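(* Let $\mathcal{K}$ be a flag triangulation, with vertex set $[m]$, of a $d$-manifold (closed, i.e. compact without boundary). Let $\mathcal{L}$ be a simplicial complex on $[m]$ such that $\mathrm{sk}_i\mathcal{K}\subset\mathcal{L}\subset\mathrm{sk}_j\mathcal{K}$ for some $i,j$ with $1\leq i\leq j\leq d$. Then $i+1\leq\mathrm{cat}(\mathcal{Z}_{\mathcal{L}})\leq j+1$. In particular, $\mathrm{cat}(\mathcal{Z}_{\mathrm{sk}_i\mathcal{K}})=i+1$.
   Context: A simplicial complex on $[m]=\{1,\dots,m\}$ is a non-empty collection of subsets (faces) of $[m]$ closed under taking subsets; all $\{i\}$, $i\in[m]$, are assumed to be faces. It is flag if every minimal non-face has two elements. The $i$-skeleton is $\mathrm{sk}_i\mathcal{K}=\{I\in\mathcal{K}:|I|\le i+1\}$. For a simplicial complex $\mathcal{L}$ on $[m]$, the moment-angle complex is $\mathcal{Z}_{\mathcal{L}}=\bigcup_{I\in\mathcal{L}}\left(\prod_{i\in I}D^2\times\prod_{i\notin I}S^1\right)\subset(D^2)^m$. The LS-category $\mathrm{cat}(X)$ is the smallest integer $n$ such that there is an open covering $X=U_0\cup\dots\cup U_n$ with every inclusion $U_i\hookrightarrow X$ null-homotopic. *)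

theory Defs
  imports "HOL-Analysis.Analysis" "HOL-Library.Extended_Nat"
begin

definition simplicial_complex_on :: "nat \<Rightarrow> nat set set \<Rightarrow> bool" where
  "simplicial_complex_on m K \<longleftrightarrow>
     K \<noteq> {} \<and> K \<subseteq> Pow {1..m} \<and> (\<forall>I\<in>K. \<forall>J. J \<subseteq> I \<longrightarrow> J \<in> K) \<and> (\<forall>i\<in>{1..m}. {i} \<in> K)"

definition minimal_nonface :: "nat \<Rightarrow> nat set set \<Rightarrow> nat set \<Rightarrow> bool" where
  "minimal_nonface m K J \<longleftrightarrow> J \<subseteq> {1..m} \<and> J \<notin> K \<and> (\<forall>J'. J' \<subset> J \<longrightarrow> J' \<in> K)"

definition flag_complex :: "nat \<Rightarrow> nat set set \<Rightarrow> bool" where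
  "flag_complex m K \<longleftrightarrow> (\<forall>J. minimal_nonface m K J \<longrightarrow> card J = 2)"

definition skeleton :: "nat \<Rightarrow> nat set set \<Rightarrow> nat set set" where
  "skeleton i K = {I \<in> K. card I \<le> i + 1}"

text \<open>
  Points of the geometric realization are given by barycentric coordinates: vertex \<open>i\<close> is the
  \<open>i\<close>-th unit vector, and coordinates outside \<open>{1..m}\<close> vanish because the support is a face.
\<close>

definition geometric_realization :: "nat \<Rightarrow> nat set set \<Rightarrow> (nat \<Rightarrow> real) topology" where
  "geometric_realization m K =
     subtopology (powertop_real UNIV)
       {x. (\<forall>i. 0 \<le> x i) \<and> (\<Sum>i=1..m. x i) = 1 \<and> {i. x i \<noteq> 0} \<in> K}"

text \<open>Connectedness is not required, and the empty space is allowed.\<close>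

definition closed_manifold :: "nat \<Rightarrow> 'a topology \<Rightarrow> bool" where
  "closed_manifold d M \<longleftrightarrow>
     Hausdorff_space M \<and> second_countable M \<and> compact_space M \<and>
     (\<forall>x \<in> topspace M. \<exists>U V. openin M U \<and> x \<in> U \<and> openin (Euclidean_space d) V \<and>
        subtopology M U homeomorphic_space subtopology (Euclidean_space d) V)"

definition triangulation_of :: "nat \<Rightarrow> nat set set \<Rightarrow> 'a topology \<Rightarrow> bool" where
  "triangulation_of m K M \<longleftrightarrow>
     simplicial_complex_on m K \<and> geometric_realization m K homeomorphic_space M"

definition moment_angle_complex :: "nat \<Rightarrow> nat set set \<Rightarrow> (nat \<Rightarrow> complex) topology" where
  "moment_angle_complex m L =
     subtopology (product_topology (\<lambda>i. top_of_set (cball 0 1)) {1..m})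
       (\<Union>I\<in>L. \<Pi>\<^sub>E i\<in>{1..m}. if i \<in> I then cball 0 1 else sphere 0 1)"

definition null_homotopic :: "'a topology \<Rightarrow> 'b topology \<Rightarrow> ('a \<Rightarrow> 'b) \<Rightarrow> bool" where
  "null_homotopic X Y f \<longleftrightarrow> (\<exists>c \<in> topspace Y. homotopic_with (\<lambda>h. True) X Y f (\<lambda>x. c))"

definition categorical_cover :: "'a topology \<Rightarrow> nat \<Rightarrow> (nat \<Rightarrow> 'a set) \<Rightarrow> bool" where
  "categorical_cover X n U \<longleftrightarrow>
     (\<forall>k\<le>n. openin X (U k) \<and> null_homotopic (subtopology X (U k)) X (\<lambda>x. x)) \<and>
     topspace X = (\<Union>k\<le>n. U k)"

text \<open>The normalised LS-category; it is \<open>\<infinity>\<close> if no finite categorical cover exists.\<close>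

definition ls_cat :: "'a topology \<Rightarrow> enat" where
  "ls_cat X = Inf {enat n |n. \<exists>U. categorical_cover X n U}"

end

theory Submission
  imports Defs "HOL-Homology.Invariance_of_Domain"
begin

text \<open>
  Upper bound: if all faces of \<open>L\<close> have at most \<open>n\<close> vertices, then every point of the moment-angle
  complex avoids one of \<open>n + 1\<close> prescribed radii in \<open>(0, 1)\<close> in all its coordinates, and the set of points
  avoiding a given radius is contractible in the complex.

  Lower bound: by invariance of domain the triangulation is a pure complex in which every ridge lies
  in exactly two facets. Restricting to the link of a face, we get vertices \<open>V\<close> on which \<open>L\<close> is a mod 2 cycle of
  dimension \<open>i\<close>. Choose a facet \<open>\<sigma>\<close> of it; by flagness every \<open>v \<in> V - \<sigma>\<close> is
  nonadjacent to some \<open>\<kappa> v \<in> \<sigma>\<close>. This partitions \<open>V\<close> into classes indexed by \<open>a \<in> \<sigma>\<close>, each of which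
  gives a map to a sphere (a product of reduced classes of degree zero of \<open>L\<close>, in Hochster's
  description of the cohomology). Given \<open>i + 1\<close> categorical open sets, deform the identity
  separately for each \<open>a \<in> \<sigma>\<close> so that one of these sets ends at the basepoint. The combined map to the product of
  the spheres starts with exactly one preimage of a generic point and ends with none, since at the end every
  point is sent to a basepoint in some factor. A Sperner count modulo 2 on a grid times the time
  interval shows that this is impossible.
\<close>

section \<open>Triangulated manifolds\<close>

text \<open>For \<open>a \<in> \<sigma>\<close> let J_a consist of a and all v with
  \<open>\<kappa> v = a\<close>. In the restriction of L to J_a the vertex a is isolated, so its
  indicator is a reduced cocycle of degree 0; it yields a class of degree |J_a| + 1 on the
  moment-angle complex. These degrees add up to |V| + i + 1, the dimension of the cells over the
  facets of the cycle, so the product is detected by counting preimages of one point: -1/2 in the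
  discs at \<open>\<sigma>\<close>, -1 at all other vertices. It is cut out by |V| + i + 1
  conditions: the sign of an imaginary part for each \<open>v \<in> V\<close> and a radius for each
  \<open>a \<in> \<sigma>\<close>. The obstacle is that the homotopies for different a are
  unrelated: after time 0 the combined coordinates need not form a point of the moment-angle
  complex. The only face condition that survives is the one between v and \<open>\<kappa> v\<close>,
  whose coordinates move by the same homotopy. It is just enough to keep the counted preimages away
  from the region where some real part is nonnegative. Counting modulo 2 requires no orientation and
  reduces the argument to finite combinatorics on a fine grid.\<close>

lemma simplicial_complex_onD:
  assumes "simplicial_complex_on m L"
  shows "{} \<in> L" "I \<in> L \<Longrightarrow> I \<subseteq> {1..m}" "I \<in> L \<Longrightarrow> J \<subseteq> I \<Longrightarrow> J \<in> L" "v \<in> {1..m} \<Longrightarrow> {v} \<in> L"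
proof -
  have "L \<noteq> {}" and sub: "\<And>I J. I \<in> L \<Longrightarrow> J \<subseteq> I \<Longrightarrow> J \<in> L"
    using assms by (auto simp: simplicial_complex_on_def)
  then show "{} \<in> L" by (metis empty_subsetI equals0I)
  show "I \<in> L \<Longrightarrow> J \<subseteq> I \<Longrightarrow> J \<in> L" by (rule sub)
qed (use assms in \<open>auto simp: simplicial_complex_on_def\<close>)

section \<open>Invariance of domain for locally Euclidean spaces\<close>

definition locally_Euclidean :: "nat \<Rightarrow> 'a topology \<Rightarrow> bool" where
  "locally_Euclidean d X \<longleftrightarrow> (\<forall>x \<in> topspace X. \<exists>U V. openin X U \<and> x \<in> U \<and> openin (Euclidean_space d) V \<and>
        subtopology X U homeomorphic_space subtopology (Euclidean_space d) V)"

lemma locally_Euclidean_homeomorphic: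
  assumes "X homeomorphic_space Y" "locally_Euclidean d Y"
  shows "locally_Euclidean d X"
  unfolding locally_Euclidean_def
proof
  fix x assume x: "x \<in> topspace X"
  obtain f where f: "homeomorphic_map X Y f" using assms(1) homeomorphic_space by blast
  then have "f x \<in> topspace Y" using x homeomorphic_imp_surjective_map by blast
  then obtain U V where U: "openin Y U" "f x \<in> U" "openin (Euclidean_space d) V"
    "subtopology Y U homeomorphic_space subtopology (Euclidean_space d) V"
    using assms(2) unfolding locally_Euclidean_def by blast
  define U' where "U' = {x \<in> topspace X. f x \<in> U}"
  have "openin X U'" unfolding U'_def
    using openin_continuous_map_preimage[OF homeomorphic_imp_continuous_map[OF f] U(1)] .
  moreover have "homeomorphic_map (subtopology X U') (subtopology Y U) f"
    by (rule homeomorphic_map_subtopologies_alt[OF f]) (auto simp: U'_def)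
  then have "subtopology X U' homeomorphic_space subtopology (Euclidean_space d) V"
    using U(4) homeomorphic_map_imp_homeomorphic_space homeomorphic_space_trans by blast
  ultimately show "\<exists>U V. openin X U \<and> x \<in> U \<and> openin (Euclidean_space d) V \<and>
        subtopology X U homeomorphic_space subtopology (Euclidean_space d) V"
    using U x by (intro exI[of _ U'] exI[of _ V]) (auto simp: U'_def)
qed

lemma locally_Euclidean_chart:
  assumes "locally_Euclidean d X" "x \<in> topspace X"
  obtains U V h g where "openin X U" "x \<in> U" "openin (Euclidean_space d) V"
    "continuous_map (subtopology X U) (Euclidean_space d) h" "continuous_map (subtopology (Euclidean_space d) V) X g"
    "h ` U \<subseteq> V" "g ` V \<subseteq> U" "\<And>y. y \<in> U \<Longrightarrow> g (h y) = y" "\<And>y. y \<in> V \<Longrightarrow> h (g y) = y"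
proof -
  obtain U V where U: "openin X U" "x \<in> U" "openin (Euclidean_space d) V"
    "subtopology X U homeomorphic_space subtopology (Euclidean_space d) V"
    using assms unfolding locally_Euclidean_def by blast
  then obtain h g where hg: "homeomorphic_maps (subtopology X U) (subtopology (Euclidean_space d) V) h g"
    unfolding homeomorphic_space_def by blast
  have sub: "U \<subseteq> topspace X" "V \<subseteq> topspace (Euclidean_space d)" using U openin_subset by auto
  show ?thesis
    by (rule that[of U V h g])
      (use hg U sub in \<open>auto simp: homeomorphic_maps_def continuous_map_in_subtopology Int_absorb1 Int_absorb2\<close>)
qed

lemma chart_composition:
  assumes A: "openin (Euclidean_space n) A"
    and \<psi>: "continuous_map (subtopology (Euclidean_space n) A) X \<psi>" "inj_on \<psi> A"
    and U: "openin X U" and h: "continuous_map (subtopology X U) Y h" "inj_on h U"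
  defines "A' \<equiv> {a \<in> A. \<psi> a \<in> U}"
  shows "openin (Euclidean_space n) A'" "continuous_map (subtopology (Euclidean_space n) A') Y (h \<circ> \<psi>)"
    "inj_on (h \<circ> \<psi>) A'"
proof -
  have AE: "A \<subseteq> topspace (Euclidean_space n)" using A openin_subset by auto
  have "openin (subtopology (Euclidean_space n) A) {a \<in> topspace (subtopology (Euclidean_space n) A). \<psi> a \<in> U}"
    by (rule openin_continuous_map_preimage[OF \<psi>(1) U])
  moreover have "{a \<in> topspace (subtopology (Euclidean_space n) A). \<psi> a \<in> U} = A'" using AE by (auto simp: A'_def)
  ultimately show "openin (Euclidean_space n) A'" using A openin_trans_full by auto
  have "continuous_map (subtopology (Euclidean_space n) A') (subtopology X U) \<psi>"
    using continuous_map_from_subtopology_mono[OF \<psi>(1), of A'] by (auto simp: continuous_map_in_subtopology A'_def)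
  from continuous_map_compose[OF this h(1)]
  show "continuous_map (subtopology (Euclidean_space n) A') Y (h \<circ> \<psi>)" .
  have "\<psi> ` A' \<subseteq> U" "A' \<subseteq> A" by (auto simp: A'_def)
  then show "inj_on (h \<circ> \<psi>) A'"
    using \<psi>(2) h(2) by (meson comp_inj_on inj_on_subset)
qed

text \<open>Invariance of domain, read in a chart around each image point.\<close>

lemma openin_injective_image:
  assumes X: "locally_Euclidean d X" and A: "openin (Euclidean_space d) A"
    and \<psi>: "continuous_map (subtopology (Euclidean_space d) A) X \<psi>" "inj_on \<psi> A"
  shows "openin X (\<psi> ` A)"
proof (subst openin_subopen, intro ballI)
  fix x assume "x \<in> \<psi> ` A"
  then obtain a where a: "a \<in> A" "x = \<psi> a" by blast
  have AE: "A \<subseteq> topspace (Euclidean_space d)" using A openin_subset by auto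
  have "x \<in> topspace X" using a AE continuous_map_image_subset_topspace[OF \<psi>(1)] by auto
  from locally_Euclidean_chart[OF X this] obtain U V h g where U: "openin X U" "x \<in> U" "openin (Euclidean_space d) V"
    "continuous_map (subtopology X U) (Euclidean_space d) h" "continuous_map (subtopology (Euclidean_space d) V) X g"
    "h ` U \<subseteq> V" "g ` V \<subseteq> U" and gh: "\<And>y. y \<in> U \<Longrightarrow> g (h y) = y" and hg: "\<And>y. y \<in> V \<Longrightarrow> h (g y) = y" by metis
  define A' where "A' = {a \<in> A. \<psi> a \<in> U}"
  have UX: "U \<subseteq> topspace X" using U(1) openin_subset by auto
  have "inj_on h U" by (rule inj_on_inverseI[of U g]) (rule gh)
  note c = chart_composition[OF A \<psi> U(1,4) this, folded A'_def]
  have "openin (Euclidean_space d) ((h \<circ> \<psi>) ` A')"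
    by (rule invariance_of_domain_Euclidean_space[OF c])
  then have "openin (subtopology X U) {y \<in> topspace (subtopology X U). h y \<in> (h \<circ> \<psi>) ` A'}"
    by (rule openin_continuous_map_preimage[OF U(4)])
  then have "openin X {y \<in> topspace (subtopology X U). h y \<in> (h \<circ> \<psi>) ` A'}"
    using U(1) openin_trans_full by blast
  moreover have "{y \<in> topspace (subtopology X U). h y \<in> (h \<circ> \<psi>) ` A'} = \<psi> ` A'"
  proof (intro equalityI subsetI)
    fix y assume "y \<in> {y \<in> topspace (subtopology X U). h y \<in> (h \<circ> \<psi>) ` A'}"
    then obtain b where "y \<in> U" "b \<in> A'" "h y = h (\<psi> b)" by auto
    moreover have "\<psi> b \<in> U" using \<open>b \<in> A'\<close> by (simp add: A'_def)
    ultimately have "y = \<psi> b" by (metis gh)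
    then show "y \<in> \<psi> ` A'" using \<open>b \<in> A'\<close> by simp
  qed (use UX in \<open>auto simp: A'_def\<close>)
  ultimately show "\<exists>T. openin X T \<and> x \<in> T \<and> T \<subseteq> \<psi> ` A"
    using a U(2) by (intro exI[of _ "\<psi> ` A'"]) (auto simp: A'_def)
qed

text \<open>Invariance of domain again, with the chart now on the source side.\<close>

lemma openin_injective_image_Euclidean:
  assumes X: "locally_Euclidean d X" and W: "openin X W"
    and \<kappa>: "continuous_map (subtopology X W) (Euclidean_space d) \<kappa>" "inj_on \<kappa> W"
  shows "openin (Euclidean_space d) (\<kappa> ` W)"
proof (subst openin_subopen, intro ballI)
  fix z assume "z \<in> \<kappa> ` W"
  then obtain x where x: "x \<in> W" "z = \<kappa> x" by blast
  then have "x \<in> topspace X" using W openin_subset by blast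
  from locally_Euclidean_chart[OF X this] obtain U V h g where U: "openin X U" "x \<in> U" "openin (Euclidean_space d) V"
    "continuous_map (subtopology X U) (Euclidean_space d) h" "continuous_map (subtopology (Euclidean_space d) V) X g"
    "h ` U \<subseteq> V" "g ` V \<subseteq> U" and gh: "\<And>y. y \<in> U \<Longrightarrow> g (h y) = y" and hg: "\<And>y. y \<in> V \<Longrightarrow> h (g y) = y" by metis
  have VE: "V \<subseteq> topspace (Euclidean_space d)" using U(3) openin_subset by auto
  define A where "A = {y \<in> V. g y \<in> W}"
  have "openin (subtopology (Euclidean_space d) V) {y \<in> topspace (subtopology (Euclidean_space d) V). g y \<in> W}"
    by (rule openin_continuous_map_preimage[OF U(5) W])
  moreover have "{y \<in> topspace (subtopology (Euclidean_space d) V). g y \<in> W} = A" using VE by (auto simp: A_def)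
  ultimately have A: "openin (Euclidean_space d) A" using U(3) openin_trans_full by auto
  have "continuous_map (subtopology (Euclidean_space d) A) (subtopology X W) g"
    using continuous_map_from_subtopology_mono[OF U(5), of A] by (auto simp: continuous_map_in_subtopology A_def)
  from continuous_map_compose[OF this \<kappa>(1)]
  have "openin (Euclidean_space d) ((\<kappa> \<circ> g) ` A)"
  proof (rule invariance_of_domain_Euclidean_space[OF A])
    show "inj_on (\<kappa> \<circ> g) A"
    proof (rule inj_onI)
      fix a b assume ab: "a \<in> A" "b \<in> A" "(\<kappa> \<circ> g) a = (\<kappa> \<circ> g) b"
      then have "g a = g b" using \<kappa>(2) by (auto simp: A_def inj_on_def)
      moreover have "a \<in> V" "b \<in> V" using ab by (auto simp: A_def)
      ultimately show "a = b" by (metis hg)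
    qed
  qed
  moreover have "z \<in> (\<kappa> \<circ> g) ` A"
    using x U(2,6) gh[of x] by (intro image_eqI[of _ _ "h x"]) (auto simp: A_def)
  moreover have "(\<kappa> \<circ> g) ` A \<subseteq> \<kappa> ` W" by (auto simp: A_def)
  ultimately show "\<exists>T. openin (Euclidean_space d) T \<and> z \<in> T \<and> T \<subseteq> \<kappa> ` W" by blast
qed

text \<open>Serves to refute openness: a set in which some point attains the minimum of coordinate
  \<open>c\<close> cannot be open.\<close>

lemma openin_Euclidean_space_perturb:
  assumes S: "openin (Euclidean_space d) S" "x \<in> S" and c: "c < d"
  obtains t where "t > 0" "x(c := x c - t) \<in> S"
proof -
  define f where "f t = x(c := x c - t)" for t :: real
  have x: "\<forall>i\<ge>d. x i = 0" using S openin_subset[OF S(1)] by (auto simp: topspace_Euclidean_space)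
  have "continuous_map euclideanreal (Euclidean_space d) f"
    unfolding Euclidean_space_def continuous_map_in_subtopology continuous_map_componentwise_UNIV
  proof (intro conjI allI)
    show "continuous_map euclideanreal euclideanreal (\<lambda>t. f t k)" for k
      by (cases "k = c") (auto simp: f_def intro!: continuous_intros)
    show "f \<in> topspace euclideanreal \<rightarrow> {x. \<forall>i\<ge>d. x i = 0}" using x c by (auto simp: f_def)
  qed
  from openin_continuous_map_preimage[OF this S(1)] have "open {t. f t \<in> S}" by simp
  moreover have "f 0 \<in> S" using S(2) by (simp add: f_def)
  ultimately obtain e where "e > 0" "\<And>t. \<bar>t\<bar> < e \<Longrightarrow> f t \<in> S"
    unfolding open_dist by (force simp: dist_real_def)
  then have "f (e / 2) \<in> S" by simp
  then show ?thesis using that[of "e / 2"] \<open>e > 0\<close> by (simp add: f_def)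
qed

text \<open>If \<open>d < n\<close>, a chart makes \<open>\<psi>\<close> an injection of an open set
  into the hyperplane of the larger space where coordinate \<open>d\<close> vanishes, although its
  image must be open.\<close>

lemma dimension_le_locally_Euclidean:
  assumes X: "locally_Euclidean d X" and A: "openin (Euclidean_space n) A" "A \<noteq> {}"
    and \<psi>: "continuous_map (subtopology (Euclidean_space n) A) X \<psi>" "inj_on \<psi> A"
  shows "n \<le> d"
proof (rule ccontr)
  assume "\<not> n \<le> d"
  then have dn: "d < n" by simp
  obtain a where a: "a \<in> A" using A by blast
  have AE: "A \<subseteq> topspace (Euclidean_space n)" using A openin_subset by auto
  then have "\<psi> a \<in> topspace X" using a continuous_map_image_subset_topspace[OF \<psi>(1)] by auto
  from locally_Euclidean_chart[OF X this] obtain U V h g where U: "openin X U" "\<psi> a \<in> U" "openin (Euclidean_space d) V"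
    "continuous_map (subtopology X U) (Euclidean_space d) h" "continuous_map (subtopology (Euclidean_space d) V) X g"
    "h ` U \<subseteq> V" "g ` V \<subseteq> U" and gh: "\<And>y. y \<in> U \<Longrightarrow> g (h y) = y" and hg: "\<And>y. y \<in> V \<Longrightarrow> h (g y) = y" by metis
  define A' where "A' = {a \<in> A. \<psi> a \<in> U}"
  have "inj_on h U" by (rule inj_on_inverseI[of U g]) (rule gh)
  note c = chart_composition[OF A(1) \<psi> U(1,4) this, folded A'_def]
  have "continuous_map (subtopology (Euclidean_space n) A') (Euclidean_space n) (h \<circ> \<psi>)"
    using c(2) dn unfolding Euclidean_space_def continuous_map_in_subtopology by (auto simp: Pi_iff)
  then have "openin (Euclidean_space n) ((h \<circ> \<psi>) ` A')"
    by (rule invariance_of_domain_Euclidean_space[OF c(1) _ c(3)])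
  moreover have flat: "y d = 0" if "y \<in> (h \<circ> \<psi>) ` A'" for y
  proof -
    have "A' \<subseteq> topspace (Euclidean_space n)" using AE by (auto simp: A'_def)
    then have "y \<in> topspace (Euclidean_space d)"
      using that continuous_map_image_subset_topspace[OF c(2)] by auto
    then show ?thesis by (simp add: topspace_Euclidean_space)
  qed
  moreover have "(h \<circ> \<psi>) a \<in> (h \<circ> \<psi>) ` A'" using a U(2) by (auto simp: A'_def)
  ultimately obtain t where t: "t > 0" "((h \<circ> \<psi>) a)(d := (h \<circ> \<psi>) a d - t) \<in> (h \<circ> \<psi>) ` A'"
    using openin_Euclidean_space_perturb[OF _ _ dn] by metis
  then show False using flat[OF t(2)] flat[OF \<open>(h \<circ> \<psi>) a \<in> (h \<circ> \<psi>) ` A'\<close>] by simp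
qed

section \<open>Open stars and pages in the geometric realization\<close>

lemma topspace_geometric_realization:
  "topspace (geometric_realization m K) = {x. (\<forall>i. 0 \<le> x i) \<and> (\<Sum>i=1..m. x i) = 1 \<and> {i. x i \<noteq> 0} \<in> K}"
  by (simp add: geometric_realization_def)

lemma continuous_map_into_geometric_realization:
  "continuous_map Y (geometric_realization m K) f \<longleftrightarrow>
    (\<forall>v. continuous_map Y euclideanreal (\<lambda>y. f y v)) \<and> f ` topspace Y \<subseteq> topspace (geometric_realization m K)"
  unfolding topspace_geometric_realization geometric_realization_def continuous_map_in_subtopology continuous_map_componentwise_UNIV
  by (simp add: image_subset_iff_funcset)

lemma continuous_map_barycentric: "continuous_map (geometric_realization m K) euclideanreal (\<lambda>y. y v)"
  using continuous_map_into_geometric_realization[of "geometric_realization m K" m K "\<lambda>y. y"] by simp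

definition open_star :: "nat \<Rightarrow> nat set set \<Rightarrow> nat set \<Rightarrow> (nat \<Rightarrow> real) set" where
  "open_star m K \<tau> = {y \<in> topspace (geometric_realization m K). \<forall>v\<in>\<tau>. 0 < y v}"

lemma openin_open_star:
  assumes "finite \<tau>"
  shows "openin (geometric_realization m K) (open_star m K \<tau>)"
proof -
  let ?X = "geometric_realization m K"
  have "openin ?X {y \<in> topspace ?X. y v \<in> {0<..}}" for v
    by (rule openin_continuous_map_preimage[OF continuous_map_barycentric]) simp
  then have "openin ?X (topspace ?X \<inter> (\<Inter>v\<in>\<tau>. {y \<in> topspace ?X. y v \<in> {0<..}}))"
    using assms by (intro openin_Int_Inter) auto
  also have "topspace ?X \<inter> (\<Inter>v\<in>\<tau>. {y \<in> topspace ?X. y v \<in> {0<..}}) = open_star m K \<tau>"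
    by (auto simp: open_star_def)
  finally show ?thesis .
qed

definition barycenter :: "nat set \<Rightarrow> nat \<Rightarrow> real" where
  "barycenter \<tau> v = (if v \<in> \<tau> then 1 / card \<tau> else 0)"

lemma barycenter_in_open_star:
  assumes K: "simplicial_complex_on m K" and \<tau>: "\<tau> \<in> K" "\<tau> \<noteq> {}"
  shows "barycenter \<tau> \<in> open_star m K \<tau>"
proof -
  have sub: "\<tau> \<subseteq> {1..m}" using simplicial_complex_onD(2)[OF K \<tau>(1)] .
  then have fin: "finite \<tau>" using finite_subset by blast
  then have pos: "card \<tau> > 0" using \<tau>(2) by (simp add: card_gt_0_iff)
  have "(\<Sum>i=1..m. barycenter \<tau> i) = (\<Sum>i\<in>\<tau>. barycenter \<tau> i)"
    using sub by (intro sum.mono_neutral_right) (auto simp: barycenter_def)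
  also have "\<dots> = 1" using pos by (simp add: barycenter_def)
  finally have "(\<Sum>i=1..m. barycenter \<tau> i) = 1" .
  moreover have "{i. barycenter \<tau> i \<noteq> 0} = \<tau>" using pos fin by (auto simp: barycenter_def)
  ultimately show ?thesis
    using \<tau>(1) pos by (simp add: open_star_def topspace_geometric_realization) (simp add: barycenter_def)
qed

text \<open>Local coordinates on the open star of a face \<open>\<tau>\<close> all of whose proper cofaces add the one
  vertex \<open>w\<close>: these would map it homeomorphically onto a set contained in a half-space.\<close>

lemma page_not_locally_Euclidean:
  assumes K: "simplicial_complex_on m K" and X: "locally_Euclidean d (geometric_realization m K)"
    and \<tau>: "\<tau> \<in> K" "card \<tau> = Suc n" and nd: "n < d" and w: "w \<notin> \<tau>"
    and page: "\<And>I. I \<in> K \<Longrightarrow> \<tau> \<subseteq> I \<Longrightarrow> I \<subseteq> insert w \<tau>"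
  shows False
proof -
  let ?X = "geometric_realization m K"
  let ?W = "open_star m K \<tau>"
  have sub: "\<tau> \<subseteq> {1..m}" using simplicial_complex_onD(2)[OF K \<tau>(1)] .
  then have fin: "finite \<tau>" using finite_subset by blast
  have ne: "\<tau> \<noteq> {}" using \<tau>(2) by auto
  obtain t where t: "bij_betw t {..n} \<tau>"
    using ex_bij_betw_nat_finite[OF fin] \<tau>(2) by (metis atLeast0LessThan lessThan_Suc_atMost)
  \<comment> \<open>The weight of \<open>t n\<close> is dropped because the sum 1 determines it.
    Coordinate \<open>n\<close> carries the weight of \<open>w\<close>, which is 0 at the barycenter
    and nowhere negative.\<close>
  define \<kappa> where "\<kappa> y = (\<lambda>i. if i < d then (if i < n then y (t i) else if i = n then y w else 0) else 0)" for y :: "nat \<Rightarrow> real"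
  have W: "openin ?X ?W" by (rule openin_open_star[OF fin])
  have supp: "{i. y i \<noteq> 0} \<subseteq> insert w \<tau>" "\<forall>i. 0 \<le> y i" "(\<Sum>i=1..m. y i) = 1" if "y \<in> ?W" for y
  proof -
    have y: "\<forall>i. 0 \<le> y i" "(\<Sum>i=1..m. y i) = 1" "{i. y i \<noteq> 0} \<in> K" "\<forall>v\<in>\<tau>. 0 < y v"
      using that by (auto simp: open_star_def topspace_geometric_realization)
    then show "{i. y i \<noteq> 0} \<subseteq> insert w \<tau>" using page[OF y(3)] by force
  qed (use that in \<open>auto simp: open_star_def topspace_geometric_realization\<close>)
  have "openin (Euclidean_space d) (\<kappa> ` ?W)"
  proof (rule openin_injective_image_Euclidean[OF X W])
    show "continuous_map (subtopology ?X ?W) (Euclidean_space d) \<kappa>"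
      unfolding \<kappa>_def continuous_map_componentwise_Euclidean_space
    proof (intro allI impI)
      fix i
      show "continuous_map (subtopology ?X ?W) euclideanreal (\<lambda>y. if i < n then y (t i) else if i = n then y w else 0)"
        by (cases "i < n"; cases "i = n") (auto intro: continuous_map_from_subtopology continuous_map_barycentric)
    qed
    show "inj_on \<kappa> ?W"
    proof (rule inj_onI)
      fix y z assume yz: "y \<in> ?W" "z \<in> ?W" "\<kappa> y = \<kappa> z"
      have a: "y (t i) = z (t i)" if "i < n" for i
        using fun_cong[OF yz(3), of i] that nd by (simp add: \<kappa>_def)
      have b: "y w = z w" using fun_cong[OF yz(3), of n] nd by (simp add: \<kappa>_def)
      have eq: "y v = z v" if "v \<noteq> t n" for v
      proof (cases "v \<in> \<tau>")
        case True
        then obtain i where "i \<le> n" "v = t i" using t by (auto simp: bij_betw_def)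
        then show ?thesis using a that by (cases "i = n") auto
      next
        case False
        then have "v \<noteq> w \<Longrightarrow> y v = 0 \<and> z v = 0" using supp(1)[OF yz(1)] supp(1)[OF yz(2)] by blast
        then show ?thesis using b by (cases "v = w") auto
      qed
      have tn: "t n \<in> {1..m}" using t sub by (auto simp: bij_betw_def)
      have "(\<Sum>i=1..m. y i) = y (t n) + (\<Sum>i\<in>{1..m}-{t n}. y i)" "(\<Sum>i=1..m. z i) = z (t n) + (\<Sum>i\<in>{1..m}-{t n}. z i)"
        using tn by (simp_all add: sum.remove)
      moreover have "(\<Sum>i\<in>{1..m}-{t n}. y i) = (\<Sum>i\<in>{1..m}-{t n}. z i)" using eq by (intro sum.cong) auto
      ultimately have "y (t n) = z (t n)" using supp(3)[OF yz(1)] supp(3)[OF yz(2)] by linarith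
      then show "y = z" using eq by (metis ext)
    qed
  qed
  moreover have b: "barycenter \<tau> \<in> ?W" by (rule barycenter_in_open_star[OF K \<tau>(1) ne])
  then have "\<kappa> (barycenter \<tau>) \<in> \<kappa> ` ?W" by simp
  ultimately obtain s where s: "s > 0" "(\<kappa> (barycenter \<tau>))(n := \<kappa> (barycenter \<tau>) n - s) \<in> \<kappa> ` ?W"
    using openin_Euclidean_space_perturb[OF _ _ nd] by metis
  then obtain y where y: "y \<in> ?W" "(\<kappa> (barycenter \<tau>))(n := \<kappa> (barycenter \<tau>) n - s) = \<kappa> y" by auto
  have "\<kappa> y n = - s" using fun_cong[OF y(2), of n] w nd by (simp add: \<kappa>_def barycenter_def)
  then have "y w < 0" using s(1) nd by (simp add: \<kappa>_def)
  then show False using supp(2)[OF y(1)] by (meson not_less)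
qed

text \<open>The open simplex on \<open>\<tau>\<close>, opened up along \<open>g\<close> into directions outside \<open>\<tau>\<close>; \<open>g = 0\<close> gives the
  simplex itself, and two pages of a book around \<open>\<tau>\<close> arise from the positive and negative part of a
  coordinate.\<close>

lemma simplex_parametrization:
  assumes K: "simplicial_complex_on m K" and \<tau>: "\<tau> \<subseteq> {1..m}" "bij_betw t {..n} \<tau>" and nN: "n \<le> N"
    and g: "\<And>v. continuous_map (Euclidean_space N) euclideanreal (\<lambda>x. g x v)"
      "\<And>x v. 0 \<le> g x v" "\<forall>x v. g x v \<noteq> 0 \<longrightarrow> v \<in> {1..m} - \<tau>"
      "\<And>x. \<tau> \<union> {v. g x v \<noteq> 0} \<in> K" "\<And>v. g (\<lambda>i. if i < n then 1 / Suc n else 0) v = 0"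
      "\<forall>x\<in>topspace (Euclidean_space N). \<forall>y\<in>topspace (Euclidean_space N).
        g x = g y \<longrightarrow> (\<forall>i<n. x i = y i) \<longrightarrow> x = y"
  defines "G \<equiv> \<lambda>x. (\<Sum>i<n. x i) + (\<Sum>v\<in>{1..m}. g x v)"
  defines "A \<equiv> {x \<in> topspace (Euclidean_space N). (\<forall>i<n. 0 < x i) \<and> G x < 1}"
  defines "\<psi> \<equiv> \<lambda>x v. if v \<in> \<tau> then (if inv_into {..n} t v < n then x (inv_into {..n} t v) else 1 - G x) else g x v"
  shows "openin (Euclidean_space N) A"
    "continuous_map (subtopology (Euclidean_space N) A) (geometric_realization m K) \<psi>" "inj_on \<psi> A"
    "barycenter \<tau> \<in> \<psi> ` A"
proof -
  \<comment> \<open>\<open>?b\<close> is the preimage of the barycenter: weight 1 / (n + 1) at the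
    first n vertices leaves the same weight for the last one.\<close>
  let ?E = "Euclidean_space N" and ?b = "\<lambda>i. if i < n then 1 / Suc n else 0 :: real"
  have cx: "continuous_map ?E euclideanreal (\<lambda>x. x i)" for i
    by (auto simp: Euclidean_space_def intro: continuous_map_product_projection continuous_map_from_subtopology)
  have cG: "continuous_map ?E euclideanreal G"
    unfolding G_def by (intro continuous_intros cx g(1)) auto
  have "openin ?E {x \<in> topspace ?E. x i \<in> {0<..}}" for i
    by (rule openin_continuous_map_preimage[OF cx]) simp
  moreover have oG: "openin ?E {x \<in> topspace ?E. G x \<in> {..<1}}"
    by (rule openin_continuous_map_preimage[OF cG]) simp
  ultimately have "openin ?E ({x \<in> topspace ?E. G x \<in> {..<1}} \<inter> (\<Inter>i\<in>{..<n}. {x \<in> topspace ?E. x i \<in> {0<..}}))"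
    by (intro openin_Int_Inter) auto
  also have "{x \<in> topspace ?E. G x \<in> {..<1}} \<inter> (\<Inter>i\<in>{..<n}. {x \<in> topspace ?E. x i \<in> {0<..}}) = A"
    by (auto simp: A_def)
  finally show "openin ?E A" .
  have Gb: "G ?b = n / Suc n" using g(5) by (simp add: G_def)
  have "G ?b < 1" unfolding Gb by simp
  then have bA: "?b \<in> A"
    using nN by (auto simp: A_def topspace_Euclidean_space)
  define j where "j = inv_into {..n} t"
  have j: "j v \<le> n" "t (j v) = v" if "v \<in> \<tau>" for v
    using that \<tau>(2) inv_into_into[of v t "{..n}"] f_inv_into_f[of v t "{..n}"] by (auto simp: j_def bij_betw_def)
  have jt: "j (t i) = i" "t i \<in> \<tau>" if "i \<le> n" for i
    using that \<tau>(2) by (auto simp: j_def bij_betw_def)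
  have \<psi>t: "\<psi> x (t i) = x i" if "i < n" for x i using jt[of i] that by (simp add: \<psi>_def j_def)
  have \<psi>n: "\<psi> x (t n) = 1 - G x" for x using jt[of n] by (simp add: \<psi>_def j_def)
  have \<psi>g: "\<psi> x v = g x v" if "v \<notin> \<tau>" for x v using that by (simp add: \<psi>_def)
  have pos: "0 < \<psi> x v" if "x \<in> A" "v \<in> \<tau>" for x v
    using that by (auto simp: \<psi>_def A_def)
  have "continuous_map (subtopology ?E A) euclideanreal (\<lambda>x. \<psi> x v)" for v
    unfolding \<psi>_def
    by (cases "v \<in> \<tau>"; cases "inv_into {..n} t v < n")
      (auto intro!: continuous_map_from_subtopology continuous_intros cG g(1) cx)
  moreover have "\<psi> x \<in> topspace (geometric_realization m K)" if "x \<in> A" for x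
  proof -
    have "(\<Sum>v=1..m. \<psi> x v) = (\<Sum>v\<in>\<tau>. \<psi> x v) + (\<Sum>v\<in>{1..m}-\<tau>. \<psi> x v)"
      using \<tau>(1) by (simp add: sum.subset_diff add.commute)
    moreover have "(\<Sum>v\<in>\<tau>. \<psi> x v) = (\<Sum>i\<le>n. \<psi> x (t i))"
      using \<tau>(2) by (simp add: sum.reindex_bij_betw)
    also have "\<dots> = (\<Sum>i<n. x i) + (1 - G x)"
      using \<psi>t \<psi>n by (simp add: lessThan_Suc_atMost[symmetric])
    moreover have "(\<Sum>v\<in>{1..m}-\<tau>. \<psi> x v) = (\<Sum>v\<in>{1..m}. g x v)"
      using g(3) \<psi>g by (intro sum.mono_neutral_cong_left) auto
    ultimately have "(\<Sum>v=1..m. \<psi> x v) = 1" by (simp add: G_def)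
    moreover have "0 \<le> \<psi> x v" for v
      using pos[OF that, of v] g(2)[of x v] \<psi>g[of v x] by (cases "v \<in> \<tau>") auto
    moreover have "{v. \<psi> x v \<noteq> 0} = \<tau> \<union> {v. g x v \<noteq> 0}"
    proof (rule Set.set_eqI)
      fix v show "v \<in> {v. \<psi> x v \<noteq> 0} \<longleftrightarrow> v \<in> \<tau> \<union> {v. g x v \<noteq> 0}"
        using pos[OF that, of v] \<psi>g[of v x] by (cases "v \<in> \<tau>") auto
    qed
    ultimately show ?thesis using g(4)[of x] by (simp add: topspace_geometric_realization)
  qed
  ultimately show "continuous_map (subtopology ?E A) (geometric_realization m K) \<psi>"
    unfolding continuous_map_into_geometric_realization by auto
  show "inj_on \<psi> A"
  proof (rule inj_onI)
    fix x y assume xy: "x \<in> A" "y \<in> A" "\<psi> x = \<psi> y"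
    have "g x v = g y v" for v
    proof (cases "v \<in> \<tau>")
      case True
      then have "g x v = 0" "g y v = 0" using g(3) by blast+
      then show ?thesis by simp
    next
      case False
      then show ?thesis using \<psi>g[OF False] xy(3) by metis
    qed
    then have "g x = g y" by auto
    moreover have "\<forall>i<n. x i = y i" using \<psi>t[of _ x] \<psi>t[of _ y] xy(3) by simp
    ultimately show "x = y" using g(6) xy(1,2) unfolding A_def by blast
  qed
  have "\<psi> ?b v = barycenter \<tau> v" for v
  proof -
    have c: "card \<tau> = Suc n" using bij_betw_same_card[OF \<tau>(2)] by simp
    show ?thesis
    proof (cases "v \<in> \<tau>")
      case True
      then show ?thesis using Gb c by (auto simp: \<psi>_def barycenter_def field_simps)
    next
      case False
      then show ?thesis using g(5) by (simp add: \<psi>_def barycenter_def)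
    qed
  qed
  then show "barycenter \<tau> \<in> \<psi> ` A" using bA by (intro image_eqI[of _ _ ?b]) auto
qed

text \<open>The open simplex on \<open>\<tau>\<close> embeds an open set of a Euclidean space of
  dimension \<open>card \<tau> - 1\<close>.\<close>

lemma card_face_le:
  assumes K: "simplicial_complex_on m K" and X: "locally_Euclidean d (geometric_realization m K)"
    and \<tau>: "\<tau> \<in> K"
  shows "card \<tau> \<le> Suc d"
proof (cases "card \<tau>")
  case (Suc n)
  have sub: "\<tau> \<subseteq> {1..m}" using simplicial_complex_onD(2)[OF K \<tau>] .
  then have fin: "finite \<tau>" using finite_subset by blast
  obtain t where t: "bij_betw t {..n} \<tau>"
    using ex_bij_betw_nat_finite[OF fin] Suc by (metis atLeast0LessThan lessThan_Suc_atMost)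
  define g where "g = (\<lambda>(x :: nat \<Rightarrow> real) (v :: nat). 0 :: real)"
  have g: "\<And>v. continuous_map (Euclidean_space n) euclideanreal (\<lambda>x. g x v)"
      "\<And>x v. 0 \<le> g x v" "\<forall>x v. g x v \<noteq> 0 \<longrightarrow> v \<in> {1..m} - \<tau>"
      "\<And>x. \<tau> \<union> {v. g x v \<noteq> 0} \<in> K" "\<And>v. g (\<lambda>i. if i < n then 1 / Suc n else 0) v = 0"
      "\<forall>x\<in>topspace (Euclidean_space n). \<forall>y\<in>topspace (Euclidean_space n).
        g x = g y \<longrightarrow> (\<forall>i<n. x i = y i) \<longrightarrow> x = y"
  proof -
    show "\<forall>x\<in>topspace (Euclidean_space n). \<forall>y\<in>topspace (Euclidean_space n).
        g x = g y \<longrightarrow> (\<forall>i<n. x i = y i) \<longrightarrow> x = y"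
    proof (intro ballI impI ext)
      fix x y i assume "x \<in> topspace (Euclidean_space n)" "y \<in> topspace (Euclidean_space n)" "\<forall>i<n. x i = y i"
      then show "x i = y i" by (cases "i < n") (auto simp: topspace_Euclidean_space)
    qed
  qed (use \<tau> in \<open>auto simp: g_def\<close>)
  note p = simplex_parametrization[OF K sub t order.refl g]
  have "n \<le> d"
    by (rule dimension_le_locally_Euclidean[OF X p(1) _ p(2,3)]) (use p(4) in blast)
  then show ?thesis using Suc by simp
qed simp

text \<open>By invariance of domain two pages already contain a neighbourhood of the barycenter, yet
  a path from the barycenter into the third page leaves their union at once.\<close>

lemma three_pages_not_locally_Euclidean:
  assumes K: "simplicial_complex_on m K" and X: "locally_Euclidean (Suc n) (geometric_realization m K)"
    and \<tau>: "\<tau> \<in> K" "card \<tau> = Suc n"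
    and w: "w1 \<notin> \<tau>" "w2 \<notin> \<tau>" "w3 \<notin> \<tau>" "w1 \<noteq> w2" "w1 \<noteq> w3" "w2 \<noteq> w3"
      "insert w1 \<tau> \<in> K" "insert w2 \<tau> \<in> K" "insert w3 \<tau> \<in> K"
  shows False
proof -
  let ?X = "geometric_realization m K"
  have sub: "\<tau> \<subseteq> {1..m}" using simplicial_complex_onD(2)[OF K \<tau>(1)] .
  then have fin: "finite \<tau>" using finite_subset by blast
  have ne: "\<tau> \<noteq> {}" using \<tau>(2) by auto
  obtain t where t: "bij_betw t {..n} \<tau>"
    using ex_bij_betw_nat_finite[OF fin] \<tau>(2) by (metis atLeast0LessThan lessThan_Suc_atMost)
  have wm: "w1 \<in> {1..m}" "w2 \<in> {1..m}" "w3 \<in> {1..m}" using simplicial_complex_onD(2)[OF K] w by blast+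
  define g :: "(nat \<Rightarrow> real) \<Rightarrow> nat \<Rightarrow> real" where
    "g x v = (if v = w1 then max (x n) 0 else if v = w2 then max (- x n) 0 else 0)" for x v
  have cx: "continuous_map (Euclidean_space (Suc n)) euclideanreal (\<lambda>x. x i)" for i
    by (auto simp: Euclidean_space_def intro: continuous_map_product_projection continuous_map_from_subtopology)
  note p = simplex_parametrization[OF K sub t, of "Suc n" g]
  have g: "\<And>v. continuous_map (Euclidean_space (Suc n)) euclideanreal (\<lambda>x. g x v)"
      "\<And>x v. 0 \<le> g x v" "\<forall>x v. g x v \<noteq> 0 \<longrightarrow> v \<in> {1..m} - \<tau>"
      "\<And>x. \<tau> \<union> {v. g x v \<noteq> 0} \<in> K" "\<And>v. g (\<lambda>i. if i < n then 1 / Suc n else 0) v = 0"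
      "\<forall>x\<in>topspace (Euclidean_space (Suc n)). \<forall>y\<in>topspace (Euclidean_space (Suc n)).
        g x = g y \<longrightarrow> (\<forall>i<n. x i = y i) \<longrightarrow> x = y"
  proof -
    show "continuous_map (Euclidean_space (Suc n)) euclideanreal (\<lambda>x. g x v)" for v
      unfolding g_def by (cases "v = w1"; cases "v = w2") (auto intro!: continuous_intros cx)
    show "0 \<le> g x v" for x v by (simp add: g_def)
    show "\<forall>x v. g x v \<noteq> 0 \<longrightarrow> v \<in> {1..m} - \<tau>" using w wm by (auto simp: g_def split: if_splits)
    show "\<tau> \<union> {v. g x v \<noteq> 0} \<in> K" for x
    proof -
      have "\<tau> \<union> {v. g x v \<noteq> 0} \<subseteq> insert w1 \<tau> \<or> \<tau> \<union> {v. g x v \<noteq> 0} \<subseteq> insert w2 \<tau>"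
        by (cases "x n \<ge> 0") (auto simp: g_def split: if_splits)
      then show ?thesis using simplicial_complex_onD(3)[OF K] w by blast
    qed
    show "g (\<lambda>i. if i < n then 1 / Suc n else 0) v = 0" for v by (simp add: g_def)
    show "\<forall>x\<in>topspace (Euclidean_space (Suc n)). \<forall>y\<in>topspace (Euclidean_space (Suc n)).
        g x = g y \<longrightarrow> (\<forall>i<n. x i = y i) \<longrightarrow> x = y"
    proof (intro ballI impI ext)
      fix x y i assume h: "x \<in> topspace (Euclidean_space (Suc n))" "y \<in> topspace (Euclidean_space (Suc n))"
        "g x = g y" "\<forall>i<n. x i = y i"
      have "max (x n) 0 = max (y n) 0" "max (- x n) 0 = max (- y n) 0"
        using fun_cong[OF h(3), of w1] fun_cong[OF h(3), of w2] w by (auto simp: g_def)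
      then have "x n = y n" by (auto simp: max_def split: if_splits)
      then show "x i = y i"
        using h by (cases "i < n"; cases "i = n") (auto simp: topspace_Euclidean_space)
    qed
  qed
  note p = p[OF le_SucI[OF order.refl] g]
  define \<psi> where "\<psi> = (\<lambda>x v. if v \<in> \<tau> then if inv_into {..n} t v < n then x (inv_into {..n} t v)
     else 1 - ((\<Sum>i<n. x i) + (\<Sum>v\<in>{1..m}. g x v)) else g x v)"
  define A where "A = {x \<in> topspace (Euclidean_space (Suc n)). (\<forall>i<n. 0 < x i) \<and> (\<Sum>i<n. x i) + (\<Sum>v\<in>{1..m}. g x v) < 1}"
  note p = p[folded \<psi>_def A_def]
  have img: "openin ?X (\<psi> ` A)"
    by (rule openin_injective_image[OF X p(1,2,3)])
  \<comment> \<open>The segment from the barycenter to the vertex \<open>w3\<close>.\<close>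
  define b where "b s = (\<lambda>v. (1 - s) * barycenter \<tau> v + (if v = w3 then s else 0))" for s :: real
  have bt: "barycenter \<tau> \<in> topspace ?X"
    using barycenter_in_open_star[OF K \<tau>(1) ne] by (simp add: open_star_def)
  have "continuous_map (top_of_set {0..1}) ?X b"
    unfolding continuous_map_into_geometric_realization
  proof (intro conjI allI image_subsetI)
    show "continuous_map (top_of_set {0..1}) euclideanreal (\<lambda>s. b s v)" for v
      by (cases "v = w3") (auto simp: b_def intro!: continuous_intros)
    fix s :: real assume "s \<in> topspace (top_of_set {0..1})"
    then have s: "0 \<le> s" "s \<le> 1" by auto
    have "(\<Sum>v=1..m. b s v) = (1 - s) * (\<Sum>v=1..m. barycenter \<tau> v) + s"
      using wm by (simp add: b_def sum.distrib sum_distrib_left)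
    also have "\<dots> = 1" using bt by (simp add: topspace_geometric_realization)
    finally have "(\<Sum>v=1..m. b s v) = 1" .
    moreover have "{v. b s v \<noteq> 0} \<subseteq> insert w3 \<tau>" by (auto simp: b_def barycenter_def)
    then have "{v. b s v \<noteq> 0} \<in> K" using simplicial_complex_onD(3)[OF K w(9)] by blast
    ultimately show "b s \<in> topspace ?X" using s by (auto simp: topspace_geometric_realization b_def barycenter_def)
  qed
  from openin_continuous_map_preimage[OF this img]
  have "openin (top_of_set {0..1}) {s \<in> {0..1}. b s \<in> \<psi> ` A}" by simp
  moreover have "b 0 = barycenter \<tau>" by (auto simp: b_def)
  then have "b 0 \<in> \<psi> ` A" using p(4) by simp
  ultimately obtain e where e: "e > 0" "\<And>s. s \<in> {0..1} \<Longrightarrow> \<bar>s\<bar> < e \<Longrightarrow> b s \<in> \<psi> ` A"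
    unfolding openin_euclidean_subtopology_iff by (force simp: dist_real_def)
  define s where "s = min 1 (e / 2)"
  have "b s \<in> \<psi> ` A" using e by (intro e(2)) (auto simp: s_def)
  then obtain x where "b s = \<psi> x" by blast
  then have "b s w3 = 0" using w by (simp add: \<psi>_def g_def)
  then have "s = 0" using w(3) by (simp add: b_def barycenter_def)
  then show False using e(1) by (simp add: s_def min_def split: if_splits)
qed

section \<open>A parity lemma of Sperner type\<close>

lemma even_card_involution:
  assumes "finite S" "\<And>x. x \<in> S \<Longrightarrow> f x \<in> S" "\<And>x. x \<in> S \<Longrightarrow> f (f x) = x" "\<And>x. x \<in> S \<Longrightarrow> f x \<noteq> x"
  shows "even (card S)"
  using assms
proof (induction "card S" arbitrary: S rule: less_induct)
  case less
  show ?case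
  proof (cases "S = {}")
    case False
    then obtain x where x: "x \<in> S" by blast
    let ?S = "S - {x, f x}"
    have fx: "f x \<in> S" "f x \<noteq> x" using less.prems x by auto
    have c: "card S = card ?S + 2"
      using x fx less.prems(1) card_Diff_subset[of "{x, f x}" S] card_mono[of S "{x, f x}"] by auto
    have "even (card ?S)"
    proof (rule less.hyps)
      show "f y \<in> ?S" if "y \<in> ?S" for y
      proof -
        have y: "y \<in> S" "y \<noteq> x" "y \<noteq> f x" using that by auto
        then have "f y \<noteq> x" "f y \<noteq> f x" using less.prems(3)[OF x] less.prems(3)[OF y(1)] by metis+
        then show ?thesis using less.prems(2)[OF y(1)] by blast
      qed
    qed (use c less.prems in auto)
    then show ?thesis using c by simp
  qed simp
qed

text \<open>A simplex of the Freudenthal triangulation of a grid is a vertex \<open>x\<close> together with a distinct list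
  \<open>js\<close> of directions: its \<open>k\<close>-th vertex arises from \<open>x\<close> by steps in the first \<open>k\<close> directions.\<close>

definition chain_vertex :: "('c \<Rightarrow> int) \<Rightarrow> 'c list \<Rightarrow> nat \<Rightarrow> 'c \<Rightarrow> int" where
  "chain_vertex x js k = (\<lambda>c. x c + of_bool (c \<in> set (take k js)))"

definition rainbow :: "(('c \<Rightarrow> int) \<Rightarrow> nat) \<Rightarrow> ('c \<Rightarrow> int) \<Rightarrow> 'c list \<Rightarrow> bool" where
  "rainbow l x js \<longleftrightarrow> (\<lambda>k. l (chain_vertex x js k)) ` {..length js} = {..length js}"

text \<open>The two summands are the cubes on either side of the face in direction \<open>c\<close>.
  Modulo 2 this is the coefficient of the face in the boundary of the chain
  \<open>Y\<close>.\<close>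

definition cofaces :: "'c set \<Rightarrow> (('c \<Rightarrow> int) \<Rightarrow> 'c set \<Rightarrow> bool) \<Rightarrow> ('c \<Rightarrow> int) \<Rightarrow> 'c set \<Rightarrow> nat" where
  "cofaces C Y x J = (\<Sum>c\<in>C - J. of_bool (Y x (insert c J)) + of_bool (Y (x(c := x c - 1)) (insert c J)))"

text \<open>If some vertex qualifies, the missing label must be \<open>Suc n\<close>. Then exactly
  one label is repeated, and either of its two carriers, but no other vertex, can be
  omitted.\<close>

lemma even_card_omitted_vertices:
  fixes f :: "nat \<Rightarrow> nat"
  assumes le: "\<And>k. k \<le> Suc n \<Longrightarrow> f k \<le> Suc n" and missing: "\<exists>a\<le>Suc n. a \<notin> f ` {..Suc n}"
  shows "even (card {k. k \<le> Suc n \<and> f ` ({..Suc n} - {k}) = {..n}})" (is "even (card ?S)")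
proof (cases "?S = {}")
  case False
  then obtain k where k: "k \<le> Suc n" "f ` ({..Suc n} - {k}) = {..n}" by blast
  have img: "f ` {..Suc n} = insert (f k) {..n}"
  proof -
    have "{..Suc n} = insert k ({..Suc n} - {k})" using k(1) by auto
    then show ?thesis using k(2) by (metis image_insert)
  qed
  have fk: "f k \<le> n"
  proof (rule ccontr)
    assume "\<not> f k \<le> n"
    then have "f k = Suc n" using le[OF k(1)] by linarith
    then show False using missing img by (auto simp: atMost_Suc)
  qed
  have inj: "inj_on f ({..Suc n} - {k})"
    by (rule eq_card_imp_inj_on) (use k in auto)
  obtain q where q: "q \<le> Suc n" "q \<noteq> k" "f q = f k"
  proof -
    have "f k \<in> f ` ({..Suc n} - {k})" using fk unfolding k(2) by simp
    then obtain x where "x \<le> Suc n" "x \<noteq> k" "f k = f x" by blast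
    then show ?thesis using that[of x] by simp
  qed
  have sub: "?S \<subseteq> {k, q}"
  proof
    fix r assume r: "r \<in> ?S"
    then have "inj_on f ({..Suc n} - {r})"
      by (intro eq_card_imp_inj_on) auto
    then show "r \<in> {k, q}"
      using q k(1) by (auto simp: inj_on_def)
  qed
  have "f ` ({..Suc n} - {q}) = {..n}"
  proof -
    have "f ` ({..Suc n} - {q}) = f ` ({..Suc n} - {k})"
    proof (intro equalityI subsetI)
      fix y assume "y \<in> f ` ({..Suc n} - {q})"
      then obtain x where "x \<le> Suc n" "x \<noteq> q" "y = f x" by auto
      then show "y \<in> f ` ({..Suc n} - {k})"
        using q by (cases "x = k") (auto intro: rev_image_eqI[of q])
    next
      fix y assume "y \<in> f ` ({..Suc n} - {k})"
      then obtain x where "x \<le> Suc n" "x \<noteq> k" "y = f x" by auto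
      then show "y \<in> f ` ({..Suc n} - {q})"
        using q k(1) by (cases "x = q") (auto intro: rev_image_eqI[of k])
    qed
    then show ?thesis using k by simp
  qed
  then have "?S = {k, q}" using sub k q by blast
  then show ?thesis using q by auto
next
  case True
  then show ?thesis by (simp only: card.empty) simp
qed

lemma chain_vertex_Cons:
  "c \<notin> set js \<Longrightarrow> chain_vertex (x(c := x c - 1)) (c # js) (Suc k) = chain_vertex x js k"
  by (auto simp: chain_vertex_def fun_eq_iff dest: in_set_takeD)

lemma chain_vertex_snoc:
  "k \<le> length js \<Longrightarrow> chain_vertex x (js @ [c]) k = chain_vertex x js k"
  by (simp add: chain_vertex_def)

text \<open>Gives the other simplex of the same cube that shares the face opposite the
  \<open>k\<close>-th vertex: only that vertex moves.\<close>

definition swap_adjacent :: "nat \<Rightarrow> 'c list \<Rightarrow> 'c list" where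
  "swap_adjacent k js = js[k - 1 := js ! k, k := js ! (k - 1)]"

lemma swap_adjacent:
  assumes "0 < k" "k < length js"
  shows "length (swap_adjacent k js) = length js" "set (swap_adjacent k js) = set js"
    "distinct (swap_adjacent k js) = distinct js"
    "swap_adjacent k (swap_adjacent k js) = js"
    "distinct js \<Longrightarrow> swap_adjacent k js \<noteq> js"
proof -
  show "length (swap_adjacent k js) = length js" by (simp add: swap_adjacent_def)
  show "set (swap_adjacent k js) = set js" "distinct (swap_adjacent k js) = distinct js"
    using assms by (simp_all add: swap_adjacent_def)
  show "swap_adjacent k (swap_adjacent k js) = js"
    using assms by (intro nth_equalityI) (auto simp: swap_adjacent_def nth_list_update)
  show "swap_adjacent k js \<noteq> js" if "distinct js"
  proof
    assume "swap_adjacent k js = js"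
    then have "swap_adjacent k js ! k = js ! k" by simp
    then show False using that assms by (auto simp: swap_adjacent_def nth_eq_iff_index_eq)
  qed
qed

lemma set_take_swap_adjacent:
  assumes "0 < k" "k < length js" "i \<noteq> k"
  shows "set (take i (swap_adjacent k js)) = set (take i js)"
proof (cases "i < k")
  case True
  then have "take i (swap_adjacent k js) = take i js"
    using assms by (simp add: swap_adjacent_def)
  then show ?thesis by simp
next
  case False
  then have "take i (swap_adjacent k js) = swap_adjacent k (take i js)"
    using assms by (simp add: swap_adjacent_def take_update_swap)
  then show ?thesis using False assms swap_adjacent(2)[of k "take i js"] by simp
qed

lemma chain_vertex_swap_adjacent:
  assumes "0 < k" "k < length js" "i \<noteq> k"
  shows "chain_vertex x (swap_adjacent k js) i = chain_vertex x js i"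
  using set_take_swap_adjacent[OF assms] by (simp add: chain_vertex_def)

text \<open>Door counting. Removing an inner vertex pairs off simplices of the same cube, so modulo 2 only
  removals of the first or last vertex remain; these count cubes around a face of codimension one.\<close>

theorem sperner_parity:
  fixes Y :: "('c \<Rightarrow> int) \<Rightarrow> 'c set \<Rightarrow> bool" and l :: "('c \<Rightarrow> int) \<Rightarrow> nat"
  assumes C: "finite C" and fin: "finite {(x, J). Y x J}"
    and Y: "\<And>x J. Y x J \<Longrightarrow> J \<subseteq> C \<and> card J = Suc n"
    and le: "\<And>x. l x \<le> Suc n"
    and missing: "\<And>x js. distinct js \<Longrightarrow> Y x (set js) \<Longrightarrow>
      \<exists>a\<le>Suc n. a \<notin> (\<lambda>k. l (chain_vertex x js k)) ` {..Suc n}"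
  shows "even (card {(x, js). distinct js \<and> set js \<subseteq> C \<and> length js = n \<and> rainbow l x js \<and>
    odd (cofaces C Y x (set js))})"
proof -
  define X where "X = {(x, js). distinct js \<and> Y x (set js)}"
  define P where "P x js k \<longleftrightarrow> (\<lambda>i. l (chain_vertex x js i)) ` ({..Suc n} - {k}) = {..n}" for x js k
  define K where "K x js = {k. k \<le> Suc n \<and> P x js k}" for x js
  define D where "D = {(s, k). s \<in> X \<and> k \<in> K (fst s) (snd s)}"
  have lenX: "length js = Suc n" if "(x, js) \<in> X" for x js
    using that Y[of x "set js"] distinct_card[of js] by (simp add: X_def)
  have finX: "finite X"
  proof (rule finite_subset)
    show "X \<subseteq> fst ` {(x, J). Y x J} \<times> {js. set js \<subseteq> C \<and> length js = Suc n}"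
    proof (rule subrelI)
      fix x js assume h: "(x, js) \<in> X"
      then have "(x, set js) \<in> {(x, J). Y x J}" by (simp add: X_def)
      then show "(x, js) \<in> fst ` {(x, J). Y x J} \<times> {js. set js \<subseteq> C \<and> length js = Suc n}"
        using lenX[OF h] Y[of x "set js"] image_eqI[of x fst "(x, set js)"] by (simp add: X_def)
    qed
    show "finite (fst ` {(x, J). Y x J} \<times> {js. set js \<subseteq> C \<and> length js = Suc n})"
      using fin finite_lists_length_eq[OF C] by auto
  qed
  have finK: "finite (K x js)" for x js by (simp add: K_def)
  have DSig: "D = Sigma X (\<lambda>s. K (fst s) (snd s))" by (auto simp: D_def)
  have finD: "finite D" unfolding DSig using finX finK by blast
  have "even (card (K x js))" if "(x, js) \<in> X" for x js
    unfolding K_def P_def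
    by (rule even_card_omitted_vertices[OF le missing]) (use that X_def in auto)
  then have evenD: "even (card D)"
    unfolding DSig using finX finK by (subst card_SigmaI) (auto intro!: dvd_sum)
  define D1 where "D1 = {d \<in> D. 0 < snd d \<and> snd d < Suc n}"
  define D0 where "D0 = {d \<in> D. snd d = 0}"
  define D2 where "D2 = {d \<in> D. snd d = Suc n}"
  have "even (card D1)"
  proof (rule even_card_involution[where f = "\<lambda>((x, js), k). ((x, swap_adjacent k js), k)"])
    show "finite D1" using finD by (simp add: D1_def)
  next
    fix d assume d: "d \<in> D1"
    then obtain x js k where [simp]: "d = ((x, js), k)" and h: "(x, js) \<in> X" "k \<in> K x js" "0 < k" "k < Suc n"
      by (auto simp: D1_def D_def)
    note len = lenX[OF h(1)]
    have k: "k < length js" using h len by simp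
    have "distinct js" using h by (simp add: X_def)
    note s = swap_adjacent[OF h(3) k]
    have "(\<lambda>i. l (chain_vertex x (swap_adjacent k js) i)) ` ({..Suc n} - {k}) = (\<lambda>i. l (chain_vertex x js i)) ` ({..Suc n} - {k})"
      using chain_vertex_swap_adjacent[OF h(3) k] by (intro image_cong) auto
    then have "((x, swap_adjacent k js), k) \<in> D1"
      using s h by (auto simp: D1_def D_def X_def K_def P_def)
    then show "(\<lambda>((x, js), k). ((x, swap_adjacent k js), k)) d \<in> D1" by simp
    show "(\<lambda>((x, js), k). ((x, swap_adjacent k js), k)) ((\<lambda>((x, js), k). ((x, swap_adjacent k js), k)) d) = d"
      using s by simp
    show "(\<lambda>((x, js), k). ((x, swap_adjacent k js), k)) d \<noteq> d"
      using s \<open>distinct js\<close> by simp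
  qed
  moreover have "card D = card D1 + (card D0 + card D2)"
  proof -
    have "D = D1 \<union> (D0 \<union> D2)" by (auto simp: D1_def D0_def D2_def D_def K_def)
    moreover have "D1 \<inter> (D0 \<union> D2) = {}" "D0 \<inter> D2 = {}" by (auto simp: D1_def D0_def D2_def)
    ultimately show ?thesis
      using finD by (metis card_Un_disjoint finite_Un)
  qed
  ultimately have even02: "even (card D0 + card D2)" using evenD by presburger
  define R where "R = {(x, js). distinct js \<and> set js \<subseteq> C \<and> length js = n \<and> rainbow l x js}"
  define E0 where "E0 = {(s, c). s \<in> R \<and> c \<in> C - set (snd s) \<and> Y ((fst s)(c := fst s c - 1)) (insert c (set (snd s)))}"
  define E2 where "E2 = {(s, c). s \<in> R \<and> c \<in> C - set (snd s) \<and> Y (fst s) (insert c (set (snd s)))}"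
  \<comment> \<open>Omitting the first vertex leaves a simplex based one step further in direction
    \<open>hd js\<close>. Seen from there the cube lies below, which is the second summand of
    \<open>cofaces\<close>.\<close>
  have "bij_betw (\<lambda>((x, js), c). ((x(c := x c - 1), c # js), 0::nat)) E0 D0"
  proof (rule bij_betwI[where g = "\<lambda>((x, js), k). ((x(hd js := x (hd js) + 1), tl js), hd js)"])
    show "(\<lambda>((x, js), c). ((x(c := x c - 1), c # js), 0::nat)) \<in> E0 \<rightarrow> D0"
    proof clarify
      fix x js c assume e: "((x, js), c) \<in> E0"
      have "(\<lambda>i. l (chain_vertex (x(c := x c - 1)) (c # js) i)) ` ({..Suc n} - {0}) = (\<lambda>i. l (chain_vertex x js i)) ` {..n}"
      proof -
        have "{..Suc n} - {0} = Suc ` {..n}"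
          by (auto simp: image_iff) (metis Suc_le_mono Suc_pred atMost_iff neq0_conv)
        then show ?thesis
          using e by (auto simp: image_image chain_vertex_Cons E0_def)
      qed
      then show "((x(c := x c - 1), c # js), 0) \<in> D0"
        using e by (auto simp: E0_def D0_def D_def K_def P_def X_def R_def rainbow_def)
    qed
    show "(\<lambda>((x, js), k). ((x(hd js := x (hd js) + 1), tl js), hd js)) \<in> D0 \<rightarrow> E0"
    proof clarify
      fix x js k assume d: "((x, js), k) \<in> D0"
      then have X: "(x, js) \<in> X" and [simp]: "k = 0" and "P x js 0" by (auto simp: D0_def D_def K_def)
      obtain c js' where js: "js = c # js'" using lenX[OF X] by (cases js) auto
      define y where "y = x(c := x c + 1)"
      have xy: "x = y(c := y c - 1)" by (simp add: y_def)
      have d': "distinct js'" "c \<notin> set js'" "Y x (insert c (set js'))" "length js' = n"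
        using X js lenX[OF X] by (auto simp: X_def)
      have "(\<lambda>i. l (chain_vertex x js i)) ` ({..Suc n} - {0}) = (\<lambda>i. l (chain_vertex y js' i)) ` {..n}"
      proof -
        have "{..Suc n} - {0} = Suc ` {..n}"
          by (auto simp: image_iff) (metis Suc_le_mono Suc_pred atMost_iff neq0_conv)
        then show ?thesis
          using d' xy unfolding js by (simp add: image_image chain_vertex_Cons)
      qed
      then have "rainbow l y js'" using \<open>P x js 0\<close> d' by (simp add: P_def rainbow_def)
      then have "((y, js'), c) \<in> E0"
        using d' Y[OF d'(3)] xy by (auto simp: E0_def R_def)
      then show "((x(hd js := x (hd js) + 1), tl js), hd js) \<in> E0"
        by (simp add: js y_def)
    qed
    show "(\<lambda>((x, js), k). ((x(hd js := x (hd js) + 1), tl js), hd js)) ((\<lambda>((x, js), c). ((x(c := x c - 1), c # js), 0::nat)) e) = e"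
      if "e \<in> E0" for e
      by (cases e) (auto simp: fun_eq_iff)
    show "(\<lambda>((x, js), c). ((x(c := x c - 1), c # js), 0::nat)) ((\<lambda>((x, js), k). ((x(hd js := x (hd js) + 1), tl js), hd js)) d) = d"
      if d0: "d \<in> D0" for d
    proof -
      obtain x js where d: "d = ((x, js), 0)" "(x, js) \<in> X" using d0 by (cases d) (auto simp: D0_def D_def)
      show ?thesis using lenX[OF d(2)] d(1) by (cases js) auto
    qed
  qed
  then have c0: "card E0 = card D0" by (rule bij_betw_same_card)
  \<comment> \<open>Omitting the last vertex keeps the base, which is the first summand of
    \<open>cofaces\<close>.\<close>
  have "bij_betw (\<lambda>((x, js), c). ((x, js @ [c]), Suc n)) E2 D2"
  proof (rule bij_betwI[where g = "\<lambda>((x, js), k). ((x, butlast js), last js)"])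
    have *: "{..Suc n} - {Suc n} = {..n}" by auto
    show "(\<lambda>((x, js), c). ((x, js @ [c]), Suc n)) \<in> E2 \<rightarrow> D2"
    proof clarify
      fix x js c assume e: "((x, js), c) \<in> E2"
      then have "(\<lambda>i. l (chain_vertex x (js @ [c]) i)) ` ({..Suc n} - {Suc n}) = (\<lambda>i. l (chain_vertex x js i)) ` {..n}"
        unfolding * by (intro image_cong) (auto simp: chain_vertex_snoc E2_def R_def)
      then show "((x, js @ [c]), Suc n) \<in> D2"
        using e by (auto simp: E2_def D2_def D_def K_def P_def X_def R_def rainbow_def)
    qed
    show "(\<lambda>((x, js), k). ((x, butlast js), last js)) \<in> D2 \<rightarrow> E2"
    proof clarify
      fix x js k assume d: "((x, js), k) \<in> D2"
      then have X: "(x, js) \<in> X" and [simp]: "k = Suc n" and P: "P x js (Suc n)" by (auto simp: D2_def D_def K_def)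
      obtain c js' where js: "js = js' @ [c]" using lenX[OF X] by (cases js rule: rev_cases) auto
      have d': "distinct js'" "c \<notin> set js'" "Y x (insert c (set js'))" "length js' = n"
        using X js lenX[OF X] by (auto simp: X_def)
      have "(\<lambda>i. l (chain_vertex x js i)) ` ({..Suc n} - {Suc n}) = (\<lambda>i. l (chain_vertex x js' i)) ` {..n}"
        unfolding * js using d' by (intro image_cong) (auto simp: chain_vertex_snoc)
      then have "rainbow l x js'" using P d' by (simp add: P_def rainbow_def)
      then have "((x, js'), c) \<in> E2"
        using d' Y[OF d'(3)] by (auto simp: E2_def R_def)
      then show "((x, butlast js), last js) \<in> E2" by (simp add: js)
    qed
    show "(\<lambda>((x, js), k). ((x, butlast js), last js)) ((\<lambda>((x, js), c). ((x, js @ [c]), Suc n)) e) = e" for e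
      by (cases e) auto
    show "(\<lambda>((x, js), c). ((x, js @ [c]), Suc n)) ((\<lambda>((x, js), k). ((x, butlast js), last js)) d) = d"
      if d2: "d \<in> D2" for d
    proof -
      obtain x js where d: "d = ((x, js), Suc n)" "(x, js) \<in> X" using d2 by (cases d) (auto simp: D2_def D_def)
      show ?thesis using lenX[OF d(2)] d(1) by (cases js rule: rev_cases) auto
    qed
  qed
  then have c2: "card E2 = card D2" by (rule bij_betw_same_card)
  define F where "F s = (cofaces C Y (fst s) (set (snd s)))" for s :: "('c \<Rightarrow> int) \<times> 'c list"
  \<comment> \<open>\<open>R\<close> does not restrict the base vertex and may be infinite. Only the
    finitely many simplices with a coface in \<open>Y\<close> contribute to the sums.\<close>
  define R' where "R' = fst ` (E0 \<union> E2)"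
  have finE: "finite E0" "finite E2"
    using finD bij_betw_finite[OF \<open>bij_betw _ E0 D0\<close>] bij_betw_finite[OF \<open>bij_betw _ E2 D2\<close>]
    by (auto simp: D0_def D2_def)
  have finR': "finite R'" using finE by (simp add: R'_def)
  have R'R: "R' \<subseteq> R" by (auto simp: R'_def E0_def E2_def)
  have E0R': "(s, c) \<in> E0 \<Longrightarrow> s \<in> R'" and E2R': "(s, c) \<in> E2 \<Longrightarrow> s \<in> R'" for s c
    unfolding R'_def by (force intro: rev_image_eqI)+
  have E0: "(s, c) \<in> E0 \<longleftrightarrow> s \<in> R \<and> c \<in> C - set (snd s) \<and> Y ((fst s)(c := fst s c - 1)) (insert c (set (snd s)))"
    and E2: "(s, c) \<in> E2 \<longleftrightarrow> s \<in> R \<and> c \<in> C - set (snd s) \<and> Y (fst s) (insert c (set (snd s)))" for s c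
    by (auto simp: E0_def E2_def)
  have "card E0 = (\<Sum>s\<in>R'. card {c\<in>C - set (snd s). Y ((fst s)(c := fst s c - 1)) (insert c (set (snd s)))})"
  proof -
    have "E0 = Sigma R' (\<lambda>s. {c\<in>C - set (snd s). Y ((fst s)(c := fst s c - 1)) (insert c (set (snd s)))})"
      using R'R E0R' E0 by auto
    then show ?thesis using finR' C by (simp add: card_SigmaI)
  qed
  moreover have "card E2 = (\<Sum>s\<in>R'. card {c\<in>C - set (snd s). Y (fst s) (insert c (set (snd s)))})"
  proof -
    have "E2 = Sigma R' (\<lambda>s. {c\<in>C - set (snd s). Y (fst s) (insert c (set (snd s)))})"
      using R'R E2R' E2 by auto
    then show ?thesis using finR' C by (simp add: card_SigmaI)
  qed
  ultimately have "card E0 + card E2 = (\<Sum>s\<in>R'. F s)"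
    using C by (simp add: F_def cofaces_def sum.distrib of_bool_def sum.If_cases set_diff_eq Collect_conj_eq Int_assoc add.commute)
  then have "even (\<Sum>s\<in>R'. F s)" using even02 c0 c2 by simp
  then have "even (card {s \<in> R'. odd (F s)})"
    using finR' by (simp add: even_sum_iff)
  moreover have "{s \<in> R'. odd (F s)} = {(x, js). distinct js \<and> set js \<subseteq> C \<and> length js = n \<and> rainbow l x js \<and>
    odd (cofaces C Y x (set js))}"
  proof -
    have "s \<in> R'" if "s \<in> R" "odd (F s)" for s
    proof (rule ccontr)
      assume "s \<notin> R'"
      then have "(s, c) \<notin> E0 \<union> E2" for c using E0R' E2R' by blast
      then have "F s = 0" using that(1) unfolding F_def cofaces_def by (intro sum.neutral) (auto simp: E0 E2)
      then show False using that by simp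
    qed
    then show ?thesis using R'R by (auto simp: R_def F_def)
  qed
  ultimately show ?thesis by simp
qed

section \<open>Cubical prisms over moment-angle complexes\<close>

text \<open>\<open>U v\<close> and \<open>W v\<close> are the coordinates of a square \<open>[-1, 1]\<^sup>2\<close> parametrizing the disc at the
  vertex \<open>v\<close>; \<open>T\<close> is the time of a homotopy.\<close>

datatype coord = U nat | W nat | T

text \<open>Makes real functions on \<open>coord\<close> a metric space, so that uniform continuity
  can be applied to parameter points.\<close>

instance coord :: countable by countable_datatype

definition coords :: "nat set \<Rightarrow> coord set" where
  "coords V = U ` V \<union> W ` V"

section \<open>The subdivided square and its perimeter modulo 2\<close>

definition square_cell :: "int \<Rightarrow> int \<Rightarrow> int \<Rightarrow> bool \<Rightarrow> bool \<Rightarrow> bool" where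
  "square_cell p a b \<alpha> \<beta> \<longleftrightarrow> \<alpha> \<and> \<beta> \<and> - p \<le> a \<and> a < p \<and> - p \<le> b \<and> b < p"

definition boundary_cell :: "int \<Rightarrow> int \<Rightarrow> int \<Rightarrow> bool \<Rightarrow> bool \<Rightarrow> bool" where
  "boundary_cell p a b \<alpha> \<beta> \<longleftrightarrow>
     (\<alpha> \<and> \<not> \<beta> \<and> - p \<le> a \<and> a < p \<and> (b = - p \<or> b = p)) \<or>
     (\<not> \<alpha> \<and> \<beta> \<and> (a = - p \<or> a = p) \<and> - p \<le> b \<and> b < p)"

definition local_cofaces :: "(int \<Rightarrow> int \<Rightarrow> bool \<Rightarrow> bool \<Rightarrow> bool) \<Rightarrow> int \<Rightarrow> int \<Rightarrow> bool \<Rightarrow> bool \<Rightarrow> nat" where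
  "local_cofaces Q a b \<alpha> \<beta> =
     (if \<alpha> then 0 else of_bool (Q a b True \<beta>) + of_bool (Q (a - 1) b True \<beta>)) +
     (if \<beta> then 0 else of_bool (Q a b \<alpha> True) + of_bool (Q a (b - 1) \<alpha> True))"

text \<open>An edge inside the square borders two unit squares, an edge of the perimeter only
  one.\<close>

lemma odd_local_cofaces_square:
  "p > 0 \<Longrightarrow> odd (local_cofaces (square_cell p) a b \<alpha> \<beta>) \<longleftrightarrow> boundary_cell p a b \<alpha> \<beta>"
  by (auto simp: local_cofaces_def square_cell_def boundary_cell_def)

text \<open>The perimeter is a closed curve: each of its vertices, corners included, meets two
  edges.\<close>

lemma even_local_cofaces_boundary:
  "p > 0 \<Longrightarrow> even (local_cofaces (boundary_cell p) a b \<alpha> \<beta>)"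
  by (cases \<alpha>; cases \<beta>; cases "a = p"; cases "a = - p"; cases "b = p"; cases "b = - p")
    (simp_all add: local_cofaces_def boundary_cell_def)

definition fits_at :: "int \<Rightarrow> nat set \<Rightarrow> nat \<Rightarrow> (coord \<Rightarrow> int) \<Rightarrow> coord set \<Rightarrow> bool" where
  "fits_at p S v x J \<longleftrightarrow> (if v \<in> S then square_cell p else boundary_cell p) (x (U v)) (x (W v)) (U v \<in> J) (W v \<in> J)"

definition fits :: "int \<Rightarrow> nat set \<Rightarrow> nat set \<Rightarrow> (coord \<Rightarrow> int) \<Rightarrow> coord set \<Rightarrow> bool" where
  "fits p V S x J \<longleftrightarrow> J - {T} \<subseteq> coords V \<and> (\<forall>c. c \<notin> coords V \<longrightarrow> c \<noteq> T \<longrightarrow> x c = 0) \<and> (\<forall>v\<in>V. fits_at p S v x J)"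

text \<open>A cube is given by its lowest vertex \<open>x\<close> and its set \<open>J\<close> of edge directions. The prism consists of
  the top-dimensional grid cubes of the moment-angle complex with facets \<open>F\<close>, times a time interval.\<close>

definition prism :: "int \<Rightarrow> nat set \<Rightarrow> nat set set \<Rightarrow> (coord \<Rightarrow> int) \<Rightarrow> coord set \<Rightarrow> bool" where
  "prism p V F x J \<longleftrightarrow> T \<in> J \<and> 0 \<le> x T \<and> x T < p \<and> (\<exists>S\<in>F. fits p V S x J)"

lemma T_notin_coords [simp]: "T \<notin> coords V" and U_in_coords [simp]: "U v \<in> coords V \<longleftrightarrow> v \<in> V"
  and W_in_coords [simp]: "W v \<in> coords V \<longleftrightarrow> v \<in> V"
  by (auto simp: coords_def)

lemma finite_coords: "finite V \<Longrightarrow> finite (coords V)"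
  by (simp add: coords_def)

lemma sum_coords: "finite V \<Longrightarrow> (\<Sum>c\<in>coords V. g c) = (\<Sum>v\<in>V. g (U v) + g (W v))" for g :: "coord \<Rightarrow> nat"
  unfolding coords_def
  by (subst sum.union_disjoint) (auto simp: sum.reindex inj_on_def sum.distrib)

text \<open>A cell thus determines the face it lies over, so cells over different facets are never
  counted twice.\<close>

lemma fits_support: "fits p V S x J \<Longrightarrow> S \<subseteq> V \<Longrightarrow> S = {v \<in> V. U v \<in> J \<and> W v \<in> J}"
  by (auto simp: fits_def fits_at_def square_cell_def boundary_cell_def split: if_splits)

lemma fits_card:
  assumes "fits p V S x J" "S \<subseteq> V" "finite V" "T \<notin> J"
  shows "card J = card V + card S"
proof -
  have J: "J \<subseteq> coords V" using assms by (auto simp: fits_def)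
  have "card J = (\<Sum>c\<in>coords V. of_bool (c \<in> J))"
    using J finite_coords[OF assms(3)] by (simp add: Int_absorb1)
  also have "\<dots> = (\<Sum>v\<in>V. of_bool (U v \<in> J) + of_bool (W v \<in> J))"
    by (rule sum_coords[OF assms(3)])
  also have "\<dots> = (\<Sum>v\<in>V. 1 + of_bool (v \<in> S))"
    using assms(1,2) by (intro sum.cong) (auto simp: fits_def fits_at_def square_cell_def boundary_cell_def split: if_splits)
  also have "\<dots> = card V + card S"
    using assms by (subst sum.distrib) (simp add: Int_absorb1)
  finally show ?thesis .
qed

lemma fits_remove:
  assumes "v \<in> S" "S \<subseteq> V"
  shows "fits p V (S - {v}) x J \<longleftrightarrow>
    (J - {T} \<subseteq> coords V \<and> (\<forall>c. c \<notin> coords V \<longrightarrow> c \<noteq> T \<longrightarrow> x c = 0) \<and> (\<forall>u\<in>V-{v}. fits_at p S u x J)) \<and>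
    boundary_cell p (x (U v)) (x (W v)) (U v \<in> J) (W v \<in> J)"
  using assms unfolding fits_def fits_at_def by auto

text \<open>Leibniz rule modulo 2: perimeters have no boundary, so the boundary of the cells over
  \<open>S\<close> consists of the cells over \<open>S - {v}\<close> with \<open>v \<in> S\<close>.
  Summed over all facets, each of these appears an even number of times by
  \<open>ridge\<close>.\<close>

lemma even_cofaces_fits:
  assumes p: "p > 0" and V: "finite V" and F: "F \<subseteq> Pow V"
    and ridge: "\<And>R. R \<subseteq> V \<Longrightarrow> even (card {S \<in> F. \<exists>v\<in>S. S - {v} = R})"
  shows "even (\<Sum>S\<in>F. cofaces (coords V) (fits p V S) x J)"
proof -
  have finF: "finite F" using F V finite_subset by auto
  define rest where "rest S v \<longleftrightarrow>
    (J - {T} \<subseteq> coords V \<and> (\<forall>c. c \<notin> coords V \<longrightarrow> c \<noteq> T \<longrightarrow> x c = 0) \<and> (\<forall>u\<in>V-{v}. fits_at p S u x J))" for S v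
  define loc where "loc S v = local_cofaces (if v \<in> S then square_cell p else boundary_cell p)
      (x (U v)) (x (W v)) (U v \<in> J) (W v \<in> J)" for S v
  define g where "g S c = (if c \<in> J then 0 else
     of_bool (fits p V S x (insert c J)) + of_bool (fits p V S (x(c := x c - 1)) (insert c J)) :: nat)" for S c
  have gloc: "g S (U v) + g S (W v) = of_bool (rest S v) * loc S v" if "v \<in> V" for S v
  proof -
    have fits_split: "fits p V S y (insert c J) \<longleftrightarrow> rest S v \<and> fits_at p S v y (insert c J)"
      if c: "c = U v \<or> c = W v" and y: "\<And>c'. c' \<noteq> c \<Longrightarrow> y c' = x c'" for y c
    proof -
      have "fits_at p S u y (insert c J) \<longleftrightarrow> fits_at p S u x J" if "u \<in> V - {v}" for u
        using that c y[of "U u"] y[of "W u"] unfolding fits_at_def by auto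
      moreover have "(\<forall>c. c \<notin> coords V \<longrightarrow> c \<noteq> T \<longrightarrow> y c = 0) \<longleftrightarrow> (\<forall>c. c \<notin> coords V \<longrightarrow> c \<noteq> T \<longrightarrow> x c = 0)"
      proof -
        have "y c' = x c'" if "c' \<notin> coords V" for c'
          by (rule y) (use that c \<open>v \<in> V\<close> in auto)
        then show ?thesis by auto
      qed
      moreover have "insert c J - {T} \<subseteq> coords V \<longleftrightarrow> J - {T} \<subseteq> coords V" using c \<open>v \<in> V\<close> by auto
      moreover have "(\<forall>u\<in>V. P u) \<longleftrightarrow> (\<forall>u\<in>V-{v}. P u) \<and> P v" for P using \<open>v \<in> V\<close> by auto
      ultimately show ?thesis unfolding fits_def rest_def by auto
    qed
    show ?thesis
      unfolding g_def loc_def local_cofaces_def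
      by (simp add: fits_split fits_at_def)
  qed
  have cof: "cofaces (coords V) (fits p V S) x J = (\<Sum>v\<in>V. of_bool (rest S v) * loc S v)" for S
  proof -
    have "cofaces (coords V) (fits p V S) x J = (\<Sum>c\<in>coords V - J. g S c)"
      unfolding cofaces_def g_def by (intro sum.cong) auto
    also have "\<dots> = (\<Sum>c\<in>coords V. g S c)"
      using finite_coords[OF V] by (intro sum.mono_neutral_left) (auto simp: g_def)
    also have "\<dots> = (\<Sum>v\<in>V. g S (U v) + g S (W v))" by (rule sum_coords[OF V])
    also have "\<dots> = (\<Sum>v\<in>V. of_bool (rest S v) * loc S v)" by (intro sum.cong refl gloc)
    finally show ?thesis .
  qed
  have "(\<Sum>S\<in>F. cofaces (coords V) (fits p V S) x J) = (\<Sum>(S, v)\<in>F \<times> V. of_bool (rest S v) * loc S v)"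
    by (simp add: cof sum.cartesian_product)
  moreover have "even (card {z \<in> F \<times> V. odd (case z of (S, v) \<Rightarrow> of_bool (rest S v) * loc S v)})"
  proof -
    have odd_iff: "odd (of_bool (rest S v) * loc S v) \<longleftrightarrow> v \<in> S \<and> fits p V (S - {v}) x J"
      if "S \<in> F" "v \<in> V" for S v
    proof (cases "v \<in> S")
      case True
      then show ?thesis using that F odd_local_cofaces_square[OF p] fits_remove[of v S V p x J]
        by (auto simp: loc_def rest_def)
    next
      case False
      then show ?thesis using even_local_cofaces_boundary[OF p] by (simp add: loc_def)
    qed
    have eq: "{z \<in> F \<times> V. odd (case z of (S, v) \<Rightarrow> of_bool (rest S v) * loc S v)} =
        {(S, v). S \<in> F \<and> v \<in> S \<and> fits p V (S - {v}) x J}" (is "?A = ?B")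
    proof (intro Set.set_eqI)
      fix z
      show "z \<in> ?A \<longleftrightarrow> z \<in> ?B"
      proof (cases z)
        case (Pair S v)
        have "S \<in> F \<Longrightarrow> v \<in> S \<Longrightarrow> v \<in> V" using F by auto
        then show ?thesis using odd_iff[of S v] Pair by auto
      qed
    qed
    \<comment> \<open>The directions of the cell leave only one candidate for
      \<open>S - {v}\<close>.\<close>
    define R where "R = {v \<in> V. U v \<in> J \<and> W v \<in> J}"
    have R: "fits p V Q x J \<Longrightarrow> Q \<subseteq> V \<Longrightarrow> Q = R" for Q
      unfolding R_def by (rule fits_support)
    show ?thesis
    proof (cases "fits p V R x J")
      case True
      have "?B = {(S, v). S \<in> F \<and> v \<in> S \<and> S - {v} = R}"
      proof -
        have "S \<in> F \<Longrightarrow> fits p V (S - {v}) x J \<longleftrightarrow> S - {v} = R" for S v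
          using R[of "S - {v}"] True F by auto
        then show ?thesis by auto
      qed
      moreover have "card {(S, v). S \<in> F \<and> v \<in> S \<and> S - {v} = R} = card {S \<in> F. \<exists>v\<in>S. S - {v} = R}"
      proof (rule bij_betw_same_card[where f = fst], rule bij_betw_imageI)
        show "inj_on fst {(S, v). S \<in> F \<and> v \<in> S \<and> S - {v} = R}"
          by (auto simp: inj_on_def)
        show "fst ` {(S, v). S \<in> F \<and> v \<in> S \<and> S - {v} = R} = {S \<in> F. \<exists>v\<in>S. S - {v} = R}"
          by (intro equalityI subsetI) (auto intro: rev_image_eqI)
      qed
      moreover have "R \<subseteq> V" by (auto simp: R_def)
      ultimately show ?thesis using ridge[of R] eq by simp
    next
      case False
      have empty: "?B = {}"
        using R False F by blast
      show ?thesis unfolding eq empty by simp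
    qed
  qed
  ultimately show ?thesis
    using finF V by (simp add: even_sum_iff)
qed

text \<open>The boundary of a cycle times an interval is its bottom and its top. Faces that contain
  the time direction are lateral and cancel by \<open>even_cofaces_fits\<close>.\<close>

lemma odd_cofaces_prism:
  assumes p: "p > 0" and V: "finite V" and F: "F \<subseteq> Pow V"
    and ridge: "\<And>R. R \<subseteq> V \<Longrightarrow> even (card {S \<in> F. \<exists>v\<in>S. S - {v} = R})"
  shows "odd (cofaces (insert T (coords V)) (prism p V F) x J) \<longleftrightarrow>
    T \<notin> J \<and> (x T = 0 \<or> x T = p) \<and> (\<exists>S\<in>F. fits p V S x J)"
proof (cases "T \<in> J")
  case False
  have fT: "fits p V S y (insert T J) \<longleftrightarrow> fits p V S x J" if "\<And>c. c \<noteq> T \<Longrightarrow> y c = x c" for y S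
    using that False unfolding fits_def fits_at_def by auto
  have "cofaces (insert T (coords V)) (prism p V F) x J =
      (\<Sum>c\<in>{T}. of_bool (prism p V F x (insert c J)) + of_bool (prism p V F (x(c := x c - 1)) (insert c J)))"
    unfolding cofaces_def using finite_coords[OF V] False
    by (intro sum.mono_neutral_right) (auto simp: prism_def)
  then show ?thesis
    using False p by (auto simp: prism_def fT)
next
  case True
  have finF: "finite F" using F V finite_subset by auto
  define t where "t \<longleftrightarrow> 0 \<le> x T \<and> x T < p"
  \<comment> \<open>At most one facet fits, by \<open>fits_support\<close>; hence the existential
    over \<open>F\<close> is a sum.\<close>
  have pr: "of_bool (prism p V F y (insert c J)) = (\<Sum>S\<in>F. of_bool (t \<and> fits p V S y (insert c J)) :: nat)"
    if "y T = x T" for y c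
  proof (cases "\<exists>S\<in>F. t \<and> fits p V S y (insert c J)")
    case True
    then obtain S where S: "S \<in> F" "t" "fits p V S y (insert c J)" by blast
    have "\<not> fits p V S' y (insert c J)" if S': "S' \<in> F" "S' \<noteq> S" for S'
    proof
      assume f: "fits p V S' y (insert c J)"
      have "S' \<subseteq> V" "S \<subseteq> V" using S'(1) S(1) F by auto
      then show False using fits_support[OF f] fits_support[OF S(3)] S'(2) by simp
    qed
    then have "(\<Sum>S\<in>F. of_bool (t \<and> fits p V S y (insert c J)) :: nat) = (\<Sum>S\<in>{S}. of_bool (t \<and> fits p V S y (insert c J)))"
      using finF S by (intro sum.mono_neutral_right) auto
    moreover have "prism p V F y (insert c J)"
      unfolding prism_def using S \<open>y T = x T\<close> \<open>T \<in> J\<close> t_def by auto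
    ultimately show ?thesis using S by simp
  next
    case False
    then show ?thesis using \<open>y T = x T\<close> by (auto simp: prism_def t_def)
  qed
  have "cofaces (insert T (coords V)) (prism p V F) x J = (\<Sum>c\<in>coords V - J. \<Sum>S\<in>F.
     of_bool (t \<and> fits p V S x (insert c J)) + of_bool (t \<and> fits p V S (x(c := x c - 1)) (insert c J)))"
    unfolding cofaces_def
  proof (rule sum.cong)
    show "insert T (coords V) - J = coords V - J" using True by auto
  next
    fix c assume "c \<in> coords V - J"
    then have "c \<noteq> T" using True by auto
    then show "of_bool (prism p V F x (insert c J)) + of_bool (prism p V F (x(c := x c - 1)) (insert c J)) =
      (\<Sum>S\<in>F. of_bool (t \<and> fits p V S x (insert c J)) + of_bool (t \<and> fits p V S (x(c := x c - 1)) (insert c J)) :: nat)"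
      by (simp add: pr sum.distrib)
  qed
  also have "\<dots> = of_bool t * (\<Sum>S\<in>F. cofaces (coords V) (fits p V S) x J)"
    unfolding cofaces_def by (subst sum.swap) (cases t; simp)
  finally show ?thesis
    using even_cofaces_fits[OF p V F ridge, of x J] True by simp
qed

lemma finite_prism:
  assumes V: "finite V" and F: "F \<subseteq> Pow V"
  shows "finite {(x, J). prism p V F x J}"
proof (rule finite_subset)
  let ?C = "insert T (coords V)"
  have "finite {x. \<forall>c. (c \<in> ?C \<longrightarrow> x c \<in> {-\<bar>p\<bar>..\<bar>p\<bar>}) \<and> (c \<notin> ?C \<longrightarrow> x c = 0)}"
    by (rule finite_set_of_finite_funs) (use finite_coords[OF V] in auto)
  then show "finite ({x. \<forall>c. (c \<in> ?C \<longrightarrow> x c \<in> {-\<bar>p\<bar>..\<bar>p\<bar>}) \<and> (c \<notin> ?C \<longrightarrow> x c = 0)} \<times> Pow ?C)"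
    using finite_coords[OF V] by auto
  have "x c \<in> {-\<bar>p\<bar>..\<bar>p\<bar>}" if h: "prism p V F x J" and c: "c \<in> ?C" for x J c
  proof (cases c)
    case (U v)
    then have "\<exists>S. fits_at p S v x J" using h c by (auto simp: prism_def fits_def)
    then show ?thesis using U by (auto simp: fits_at_def square_cell_def boundary_cell_def split: if_splits)
  next
    case (W v)
    then have "\<exists>S. fits_at p S v x J" using h c by (auto simp: prism_def fits_def)
    then show ?thesis using W by (auto simp: fits_at_def square_cell_def boundary_cell_def split: if_splits)
  qed (use h in \<open>auto simp: prism_def\<close>)
  then have bound: "c \<in> ?C \<longrightarrow> x c \<in> {-\<bar>p\<bar>..\<bar>p\<bar>}" if "prism p V F x J" for x J c
    using that by blast
  have zero: "c \<notin> ?C \<longrightarrow> x c = 0" if "prism p V F x J" for x J c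
    using that by (auto simp: prism_def fits_def)
  have J: "J \<subseteq> ?C" if "prism p V F x J" for x J
    using that by (auto simp: prism_def fits_def)
  show "{(x, J). prism p V F x J} \<subseteq>
     {x. \<forall>c. (c \<in> ?C \<longrightarrow> x c \<in> {-\<bar>p\<bar>..\<bar>p\<bar>}) \<and> (c \<notin> ?C \<longrightarrow> x c = 0)} \<times> Pow ?C"
  proof (rule subrelI)
    fix x J assume "(x, J) \<in> {(x, J). prism p V F x J}"
    then have h: "prism p V F x J" by simp
    show "(x, J) \<in> {x. \<forall>c. (c \<in> ?C \<longrightarrow> x c \<in> {-\<bar>p\<bar>..\<bar>p\<bar>}) \<and> (c \<notin> ?C \<longrightarrow> x c = 0)} \<times> Pow ?C"
      by (intro SigmaI CollectI allI conjI PowI bound[OF h] zero[OF h] J[OF h])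
  qed
qed

lemma prism_card:
  assumes V: "finite V" and F: "F \<subseteq> Pow V" and card: "\<And>S. S \<in> F \<Longrightarrow> card S = k"
    and pr: "prism p V F x J"
  shows "J \<subseteq> insert T (coords V) \<and> card J = Suc (card V + k)"
proof -
  obtain S where S: "S \<in> F" "fits p V S x J" "T \<in> J" using pr by (auto simp: prism_def)
  then have "fits p V S x (J - {T})" by (auto simp: fits_def fits_at_def)
  then have "card (J - {T}) = card V + card S"
    using fits_card[of p V S x "J - {T}"] S F V by auto
  moreover have J: "J \<subseteq> insert T (coords V)" using S by (auto simp: fits_def)
  then have "finite J" using finite_coords[OF V] finite_subset by blast
  then have "card J = Suc (card (J - {T}))" using S by (intro card.remove) auto
  ultimately have "card J = Suc (card V + k)" using card[OF S(1)] by linarith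
  then show ?thesis using J by simp
qed

section \<open>Labels and the square model of the disc\<close>

text \<open>The value \<open>length es\<close> marks a point that is neither far nor satisfies any
  condition of the list. Far points get one further label, so that a full simplex of the boundary
  has none of them.\<close>

definition label :: "'c list \<Rightarrow> ('c \<Rightarrow> 'p \<Rightarrow> bool) \<Rightarrow> ('p \<Rightarrow> bool) \<Rightarrow> 'p \<Rightarrow> nat" where
  "label es pos far y = (if far y then Suc (length es)
     else LEAST j. j = length es \<or> j < length es \<and> pos (es ! j) y)"

lemma label_nonfar:
  assumes "\<not> far y"
  shows "label es pos far y \<le> length es"
    "label es pos far y < length es \<Longrightarrow> pos (es ! label es pos far y) y"
    "j < label es pos far y \<Longrightarrow> \<not> pos (es ! j) y"
proof -
  let ?P = "\<lambda>j. j = length es \<or> j < length es \<and> pos (es ! j) y"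
  have l: "label es pos far y = (LEAST j. ?P j)" using assms by (simp add: label_def)
  show le: "label es pos far y \<le> length es" unfolding l by (rule Least_le) simp
  have "?P (LEAST j. ?P j)" by (rule LeastI[of ?P "length es"]) simp
  then show "label es pos far y < length es \<Longrightarrow> pos (es ! label es pos far y) y" unfolding l by auto
  show "\<not> pos (es ! j) y" if "j < label es pos far y"
    using not_less_Least[of j ?P] that le unfolding l by auto
qed

lemma label_far: "far y \<Longrightarrow> label es pos far y = Suc (length es)"
  by (simp add: label_def)

lemma label_le: "label es pos far y \<le> Suc (length es)"
  using label_nonfar(1)[of far y es pos] label_far[of far y es pos] by (cases "far y") auto

lemma label_eqI:
  assumes "\<not> far y" "j < length es \<Longrightarrow> pos (es ! j) y" "j \<le> length es" "\<And>i. i < j \<Longrightarrow> \<not> pos (es ! i) y"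
  shows "label es pos far y = j"
proof (rule antisym)
  show "label es pos far y \<le> j"
    using label_nonfar(3)[of far y j es pos, OF assms(1)] label_nonfar(1)[of far y es pos, OF assms(1)] assms(2,3)
    by (metis le_neq_implies_less not_le)
  show "j \<le> label es pos far y"
    using label_nonfar(2)[of far y es pos, OF assms(1)] assms(3,4) by (metis not_le order_less_le_trans)
qed

lemma rainbow_imp_nonfar:
  assumes "rainbow (label es pos far) x js" "length js = length es" "k \<le> length js"
  shows "\<not> far (chain_vertex x js k)"
proof
  assume "far (chain_vertex x js k)"
  then have "label es pos far (chain_vertex x js k) = Suc (length js)"
    using assms(2) by (simp add: label_far)
  moreover have "label es pos far (chain_vertex x js k) \<in> {..length js}"
    using assms(1,3) unfolding rainbow_def by blast
  ultimately show False by simp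
qed

text \<open>Along the chain more and more conditions hold, so the least index of one that holds can
  only decrease. Meeting all N + 1 labels in N steps, it drops by exactly one each time, which
  dictates the order of the directions.\<close>

lemma rainbow_label_iff:
  assumes es: "distinct es" and js: "distinct js" "set js = set es" and len: "length js = length es"
    and far: "\<And>k. k \<le> length js \<Longrightarrow> \<not> far (chain_vertex x js k)"
    and pos: "\<And>k c. k \<le> length js \<Longrightarrow> c \<in> set es \<Longrightarrow> pos c (chain_vertex x js k) \<longleftrightarrow> c \<in> set (take k js)"
  shows "rainbow (label es pos far) x js \<longleftrightarrow> js = rev es"
proof -
  define N where "N = length es"
  define f where "f k = label es pos far (chain_vertex x js k)" for k
  have f_le: "f k \<le> N" if "k \<le> N" for k
    unfolding f_def N_def by (rule label_nonfar(1)) (use far that len N_def in auto)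
  have f_in: "es ! f k \<in> set (take k js)" if "k \<le> N" "f k < N" for k
    using label_nonfar(2)[of far "chain_vertex x js k" es pos] far[of k] pos[of k "es ! f k"] that len
    unfolding f_def N_def by auto
  have f_notin: "es ! j \<notin> set (take k js)" if "k \<le> N" "j < f k" for k j
    using label_nonfar(3)[of far "chain_vertex x js k" j es pos] far[of k] pos[of k "es ! j"] that len f_le[of k]
    unfolding f_def N_def by auto
  have rb: "rainbow (label es pos far) x js \<longleftrightarrow> f ` {..N} = {..N}"
    using len by (simp add: rainbow_def f_def N_def)
  show ?thesis
  proof
    assume "rainbow (label es pos far) x js"
    then have img: "f ` {..N} = {..N}" using rb by simp
    then have inj: "inj_on f {..N}" by (intro eq_card_imp_inj_on) auto
    have step: "f (Suc k) < f k" if "Suc k \<le> N" for k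
    proof (rule ccontr)
      assume "\<not> f (Suc k) < f k"
      moreover have "f (Suc k) \<noteq> f k" using inj_onD[OF inj, of "Suc k" k] that by auto
      ultimately have less: "f k < f (Suc k)" by simp
      then have "f k < N" using f_le[OF that] by simp
      then have "es ! f k \<in> set (take k js)" using f_in[of k] that by simp
      then have "es ! f k \<in> set (take (Suc k) js)" using set_take_subset_set_take[of k "Suc k" js] by auto
      then show False using f_notin[OF that less] by simp
    qed
    have lower: "N - k \<le> f k" if "k \<le> N" for k
      using that
    proof (induction "N - k" arbitrary: k)
      case (Suc n)
      then have "Suc k \<le> N" "n = N - Suc k" by auto
      then have "N - Suc k \<le> f (Suc k)" using Suc by simp
      then show ?case using step[OF \<open>Suc k \<le> N\<close>] by simp
    qed simp
    have upper: "f k \<le> N - k" if "k \<le> N" for k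
      using that
    proof (induction k)
      case 0 then show ?case using f_le by simp
    next
      case (Suc k) then show ?case using step[of k] by simp
    qed
    have f: "f k = N - k" if "k \<le> N" for k using lower[OF that] upper[OF that] by simp
    show "js = rev es"
    proof (rule nth_equalityI)
      fix k assume k: "k < length js"
      then have kN: "k < N" using len N_def by simp
      have "es ! (N - Suc k) \<in> set (take (Suc k) js)"
        using f_in[of "Suc k"] f[of "Suc k"] kN by simp
      moreover have "es ! (N - Suc k) \<notin> set (take k js)"
        using f_notin[of k "N - Suc k"] f[of k] kN by simp
      ultimately have "es ! (N - Suc k) = js ! k"
        using k by (simp add: take_Suc_conv_app_nth)
      then show "js ! k = rev es ! k" using kN by (simp add: rev_nth N_def)
    qed (simp add: len)
  next
    assume "js = rev es"
    have f: "f k = N - k" if "k \<le> N" for k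
      unfolding f_def
    proof (rule label_eqI)
      have mem: "es ! j \<in> set (take k (rev es)) \<longleftrightarrow> N - k \<le> j" if "j < N" for j
      proof -
        have "set (take k (rev es)) = set (drop (N - k) es)" by (simp add: take_rev N_def)
        also have "es ! j \<in> \<dots> \<longleftrightarrow> N - k \<le> j"
        proof
          assume "es ! j \<in> set (drop (N - k) es)"
          then obtain i where "i < length (drop (N - k) es)" "drop (N - k) es ! i = es ! j"
            by (auto simp: in_set_conv_nth)
          then have "i + (N - k) < N" "es ! (N - k + i) = es ! j" by (auto simp: N_def)
          then have "N - k + i = j" using es that by (subst nth_eq_iff_index_eq[symmetric, of es]) (auto simp: N_def)
          then show "N - k \<le> j" by simp
        next
          assume "N - k \<le> j"
          then have "drop (N - k) es ! (j - (N - k)) = es ! j" "j - (N - k) < length (drop (N - k) es)"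
            using that by (auto simp: N_def)
          then show "es ! j \<in> set (drop (N - k) es)" by (metis nth_mem)
        qed
        finally show ?thesis .
      qed
      have kl: "k \<le> length js" using that len N_def by simp
      show "\<not> far (chain_vertex x js k)" using far kl .
      show "pos (es ! (N - k)) (chain_vertex x js k)" if "N - k < length es"
        using pos[OF kl, of "es ! (N - k)"] mem[of "N - k"] that \<open>js = rev es\<close> by (simp add: N_def)
      show "N - k \<le> length es" by (simp add: N_def)
      show "\<not> pos (es ! i) (chain_vertex x js k)" if "i < N - k" for i
        using pos[OF kl, of "es ! i"] mem[of i] that \<open>js = rev es\<close> by (simp add: N_def)
    qed
    have "f ` {..N} = {..N}"
    proof (intro equalityI subsetI)
      fix y assume "y \<in> {..N}"
      then have "f (N - y) = y" "N - y \<in> {..N}" using f[of "N - y"] by auto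
      then show "y \<in> f ` {..N}" by (metis image_eqI)
    qed (use f_le in auto)
    then show "rainbow (label es pos far) x js" using rb by simp
  qed
qed

text \<open>The elliptical grid mapping: it takes the boundary of the square to the circle and preserves the
  signs of both coordinates.\<close>

definition square_to_disc :: "real \<Rightarrow> real \<Rightarrow> complex" where
  "square_to_disc u w = Complex (u * sqrt (1 - w\<^sup>2 / 2)) (w * sqrt (1 - u\<^sup>2 / 2))"

lemma norm_square_to_disc:
  assumes "\<bar>u\<bar> \<le> 1" "\<bar>w\<bar> \<le> 1"
  shows "(cmod (square_to_disc u w))\<^sup>2 = 1 - (1 - u\<^sup>2) * (1 - w\<^sup>2)"
proof -
  have "u\<^sup>2 \<le> 1" "w\<^sup>2 \<le> 1" using assms by (simp_all add: abs_square_le_1)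
  then show ?thesis
    by (simp add: square_to_disc_def cmod_power2 power_mult_distrib) (simp add: algebra_simps)
qed

lemma square_to_disc_in_disc:
  assumes "\<bar>u\<bar> \<le> 1" "\<bar>w\<bar> \<le> 1"
  shows "cmod (square_to_disc u w) \<le> 1"
    and "cmod (square_to_disc u w) = 1 \<longleftrightarrow> \<bar>u\<bar> = 1 \<or> \<bar>w\<bar> = 1"
proof -
  have sq: "u\<^sup>2 \<le> 1" "w\<^sup>2 \<le> 1" using assms by (simp_all add: abs_square_le_1)
  have "(cmod (square_to_disc u w))\<^sup>2 \<le> 1"
    using sq norm_square_to_disc[OF assms] by simp
  then show "cmod (square_to_disc u w) \<le> 1" by (simp add: abs_square_le_1)
  have "cmod (square_to_disc u w) = 1 \<longleftrightarrow> (cmod (square_to_disc u w))\<^sup>2 = 1"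
    by (simp add: power2_eq_1_iff) (smt (verit) norm_ge_zero)
  also have "\<dots> \<longleftrightarrow> u\<^sup>2 = 1 \<or> w\<^sup>2 = 1"
    using norm_square_to_disc[OF assms] by auto
  also have "\<dots> \<longleftrightarrow> \<bar>u\<bar> = 1 \<or> \<bar>w\<bar> = 1"
    by (simp add: power2_eq_1_iff abs_if) 
  finally show "cmod (square_to_disc u w) = 1 \<longleftrightarrow> \<bar>u\<bar> = 1 \<or> \<bar>w\<bar> = 1" .
qed

lemma sgn_square_to_disc:
  assumes "\<bar>u\<bar> \<le> 1" "\<bar>w\<bar> \<le> 1"
  shows "Re (square_to_disc u w) < 0 \<longleftrightarrow> u < 0" "Im (square_to_disc u w) > 0 \<longleftrightarrow> w > 0"
proof -
  have "u\<^sup>2 \<le> 1" "w\<^sup>2 \<le> 1" using assms by (simp_all add: abs_square_le_1)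
  then have "sqrt (1 - w\<^sup>2 / 2) > 0" "sqrt (1 - u\<^sup>2 / 2) > 0" by simp_all
  then show "Re (square_to_disc u w) < 0 \<longleftrightarrow> u < 0" "Im (square_to_disc u w) > 0 \<longleftrightarrow> w > 0"
    by (simp_all add: square_to_disc_def mult_less_0_iff zero_less_mult_iff)
qed

text \<open>On the real axis radius 1/2 is attained exactly at the grid point
  \<open>a = - q\<close>. The point is that the strict comparison is the same for
  \<open>b = 0\<close> and \<open>b = 1\<close>: one grid step towards the centre outweighs the
  offset in the other coordinate.\<close>

lemma norm_square_to_disc_grid:
  fixes q a b :: int
  assumes q: "q \<ge> 2" and a: "- (2 * q) \<le> a" "a < 0" and b: "b = 0 \<or> b = 1"
  shows "cmod (square_to_disc (a / (2 * q)) (b / (2 * q))) < 1 / 2 \<longleftrightarrow> - q < a"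
proof -
  let ?u = "a / (2 * q) :: real" and ?w = "b / (2 * q) :: real"
  have scale: "3 / 4 < X / real_of_int (16 * q ^ 4) \<longleftrightarrow> real_of_int (12 * q ^ 4) < X" for X
    using q by (simp add: pos_less_divide_eq)
  have uw: "\<bar>?u\<bar> \<le> 1" "\<bar>?w\<bar> \<le> 1" using q a b by (auto simp: abs_le_iff divide_simps)
  have "cmod (square_to_disc ?u ?w) < 1 / 2 \<longleftrightarrow> (cmod (square_to_disc ?u ?w))\<^sup>2 < (1 / 2)\<^sup>2"
    using power_strict_mono[of "cmod (square_to_disc ?u ?w)" "1 / 2" 2]
      power2_less_imp_less[of "cmod (square_to_disc ?u ?w)" "1 / 2"] by auto
  also have "\<dots> \<longleftrightarrow> 3 / 4 < (1 - ?u\<^sup>2) * (1 - ?w\<^sup>2)"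
    unfolding norm_square_to_disc[OF uw] by (auto simp: power2_eq_square)
  also have "(1 - ?u\<^sup>2) * (1 - ?w\<^sup>2) = real_of_int ((4 * q\<^sup>2 - a\<^sup>2) * (4 * q\<^sup>2 - b\<^sup>2)) / real_of_int (16 * q ^ 4)"
    using q by (simp add: field_simps power2_eq_square power4_eq_xxxx)
  also have "3 / 4 < \<dots> \<longleftrightarrow> real_of_int (12 * q ^ 4) < real_of_int ((4 * q\<^sup>2 - a\<^sup>2) * (4 * q\<^sup>2 - b\<^sup>2))"
    by (rule scale)
  also have "\<dots> \<longleftrightarrow> 12 * q ^ 4 < (4 * q\<^sup>2 - a\<^sup>2) * (4 * q\<^sup>2 - b\<^sup>2)"
    by (rule of_int_less_iff)
  also have "\<dots> \<longleftrightarrow> - q < a"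
  proof
    assume "- q < a"
    then have "\<bar>a\<bar> \<le> \<bar>q - 1\<bar>" using a q by auto
    then have a2: "a\<^sup>2 \<le> (q - 1)\<^sup>2" by (simp only: abs_le_square_iff)
    have b2: "b\<^sup>2 \<le> 1" using b by auto
    have "(4 * q\<^sup>2 - (q - 1)\<^sup>2) * (4 * q\<^sup>2 - 1) = 12 * q ^ 4 + (8 * (q * (q * q)) - 7 * (q * q) - 2 * q + 1)"
      by (simp add: power2_eq_square power4_eq_xxxx algebra_simps)
    moreover have "2 * q \<le> q * q" "2 * (q * q) \<le> q * (q * q)" using q by (intro mult_right_mono; simp)+
    ultimately have "12 * q ^ 4 < (4 * q\<^sup>2 - (q - 1)\<^sup>2) * (4 * q\<^sup>2 - 1)"
      using q by linarith
    also have "\<dots> \<le> (4 * q\<^sup>2 - a\<^sup>2) * (4 * q\<^sup>2 - b\<^sup>2)"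
    proof (rule mult_mono)
      have "(q-1)\<^sup>2 \<le> q\<^sup>2" "1 \<le> q\<^sup>2" using q by (simp_all add: power_mono)
      then show "0 \<le> 4 * q\<^sup>2 - a\<^sup>2" "0 \<le> 4 * q\<^sup>2 - 1" using a2 by auto
    qed (use a2 b2 in auto)
    finally show "12 * q ^ 4 < (4 * q\<^sup>2 - a\<^sup>2) * (4 * q\<^sup>2 - b\<^sup>2)" .
  next
    assume less: "12 * q ^ 4 < (4 * q\<^sup>2 - a\<^sup>2) * (4 * q\<^sup>2 - b\<^sup>2)"
    show "- q < a"
    proof (rule ccontr)
      assume "\<not> - q < a"
      then have "\<bar>q\<bar> \<le> \<bar>a\<bar>" using a q by auto
      then have a2: "q\<^sup>2 \<le> a\<^sup>2" by (simp only: abs_le_square_iff)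
      have "\<bar>a\<bar> \<le> \<bar>2 * q\<bar>" using a q by auto
      then have a4: "a\<^sup>2 \<le> 4 * q\<^sup>2" using abs_le_square_iff[of a "2 * q"] by (simp add: power_mult_distrib)
      have "(4 * q\<^sup>2 - a\<^sup>2) * (4 * q\<^sup>2 - b\<^sup>2) \<le> (3 * q\<^sup>2) * (4 * q\<^sup>2)"
      proof (rule mult_mono)
        have "b\<^sup>2 \<le> 1" "1 \<le> q\<^sup>2" using b q by auto
        then show "0 \<le> 4 * q\<^sup>2 - b\<^sup>2" by auto
      qed (use a2 a4 in auto)
      also have "\<dots> = 12 * q ^ 4" by (simp add: power2_eq_square power4_eq_xxxx)
      finally show False using less by simp
    qed
  qed
  finally show ?thesis .
qed

section \<open>Counting full simplices at both ends of the prism\<close>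

definition in_region :: "int \<Rightarrow> nat set \<Rightarrow> nat set \<Rightarrow> (coord \<Rightarrow> int) \<Rightarrow> bool" where
  "in_region p V S y \<longleftrightarrow>
     (\<forall>v\<in>V. \<bar>y (U v)\<bar> \<le> p \<and> \<bar>y (W v)\<bar> \<le> p \<and> (v \<notin> S \<longrightarrow> \<bar>y (U v)\<bar> = p \<or> \<bar>y (W v)\<bar> = p)) \<and>
     0 \<le> y T \<and> y T \<le> p \<and> (\<forall>c. c \<notin> insert T (coords V) \<longrightarrow> y c = 0)"

lemma fits_in_region:
  assumes "fits p V S x J" "T \<in> J \<Longrightarrow> 0 \<le> x T \<and> x T < p" "T \<notin> J \<Longrightarrow> 0 \<le> x T \<and> x T \<le> p" "I \<subseteq> J"
  shows "in_region p V S (\<lambda>c. x c + of_bool (c \<in> I))"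
proof -
  have "\<bar>x (U v) + of_bool (U v \<in> I)\<bar> \<le> p \<and> \<bar>x (W v) + of_bool (W v \<in> I)\<bar> \<le> p \<and>
      (v \<notin> S \<longrightarrow> \<bar>x (U v) + of_bool (U v \<in> I)\<bar> = p \<or> \<bar>x (W v) + of_bool (W v \<in> I)\<bar> = p)"
    if "v \<in> V" for v
  proof -
    have *: "fits_at p S v x J" using that assms(1) by (simp add: fits_def)
    have "U v \<in> I \<longrightarrow> U v \<in> J" "W v \<in> I \<longrightarrow> W v \<in> J" using assms(4) by auto
    with * show ?thesis
      unfolding fits_at_def square_cell_def boundary_cell_def
      by (cases "v \<in> S"; cases "U v \<in> I"; cases "W v \<in> I"; cases "U v \<in> J"; cases "W v \<in> J") auto
  qed
  moreover have "0 \<le> x T + of_bool (T \<in> I) \<and> x T + of_bool (T \<in> I) \<le> p"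
    using assms(2-4) by (cases "T \<in> J"; cases "T \<in> I") auto
  moreover have "x c + of_bool (c \<in> I) = 0" if "c \<notin> insert T (coords V)" for c
  proof -
    have "c \<notin> I" "x c = 0" using that assms(1,4) by (auto simp: fits_def)
    then show ?thesis by simp
  qed
  ultimately show ?thesis by (simp add: in_region_def)
qed

lemma fits_chain_vertex_in_region:
  assumes "fits p V S x (set js)" "T \<in> set js \<Longrightarrow> 0 \<le> x T \<and> x T < p" "T \<notin> set js \<Longrightarrow> 0 \<le> x T \<and> x T \<le> p"
  shows "in_region p V S (chain_vertex x js k)"
  unfolding chain_vertex_def by (rule fits_in_region[OF assms]) (auto dest: in_set_takeD)

text \<open>\<open>\<phi> y v\<close> stands for the \<open>v\<close>-coordinate of the homotopy belonging to \<open>\<kappa> v\<close> (to \<open>v\<close> itself if \<open>v \<in> \<sigma>\<close>),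
  which is why \<open>nonadj\<close> may compare \<open>\<phi> y v\<close> with \<open>\<phi> y (\<kappa> v)\<close>. The assumption \<open>ridge\<close> says that the
  facets \<open>F\<close> form a cycle modulo 2.\<close>

locale grid_map =
  fixes q p :: int and V \<sigma> :: "nat set" and F :: "nat set set" and \<kappa> :: "nat \<Rightarrow> nat"
    and \<phi> :: "(coord \<Rightarrow> int) \<Rightarrow> nat \<Rightarrow> complex"
  assumes q: "q \<ge> 2" and p: "p = 2 * q" and V: "finite V" and F: "F \<subseteq> Pow V"
    and card: "\<And>S. S \<in> F \<Longrightarrow> card S = card \<sigma>" and \<sigma>: "\<sigma> \<in> F"
    and ridge: "\<And>R. R \<subseteq> V \<Longrightarrow> even (card {S \<in> F. \<exists>v\<in>S. S - {v} = R})"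
    and bottom: "\<And>y S v. S \<in> F \<Longrightarrow> in_region p V S y \<Longrightarrow> y T = 0 \<Longrightarrow> v \<in> V \<Longrightarrow>
      \<phi> y v = square_to_disc (y (U v) / p) (y (W v) / p)"
    and top: "\<And>y S. S \<in> F \<Longrightarrow> in_region p V S y \<Longrightarrow> y T = p \<Longrightarrow> \<exists>v\<in>V. Re (\<phi> y v) \<ge> 0"
    and small: "\<And>y z S v. S \<in> F \<Longrightarrow> in_region p V S y \<Longrightarrow> in_region p V S z \<Longrightarrow> (\<And>c. \<bar>y c - z c\<bar> \<le> 1) \<Longrightarrow>
      v \<in> V \<Longrightarrow> cmod (\<phi> y v - \<phi> z v) < 1 / 4"
    and \<kappa>: "\<And>v. v \<in> V - \<sigma> \<Longrightarrow> \<kappa> v \<in> \<sigma>"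
    and nonadj: "\<And>y S v. S \<in> F \<Longrightarrow> in_region p V S y \<Longrightarrow> v \<in> V - \<sigma> \<Longrightarrow> cmod (\<phi> y v) < 1 \<Longrightarrow> cmod (\<phi> y (\<kappa> v)) = 1"
begin

text \<open>The labels detect preimages, outside the region \<open>far\<close>, of the point where \<open>Im (\<phi> y v) = 0\<close> for all \<open>v\<close>
  and \<open>cmod (\<phi> y a) = 1 / 2\<close> for \<open>a \<in> \<sigma>\<close>. At time \<open>0\<close> there is exactly one, inside the cell of \<open>\<sigma>\<close>.\<close>

definition pos :: "coord \<Rightarrow> (coord \<Rightarrow> int) \<Rightarrow> bool" where
  "pos c y = (case c of U a \<Rightarrow> cmod (\<phi> y a) < 1 / 2 | W v \<Rightarrow> Im (\<phi> y v) > 0 | T \<Rightarrow> False)"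

definition far :: "(coord \<Rightarrow> int) \<Rightarrow> bool" where
  "far y \<longleftrightarrow> (\<exists>v\<in>V. Re (\<phi> y v) \<ge> 0)"

definition J0 :: "coord set" where
  "J0 = U ` \<sigma> \<union> W ` V"

definition es :: "coord list" where
  "es = (SOME es. distinct es \<and> set es = J0)"

abbreviation lab :: "(coord \<Rightarrow> int) \<Rightarrow> nat" where
  "lab \<equiv> label es pos far"

text \<open>Lowest vertex of the cell at the counted point: \<open>- q / p\<close> is -1/2, of
  radius 1/2, and \<open>- p / p\<close> is the left side of the square. The imaginary directions
  start at 0, just before their sign becomes positive.\<close>

definition x0 :: "coord \<Rightarrow> int" where
  "x0 c = (case c of U v \<Rightarrow> if v \<in> \<sigma> then - q else if v \<in> V then - p else 0 | _ \<Rightarrow> 0)"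

lemma \<sigma>V: "\<sigma> \<subseteq> V" using F \<sigma> by auto

lemma p0: "p > 0" using p q by simp

lemma es: "distinct es" "set es = J0"
proof -
  have "finite J0" using V \<sigma>V finite_subset by (auto simp: J0_def)
  then have "\<exists>es. distinct es \<and> set es = J0" using finite_distinct_list by metis
  then have "distinct es \<and> set es = J0" unfolding es_def by (rule someI_ex)
  then show "distinct es" "set es = J0" by auto
qed

lemma length_es: "length es = card V + card \<sigma>"
proof -
  have "card J0 = card (U ` \<sigma>) + card (W ` V)"
    unfolding J0_def using V \<sigma>V finite_subset by (intro card_Un_disjoint) auto
  then have "card J0 = card V + card \<sigma>" by (simp add: card_image inj_on_def)
  then show ?thesis using distinct_card[OF es(1)] es(2) by simp
qed

lemma J0_coords: "J0 \<subseteq> coords V"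
  using \<sigma>V by (auto simp: J0_def coords_def)

lemma label_pos:
  assumes "c \<in> J0" shows "\<exists>j<length es. \<forall>y. lab y = j \<longrightarrow> \<not> far y \<and> pos c y"
proof -
  obtain j where j: "j < length es" "es ! j = c" using assms es by (metis in_set_conv_nth)
  have "\<not> far y \<and> pos c y" if "lab y = j" for y
    using label_far[of far y es pos] label_nonfar(2)[of far y es pos] j that by (cases "far y") auto
  then show ?thesis using j by blast
qed

lemma label_top: "lab y = length es \<Longrightarrow> \<not> far y \<and> (\<forall>c\<in>J0. \<not> pos c y)"
proof -
  assume h: "lab y = length es"
  then have nf: "\<not> far y" using label_far[of far y es pos] by auto
  have "\<not> pos c y" if c: "c \<in> J0" for c
  proof -
    obtain j where "j < length es" "es ! j = c" using c es by (metis in_set_conv_nth)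
    then show ?thesis using label_nonfar(3)[of far y j es pos, OF nf] h by auto
  qed
  then show ?thesis using nf by simp
qed

lemma chain_vertex_close: "\<bar>chain_vertex x js k c - chain_vertex x js l c\<bar> \<le> 1"
  by (simp add: chain_vertex_def)

text \<open>With all labels present, a far vertex, one with label \<open>length es\<close> and one
  where \<open>W v\<close> holds together bring some coordinate \<open>v\<close> close to 0. If
  \<open>v \<in> \<sigma>\<close>, the condition \<open>U v\<close> then holds where it was seen to
  fail. Otherwise a vertex where \<open>U (\<kappa> v)\<close> holds has both moduli below 1,
  against \<open>nonadj\<close>.\<close>

lemma missing_label:
  assumes js: "distinct js" "prism p V F x (set js)"
  shows "\<exists>a\<le>Suc (length es). a \<notin> (\<lambda>k. lab (chain_vertex x js k)) ` {..Suc (length es)}"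
proof (rule ccontr)
  assume "\<not> ?thesis"
  then have all: "\<exists>k. lab (chain_vertex x js k) = a" if "a \<le> Suc (length es)" for a
    using that by force
  obtain S where S: "S \<in> F" "fits p V S x (set js)" "T \<in> set js" "0 \<le> x T" "x T < p"
    using js(2) by (auto simp: prism_def)
  have reg: "in_region p V S (chain_vertex x js k)" for k
    by (rule fits_chain_vertex_in_region) (use S in auto)
  have close: "cmod (\<phi> (chain_vertex x js k) v - \<phi> (chain_vertex x js l) v) < 1 / 4" if "v \<in> V" for k l v
    by (rule small[OF S(1) reg reg chain_vertex_close that])
  obtain k0 where "lab (chain_vertex x js k0) = Suc (length es)" using all by blast
  then have "far (chain_vertex x js k0)"
    using label_nonfar(1)[of far _ es pos] by (metis not_less_eq_eq order_refl)
  then obtain v where v: "v \<in> V" "Re (\<phi> (chain_vertex x js k0) v) \<ge> 0" by (auto simp: far_def)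
  obtain k1 where "lab (chain_vertex x js k1) = length es" using all[of "length es"] by auto
  then have k1: "\<not> far (chain_vertex x js k1)" "\<And>c. c \<in> J0 \<Longrightarrow> \<not> pos c (chain_vertex x js k1)"
    using label_top by auto
  have "W v \<in> J0" using v by (simp add: J0_def)
  then obtain j where "j < length es" "\<And>y. lab y = j \<Longrightarrow> \<not> far y \<and> pos (W v) y" using label_pos by blast
  then obtain k2 where k2: "pos (W v) (chain_vertex x js k2)" using all[of j] by auto
  define z where "z = \<phi> (chain_vertex x js k1) v"
  have "Re z < 0" "Im z \<le> 0"
    using k1(1) k1(2)[OF \<open>W v \<in> J0\<close>] v by (auto simp: far_def pos_def z_def)
  moreover have "\<bar>Re z - Re (\<phi> (chain_vertex x js k0) v)\<bar> < 1 / 4" "\<bar>Im z - Im (\<phi> (chain_vertex x js k2) v)\<bar> < 1 / 4"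
    using close[OF v(1), of k1 k0] close[OF v(1), of k1 k2]
      abs_Re_le_cmod[of "z - \<phi> (chain_vertex x js k0) v"] abs_Im_le_cmod[of "z - \<phi> (chain_vertex x js k2) v"]
    by (auto simp: z_def)
  \<comment> \<open>Real and imaginary part both change sign within the simplex, on which they vary
    by less than 1/4.\<close>
  ultimately have "\<bar>Re z\<bar> < 1 / 4" "\<bar>Im z\<bar> < 1 / 4"
    using v(2) k2 by (auto simp: pos_def)
  then have z: "cmod z < 1 / 2" using cmod_le[of z] by simp
  show False
  proof (cases "v \<in> \<sigma>")
    case True
    then have "\<not> pos (U v) (chain_vertex x js k1)" using k1(2) by (simp add: J0_def)
    then show False using z by (simp add: pos_def z_def)
  next
    case False
    then have vs: "v \<in> V - \<sigma>" using v by simp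
    then have "U (\<kappa> v) \<in> J0" using \<kappa> by (simp add: J0_def)
    then obtain j where "j < length es" "\<And>y. lab y = j \<Longrightarrow> \<not> far y \<and> pos (U (\<kappa> v)) y" using label_pos by blast
    then obtain k3 where "pos (U (\<kappa> v)) (chain_vertex x js k3)" using all[of j] by auto
    then have lt: "cmod (\<phi> (chain_vertex x js k3) (\<kappa> v)) < 1 / 2" by (simp add: pos_def)
    \<comment> \<open>Moving to the vertex \<open>k3\<close> costs less than 1/4, and 1/2 + 1/4 <
      1.\<close>
    have "cmod (\<phi> (chain_vertex x js k3) v) \<le> cmod z + cmod (\<phi> (chain_vertex x js k3) v - z)"
      by (metis add_diff_cancel_left' diff_add_cancel norm_triangle_ineq add.commute)
    then have "cmod (\<phi> (chain_vertex x js k3) v) < 1"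
      using z close[OF v(1), of k3 k1] by (simp add: z_def)
    then have "cmod (\<phi> (chain_vertex x js k3) (\<kappa> v)) = 1"
      using nonadj[OF S(1) reg vs] by simp
    then show False using lt by simp
  qed
qed

lemma fits_x0: "fits p V \<sigma> x0 J0"
  unfolding fits_def
proof (intro conjI ballI allI impI)
  show "J0 - {T} \<subseteq> coords V" using J0_coords by auto
  show "x0 c = 0" if "c \<notin> coords V" "c \<noteq> T" for c
    using that \<sigma>V by (cases c) (auto simp: x0_def)
  show "fits_at p \<sigma> v x0 J0" if "v \<in> V" for v
    unfolding fits_at_def x0_def square_cell_def boundary_cell_def J0_def using that p q by auto
qed

lemma region_unit: 
  assumes "in_region p V S y" "v \<in> V"
  shows "\<bar>y (U v) / p\<bar> \<le> 1" "\<bar>y (W v) / p\<bar> \<le> 1"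
  using assms p0 by (auto simp: in_region_def abs_le_iff divide_simps)

lemma region_sgn:
  assumes "S \<in> F" "in_region p V S y" "v \<in> V" "y T = 0"
  shows "Re (\<phi> y v) < 0 \<longleftrightarrow> y (U v) < 0" "Im (\<phi> y v) > 0 \<longleftrightarrow> y (W v) > 0"
    "cmod (\<phi> y v) < 1 \<Longrightarrow> v \<in> S"
proof -
  note b = bottom[OF assms(1,2,4,3)] and u = region_unit[OF assms(2,3)]
  show "Re (\<phi> y v) < 0 \<longleftrightarrow> y (U v) < 0" "Im (\<phi> y v) > 0 \<longleftrightarrow> y (W v) > 0"
    unfolding b sgn_square_to_disc[OF u] using p0 by (simp_all add: divide_less_0_iff zero_less_divide_iff)
  assume "cmod (\<phi> y v) < 1"
  then have "\<not> (\<bar>y (U v) / p\<bar> = 1 \<or> \<bar>y (W v) / p\<bar> = 1)"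
    using square_to_disc_in_disc(2)[OF u] b by auto
  then have "\<bar>y (U v)\<bar> \<noteq> p" "\<bar>y (W v)\<bar> \<noteq> p" using p0 by auto
  then show "v \<in> S" using assms(2,3) unfolding in_region_def by blast
qed

lemma region_half:
  assumes "S \<in> F" "in_region p V S y" "v \<in> V" "y T = 0" "y (U v) < 0" "y (W v) = 0 \<or> y (W v) = 1"
  shows "cmod (\<phi> y v) < 1 / 2 \<longleftrightarrow> - q < y (U v)"
proof -
  have "- (2 * q) \<le> y (U v)" using assms(2,3) p by (auto simp: in_region_def)
  then show ?thesis
    using norm_square_to_disc_grid[OF q _ assms(5,6)] bottom[OF assms(1,2,4,3)] p by simp
qed

lemma rainbow_x0: "rainbow lab x0 (rev es)"
proof -
  have *: "chain_vertex x0 (rev es) k c = x0 c + of_bool (c \<in> set (take k (rev es)))" for k c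
    by (simp add: chain_vertex_def)
  have sub: "set (take k (rev es)) \<subseteq> J0" for k using set_take_subset[of k "rev es"] unfolding set_rev es(2) .
  have T: "T \<notin> J0" using J0_coords by auto
  have reg: "in_region p V \<sigma> (chain_vertex x0 (rev es) k)" for k
    by (rule fits_chain_vertex_in_region) (use fits_x0 es T p0 in \<open>auto simp: x0_def\<close>)
  have T0: "chain_vertex x0 (rev es) k T = 0" for k using sub[of k] T by (auto simp: * x0_def)
  have neg: "chain_vertex x0 (rev es) k (U v) < 0" if "v \<in> V" for k v
  proof -
    have "U v \<in> set (take k (rev es)) \<Longrightarrow> v \<in> \<sigma>" using sub[of k] by (auto simp: J0_def)
    then show ?thesis unfolding * x0_def using that p q by auto
  qed
  have "rainbow lab x0 (rev es) \<longleftrightarrow> rev es = rev es"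
  proof (rule rainbow_label_iff)
    show "\<not> far (chain_vertex x0 (rev es) k)" for k
      using region_sgn(1)[OF \<sigma> reg _ T0] neg by (auto simp: far_def not_le)
    show "pos c (chain_vertex x0 (rev es) k) \<longleftrightarrow> c \<in> set (take k (rev es))" if "c \<in> set es" for k c
    proof (cases c)
      case (U v)
      then have v: "v \<in> \<sigma>" "v \<in> V" using that es \<sigma>V by (auto simp: J0_def)
      have "chain_vertex x0 (rev es) k (W v) = 0 \<or> chain_vertex x0 (rev es) k (W v) = 1" by (simp add: * x0_def)
      from region_half[OF \<sigma> reg v(2) T0 neg[OF v(2)] this]
      moreover have "chain_vertex x0 (rev es) k (U v) = - q + of_bool (U v \<in> set (take k (rev es)))"
        using v by (simp add: * x0_def)
      ultimately show ?thesis using U by (simp add: pos_def)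
    next
      case (W v)
      then have "v \<in> V" using that es by (auto simp: J0_def)
      from region_sgn(2)[OF \<sigma> reg this T0] have "0 < Im (\<phi> (chain_vertex x0 (rev es) k) v) \<longleftrightarrow> 0 < chain_vertex x0 (rev es) k (W v)" .
      moreover have "chain_vertex x0 (rev es) k (W v) = of_bool (W v \<in> set (take k (rev es)))"
        by (simp add: * x0_def)
      ultimately show ?thesis using W by (simp add: pos_def)
    next
      case T
      then show ?thesis using \<open>T \<notin> J0\<close> that es by simp
    qed
  qed (use es in auto)
  then show ?thesis by simp
qed

text \<open>A full simplex has no far vertex, which excludes the top. At the bottom the coordinates
  are explicit, and each condition must fail at one vertex and hold at another; this pins down every
  coordinate of the cell.\<close>

lemma rainbow_unique:
  assumes js: "distinct js" "length js = length es" and T: "T \<notin> set js" and x: "x T = 0 \<or> x T = p"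
    and S: "S \<in> F" "fits p V S x (set js)" and rb: "rainbow lab x js"
  shows "x = x0 \<and> js = rev es"
proof -
  let ?y = "chain_vertex x js"
  have reg: "in_region p V S (?y k)" for k
    by (rule fits_chain_vertex_in_region) (use S T x p0 in auto)
  have yT: "?y k T = x T" for k using T by (auto simp: chain_vertex_def dest: in_set_takeD)
  have nonfar: "\<not> far (?y k)" if "k \<le> length js" for k
    using rainbow_imp_nonfar[OF rb js(2) that] .
  have "x T \<noteq> p"
    using top[OF S(1) reg[of 0]] nonfar[of 0] yT[of 0] by (auto simp: far_def)
  then have xT: "x T = 0" using x by simp
  have yT: "?y k T = 0" for k using yT xT by simp
  have all: "\<exists>k\<le>length js. lab (?y k) = a" if "a \<le> length es" for a
  proof -
    have "a \<in> (\<lambda>k. lab (?y k)) ` {..length js}" using rb that js(2) by (simp add: rainbow_def)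
    then show ?thesis by auto
  qed
  have allpos: "\<exists>k\<le>length js. pos c (?y k)" if c: "c \<in> J0" for c
  proof -
    obtain j where "j < length es" "\<And>y. lab y = j \<Longrightarrow> \<not> far y \<and> pos c y" using label_pos[OF c] by blast
    then show ?thesis using all[of j] by auto
  qed
  obtain k1 where k1: "k1 \<le> length js" "\<And>c. c \<in> J0 \<Longrightarrow> \<not> pos c (?y k1)"
    using all[of "length es"] label_top by blast
  have neg: "?y k (U v) < 0" if "v \<in> V" "k \<le> length js" for v k
    using nonfar[OF that(2)] region_sgn(1)[OF S(1) reg that(1) yT, of k] that(1) by (auto simp: far_def not_le)
  have y: "?y k c = x c + of_bool (c \<in> set (take k js))" for k c by (simp add: chain_vertex_def)
  \<comment> \<open>The condition \<open>U a\<close> puts the \<open>a\<close>-coordinate inside the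
    open disc, which at time 0 is possible only for vertices of \<open>S\<close>. Equal
    cardinalities then give \<open>S = \<sigma>\<close>.\<close>
  have "\<sigma> \<subseteq> S"
  proof
    fix a assume "a \<in> \<sigma>"
    then have "U a \<in> J0" "a \<in> V" using \<sigma>V by (auto simp: J0_def)
    then obtain k where "cmod (\<phi> (?y k) a) < 1 / 2" using allpos[of "U a"] by (auto simp: pos_def)
    then show "a \<in> S" using region_sgn(3)[OF S(1) reg \<open>a \<in> V\<close> yT, of k] by simp
  qed
  moreover have "finite S" using S(1) F V by (meson PowD finite_subset subsetD)
  ultimately have S\<sigma>: "S = \<sigma>" using card_subset_eq[of S \<sigma>] card[OF S(1)] by simp
  \<comment> \<open>The condition \<open>W v\<close> changes along the simplex, so the edge in this
    direction runs from 0 to 1.\<close>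
  have Wv: "x (W v) = 0 \<and> W v \<in> set js" if v: "v \<in> V" for v
  proof -
    have "W v \<in> J0" using v by (simp add: J0_def)
    then obtain k where "pos (W v) (?y k)" "\<not> pos (W v) (?y k1)" using allpos k1(2) by blast
    then have "?y k (W v) > 0" "\<not> ?y k1 (W v) > 0"
      using region_sgn(2)[OF S(1) reg v yT] by (auto simp: pos_def)
    then show ?thesis unfolding y
      by (cases "W v \<in> set (take k js)"; cases "W v \<in> set (take k1 js)") (auto dest: in_set_takeD)
  qed
  have cell: "fits_at p \<sigma> v x (set js)" if "v \<in> V" for v using S(2) that S\<sigma> by (simp add: fits_def)
  have "x (U v) = - p \<and> U v \<notin> set js" if v: "v \<in> V" "v \<notin> \<sigma>" for v
    using cell[OF v(1)] Wv[OF v(1)] v(2) neg[OF v(1), of 0] p0 by (auto simp: fits_at_def boundary_cell_def y)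
  moreover have "x (U a) = - q \<and> U a \<in> set js" if a: "a \<in> \<sigma>" for a
  proof
    have aV: "a \<in> V" using a \<sigma>V by auto
    show Ua: "U a \<in> set js" using cell[OF aV] a by (auto simp: fits_at_def square_cell_def)
    have "U a \<in> J0" using a by (simp add: J0_def)
    then obtain k where k: "k \<le> length js" "pos (U a) (?y k)" and nk1: "\<not> pos (U a) (?y k1)" using allpos k1(2) by blast
    have w: "?y k (W a) = 0 \<or> ?y k (W a) = 1" for k using Wv[OF aV] by (auto simp: y)
    have "- q < ?y k (U a)" "\<not> - q < ?y k1 (U a)"
      using region_half[OF S(1) reg aV yT neg[OF aV k(1)] w] k(2)
        region_half[OF S(1) reg aV yT neg[OF aV k1(1)] w] nk1 by (auto simp: pos_def)
    then show "x (U a) = - q" unfolding y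
      by (cases "U a \<in> set (take k js)"; cases "U a \<in> set (take k1 js)") auto
  qed
  ultimately have x: "x = x0" and sj: "set js = set es"
  proof -
    assume 1: "\<And>v. v \<in> V \<Longrightarrow> v \<notin> \<sigma> \<Longrightarrow> x (U v) = - p \<and> U v \<notin> set js"
      and 2: "\<And>a. a \<in> \<sigma> \<Longrightarrow> x (U a) = - q \<and> U a \<in> set js"
    have out: "x c = 0" if "c \<notin> coords V" for c
      using S(2) that xT by (cases "c = T") (auto simp: fits_def)
    show "x = x0"
    proof
      fix c show "x c = x0 c"
        using 1 2 Wv out[of c] xT \<sigma>V by (cases c) (auto simp: x0_def)
    qed
    have "set js \<subseteq> coords V" using S(2) T by (auto simp: fits_def)
    then have sub: "U v \<in> set js \<Longrightarrow> v \<in> V" "W v \<in> set js \<Longrightarrow> v \<in> V" for v by auto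
    show "set js = set es"
    proof (rule Set.set_eqI)
      fix c show "c \<in> set js \<longleftrightarrow> c \<in> set es"
      proof (cases c)
        case (U v)
        have "U v \<in> set js \<longleftrightarrow> v \<in> \<sigma>" using 1[of v] 2[of v] sub(1)[of v] by blast
        then show ?thesis using U by (auto simp: es J0_def)
      next
        case (W v)
        have "W v \<in> set js \<longleftrightarrow> v \<in> V" using Wv[of v] sub(2)[of v] by blast
        then show ?thesis using W by (auto simp: es J0_def)
      next
        case T
        then show ?thesis using \<open>T \<notin> set js\<close> by (auto simp: es J0_def)
      qed
    qed
  qed
  have "rainbow lab x js \<longleftrightarrow> js = rev es"
  proof (rule rainbow_label_iff[OF es(1) js(1) sj js(2)])
    show "\<not> far (?y k)" if "k \<le> length js" for k using nonfar[OF that] .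
    show "pos c (?y k) \<longleftrightarrow> c \<in> set (take k js)" if "k \<le> length js" "c \<in> set es" for k c
    proof (cases c)
      case (U v)
      then have v: "v \<in> \<sigma>" "v \<in> V" using that es \<sigma>V by (auto simp: J0_def)
      have "?y k (W v) = 0 \<or> ?y k (W v) = 1" unfolding y unfolding x by (simp add: x0_def)
      from region_half[OF S(1) reg v(2) yT neg[OF v(2) that(1)] this]
      moreover have "?y k (U v) = - q + of_bool (U v \<in> set (take k js))"
        unfolding y unfolding x using v by (simp add: x0_def)
      ultimately show ?thesis using U by (simp add: pos_def)
    next
      case (W v)
      then have "v \<in> V" using that es by (auto simp: J0_def)
      from region_sgn(2)[OF S(1) reg this yT] have "0 < Im (\<phi> (?y k) v) \<longleftrightarrow> 0 < ?y k (W v)" .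
      moreover have "?y k (W v) = of_bool (W v \<in> set (take k js))"
        unfolding y unfolding x by (simp add: x0_def)
      ultimately show ?thesis using W by (simp add: pos_def)
    next
      case T
      then show ?thesis using J0_coords that es by auto
    qed
  qed
  then show ?thesis using rb x by simp
qed

theorem no_grid_map: False
proof -
  let ?N = "length es" and ?C = "insert T (coords V)"
  have "even (card {(x, js). distinct js \<and> set js \<subseteq> ?C \<and> length js = ?N \<and> rainbow lab x js \<and>
    odd (cofaces ?C (prism p V F) x (set js))})"
  proof (rule sperner_parity)
    show "finite ?C" using finite_coords[OF V] by simp
    show "finite {(x, J). prism p V F x J}" by (rule finite_prism[OF V F])
    show "J \<subseteq> ?C \<and> card J = Suc ?N" if "prism p V F x J" for x J
      using prism_card[OF V F card that] length_es by simp
    show "lab x \<le> Suc ?N" for x by (rule label_le)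
  qed (rule missing_label)
  moreover have "{(x, js). distinct js \<and> set js \<subseteq> ?C \<and> length js = ?N \<and> rainbow lab x js \<and>
    odd (cofaces ?C (prism p V F) x (set js))} = {(x0, rev es)}" (is "?A = _")
  proof (intro equalityI subrelI)
    fix x js assume "(x, js) \<in> ?A"
    then have "distinct js" "length js = ?N" "rainbow lab x js" "odd (cofaces ?C (prism p V F) x (set js))" by auto
    then have "x = x0 \<and> js = rev es"
      using odd_cofaces_prism[OF p0 V F ridge, of x "set js"] rainbow_unique[of js x] by blast
    then show "(x, js) \<in> {(x0, rev es)}" by simp
  next
    fix x js assume "(x, js) \<in> {(x0, rev es)}"
    then have [simp]: "x = x0" "js = rev es" by auto
    have "odd (cofaces ?C (prism p V F) x0 J0)"
      using odd_cofaces_prism[OF p0 V F ridge, of x0 J0] fits_x0 \<sigma> J0_coords by (auto simp: x0_def)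
    then show "(x, js) \<in> ?A" using es rainbow_x0 J0_coords by auto
  qed
  ultimately show False by simp
qed

end

section \<open>Moment-angle complexes\<close>

text \<open>The coordinates inside the open disc form the smallest admissible face, so the union
  over all faces becomes a condition on this one set.\<close>

lemma topspace_moment_angle_complex:
  assumes "simplicial_complex_on m L"
  shows "topspace (moment_angle_complex m L) =
    {z \<in> extensional {1..m}. (\<forall>v\<in>{1..m}. cmod (z v) \<le> 1) \<and> {v \<in> {1..m}. cmod (z v) < 1} \<in> L}"
proof (intro equalityI subsetI)
  fix z assume "z \<in> topspace (moment_angle_complex m L)"
  then obtain I where I: "I \<in> L" "z \<in> (\<Pi>\<^sub>E i\<in>{1..m}. if i \<in> I then cball 0 1 else sphere 0 1)"
    by (auto simp: moment_angle_complex_def)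
  have z: "cmod (z v) \<le> 1" "v \<notin> I \<Longrightarrow> cmod (z v) = 1" if "v \<in> {1..m}" for v
    using PiE_mem[OF I(2) that] by (auto split: if_splits)
  then have "{v \<in> {1..m}. cmod (z v) < 1} \<subseteq> I" by force
  then have "{v \<in> {1..m}. cmod (z v) < 1} \<in> L" using simplicial_complex_onD(3)[OF assms I(1)] by blast
  then show "z \<in> {z \<in> extensional {1..m}. (\<forall>v\<in>{1..m}. cmod (z v) \<le> 1) \<and> {v \<in> {1..m}. cmod (z v) < 1} \<in> L}"
    using z I(2) by (auto simp: PiE_def)
next
  fix z assume z: "z \<in> {z \<in> extensional {1..m}. (\<forall>v\<in>{1..m}. cmod (z v) \<le> 1) \<and> {v \<in> {1..m}. cmod (z v) < 1} \<in> L}"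
  let ?I = "{v \<in> {1..m}. cmod (z v) < 1}"
  have "z \<in> (\<Pi>\<^sub>E i\<in>{1..m}. if i \<in> ?I then cball 0 1 else sphere 0 1)"
    using z by (auto simp: PiE_iff not_less intro: antisym)
  then have "z \<in> (\<Union>I\<in>L. \<Pi>\<^sub>E i\<in>{1..m}. if i \<in> I then cball 0 1 else sphere 0 1)"
    using z by (intro UN_I[of ?I]) auto
  moreover have "z \<in> (\<Pi>\<^sub>E i\<in>{1..m}. cball 0 1)" using z by (auto simp: PiE_iff)
  ultimately show "z \<in> topspace (moment_angle_complex m L)"
    using z unfolding moment_angle_complex_def topspace_subtopology topspace_product_topology by auto
qed

lemma continuous_map_into_moment_angle_complex:
  assumes "simplicial_complex_on m L"
  shows "continuous_map X (moment_angle_complex m L) f \<longleftrightarrow>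
    f ` topspace X \<subseteq> topspace (moment_angle_complex m L) \<and>
    (\<forall>v\<in>{1..m}. continuous_map X euclidean (\<lambda>x. f x v))" (is "?l \<longleftrightarrow> ?r")
proof -
  let ?S = "\<Union>I\<in>L. \<Pi>\<^sub>E i\<in>{1..m}. if i \<in> I then cball 0 1 else sphere (0::complex) 1"
  have "?S \<subseteq> (\<Pi>\<^sub>E i\<in>{1..m}. cball 0 1)" by (force simp: PiE_iff split: if_splits)
  then have top: "topspace (moment_angle_complex m L) = ?S"
    unfolding moment_angle_complex_def by auto
  have "?l \<longleftrightarrow> continuous_map X (product_topology (\<lambda>i. top_of_set (cball 0 1)) {1..m}) f \<and> f \<in> topspace X \<rightarrow> ?S"
    unfolding moment_angle_complex_def by (rule continuous_map_in_subtopology)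
  also have "\<dots> \<longleftrightarrow> ?r"
  proof
    assume h: "continuous_map X (product_topology (\<lambda>i. top_of_set (cball 0 1)) {1..m}) f \<and> f \<in> topspace X \<rightarrow> ?S"
    then have "f ` topspace X \<subseteq> ?S" by blast
    with h show ?r unfolding top by (simp add: continuous_map_componentwise continuous_map_in_subtopology)
  next
    assume h: ?r
    have *: "f x \<in> topspace (moment_angle_complex m L)" if "x \<in> topspace X" for x using h that by blast
    show "continuous_map X (product_topology (\<lambda>i. top_of_set (cball 0 1)) {1..m}) f \<and> f \<in> topspace X \<rightarrow> ?S"
      using h * unfolding continuous_map_componentwise continuous_map_in_subtopology top[symmetric]
      by (auto simp: topspace_moment_angle_complex[OF assms])
  qed
  finally show ?thesis .
qed

lemma continuous_map_moment_angle_coordinate: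
  assumes "simplicial_complex_on m L" "v \<in> {1..m}"
  shows "continuous_map (moment_angle_complex m L) euclidean (\<lambda>z. z v)"
  using continuous_map_into_moment_angle_complex[OF assms(1), of "moment_angle_complex m L" "\<lambda>z. z"] assms(2)
  by simp

definition basepoint :: "nat \<Rightarrow> nat \<Rightarrow> complex" where
  "basepoint m = (\<lambda>v\<in>{1..m}. 1)"

lemma basepoint_in_moment_angle_complex:
  assumes "simplicial_complex_on m L"
  shows "basepoint m \<in> topspace (moment_angle_complex m L)"
proof -
  have "{v \<in> {1..m}. cmod (basepoint m v) < 1} = {}" by (auto simp: basepoint_def)
  then have "{v \<in> {1..m}. cmod (basepoint m v) < 1} \<in> L"
    using simplicial_complex_onD(1)[OF assms] by (simp only:)
  then show ?thesis by (auto simp: topspace_moment_angle_complex[OF assms] basepoint_def)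
qed

lemma norm_convex_le_1:
  assumes "cmod z \<le> 1" "cmod w \<le> 1" "0 \<le> t" "t \<le> 1"
  shows "cmod ((1 - t) *\<^sub>R z + t *\<^sub>R w) \<le> 1"
proof -
  have "cmod ((1 - t) *\<^sub>R z + t *\<^sub>R w) \<le> (1 - t) * cmod z + t * cmod w"
    using norm_triangle_ineq[of "(1 - t) *\<^sub>R z" "t *\<^sub>R w"] assms by simp
  also have "\<dots> \<le> (1 - t) * 1 + t * 1" using assms by (intro add_mono mult_left_mono) auto
  finally show ?thesis by simp
qed

text \<open>Null-homotopies may end at different constants. Path connectedness moves them all to one
  point whose coordinates have positive real part. Interior coordinates travel straight to 1, those
  on the circle rotate to it.\<close>

lemma path_component_of_basepoint:
  assumes L: "simplicial_complex_on m L" and z: "z \<in> topspace (moment_angle_complex m L)"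
  shows "path_component_of (moment_angle_complex m L) z (basepoint m)"
proof -
  define g where "g t = (\<lambda>v\<in>{1..m}. if cmod (z v) < 1 then (1 - t) *\<^sub>R z v + t *\<^sub>R 1 else cis ((1 - t) * Arg (z v)))" for t :: real
  note top = topspace_moment_angle_complex[OF L]
  have zv: "z \<in> extensional {1..m}" "\<And>v. v \<in> {1..m} \<Longrightarrow> cmod (z v) \<le> 1" "{v \<in> {1..m}. cmod (z v) < 1} \<in> L"
    using z by (auto simp: top)
  have in_top: "g t \<in> topspace (moment_angle_complex m L)" if t: "t \<in> {0..1}" for t
  proof -
    have "{v \<in> {1..m}. cmod (g t v) < 1} \<subseteq> {v \<in> {1..m}. cmod (z v) < 1}"
      by (auto simp: g_def split: if_splits)
    then have "{v \<in> {1..m}. cmod (g t v) < 1} \<in> L" using simplicial_complex_onD(3)[OF L zv(3)] by blast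
    moreover have "cmod (g t v) \<le> 1" if "v \<in> {1..m}" for v
      using that norm_convex_le_1[of "z v" 1 t] t by (auto simp: g_def)
    ultimately show ?thesis by (auto simp: top g_def)
  qed
  have "pathin (moment_angle_complex m L) g"
    unfolding pathin_def continuous_map_into_moment_angle_complex[OF L]
  proof (intro conjI ballI)
    show "continuous_map (top_of_set {0..1}) euclidean (\<lambda>t. g t v)" if "v \<in> {1..m}" for v
      using that unfolding g_def by (cases "cmod (z v) < 1") (auto intro!: continuous_intros)
  qed (use in_top in auto)
  moreover have "g 0 = z"
  proof
    fix v show "g 0 v = z v"
    proof (cases "v \<in> {1..m}")
      case True
      then have "cmod (z v) < 1 \<or> cmod (z v) = 1" using zv(2)[OF True] by linarith
      then have "\<not> cmod (z v) < 1 \<Longrightarrow> cis (Arg (z v)) = z v"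
        using cis_Arg[of "z v"] by (cases "z v = 0") (auto simp: sgn_eq)
      then show ?thesis using True by (auto simp: g_def)
    next
      case False
      then show ?thesis using zv(1) by (auto simp: g_def extensional_def)
    qed
  qed
  moreover have "g 1 = basepoint m" by (auto simp: g_def basepoint_def)
  ultimately show ?thesis unfolding path_component_of_def by blast
qed

lemma null_homotopic_to_basepoint:
  assumes L: "simplicial_complex_on m L" and "null_homotopic X (moment_angle_complex m L) f"
  shows "homotopic_with (\<lambda>h. True) X (moment_angle_complex m L) f (\<lambda>x. basepoint m)"
proof -
  obtain c where c: "c \<in> topspace (moment_angle_complex m L)"
    "homotopic_with (\<lambda>h. True) X (moment_angle_complex m L) f (\<lambda>x. c)"
    using assms(2) unfolding null_homotopic_def by blast
  have "homotopic_with (\<lambda>h. True) X (moment_angle_complex m L) (\<lambda>x. c) (\<lambda>x. basepoint m)"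
    unfolding homotopic_constant_maps using path_component_of_basepoint[OF L c(1)] by blast
  then show ?thesis using c(2) homotopic_with_trans by blast
qed

section \<open>The lower bound for a cycle modulo 2\<close>

lemma dist_fun_small:
  assumes "\<delta> > (0::real)"
  obtains \<eta> where "\<eta> > 0" "\<And>x y :: 'c::countable \<Rightarrow> real. (\<And>c. \<bar>x c - y c\<bar> \<le> \<eta>) \<Longrightarrow> dist x y < \<delta>"
proof -
  obtain N where N: "(1 / 2 :: real) ^ N < \<delta> / 2"
    using real_arch_pow_inv[of "\<delta> / 2" "1 / 2"] assms by auto
  \<comment> \<open>Twice the largest of the first N + 1 differences is at most
    \<open>\<delta> / 4\<close>; the tail adds at most \<open>(1 / 2) ^ N\<close>.\<close>
  have "dist x y < \<delta>" if "\<And>c. \<bar>x c - y c\<bar> \<le> \<delta> / 8" for x y :: "'c \<Rightarrow> real"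
  proof -
    have "Max {dist (x (from_nat n)) (y (from_nat n)) |n. n \<le> N} \<le> \<delta> / 8"
      using that by (subst Max_le_iff) (auto simp: dist_real_def)
    then show ?thesis using dist_fun_le_dist_first_terms[of x y N] N assms by linarith
  qed
  then show ?thesis using that[of "\<delta> / 8"] assms by auto
qed

text \<open>The continuous counterpart of \<open>in_region\<close>, with \<open>p\<close> scaled to
  1. Its compactness is what yields a mesh size for the grid.\<close>

definition params :: "nat set \<Rightarrow> nat set set \<Rightarrow> (coord \<Rightarrow> real) set" where
  "params V F = (\<Union>S\<in>F. {\<xi>. (\<forall>v\<in>V. \<bar>\<xi> (U v)\<bar> \<le> 1 \<and> \<bar>\<xi> (W v)\<bar> \<le> 1 \<and> (v \<notin> S \<longrightarrow> \<bar>\<xi> (U v)\<bar> = 1 \<or> \<bar>\<xi> (W v)\<bar> = 1)) \<and>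
     0 \<le> \<xi> T \<and> \<xi> T \<le> 1 \<and> (\<forall>c. c \<notin> insert T (coords V) \<longrightarrow> \<xi> c = 0)})"

lemma in_region_imp_params:
  assumes "S \<in> F" "in_region p V S y" "p > 0"
  shows "(\<lambda>c. y c / p) \<in> params V F"
  using assms unfolding params_def in_region_def
  by (intro UN_I[of S]) (auto simp: abs_divide divide_le_eq)

lemma continuous_on_coordinate [continuous_intros]: "continuous_on A (\<lambda>\<xi>. \<xi> c)" for A :: "('c \<Rightarrow> 'b::topological_space) set"
  by (rule continuous_on_subset[OF continuous_on_product_coordinates]) simp

lemma compact_params:
  assumes "finite F"
  shows "compact (params V F)"
proof -
  have "compactin (product_topology (\<lambda>i. euclidean) UNIV) (PiE UNIV (\<lambda>c::coord. {-1..1::real}))"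
    by (simp add: compactin_PiE)
  then have "compact (PiE UNIV (\<lambda>c::coord. {-1..1::real}))"
    by (simp add: euclidean_product_topology)
  moreover have "closed (params V F)"
    unfolding params_def using assms
  proof (intro closed_UN ballI)
    fix S
    show "closed {\<xi>. (\<forall>v\<in>V. \<bar>\<xi> (U v)\<bar> \<le> 1 \<and> \<bar>\<xi> (W v)\<bar> \<le> 1 \<and> (v \<notin> S \<longrightarrow> \<bar>\<xi> (U v)\<bar> = 1 \<or> \<bar>\<xi> (W v)\<bar> = 1)) \<and>
     0 \<le> \<xi> T \<and> \<xi> T \<le> (1::real) \<and> (\<forall>c. c \<notin> insert T (coords V) \<longrightarrow> \<xi> c = 0)}"
      unfolding Ball_def
      by (intro closed_Collect_conj closed_Collect_all closed_Collect_imp closed_Collect_disj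
          closed_Collect_le closed_Collect_eq continuous_intros open_Collect_const)
  qed
  moreover have "params V F \<subseteq> PiE UNIV (\<lambda>c. {-1..1})"
  proof (intro subsetI PiE_I)
    fix \<xi> c assume "\<xi> \<in> params V F"
    then show "\<xi> c \<in> {-1..1}"
      by (cases "c \<in> insert T (coords V)"; cases c) (auto simp: params_def abs_le_iff)
  qed simp
  ultimately show ?thesis by (metis compact_Int_closed inf.absorb_iff2)
qed

definition param_point :: "nat \<Rightarrow> nat set \<Rightarrow> (coord \<Rightarrow> real) \<Rightarrow> nat \<Rightarrow> complex" where
  "param_point m V \<xi> = (\<lambda>v\<in>{1..m}. if v \<in> V then square_to_disc (\<xi> (U v)) (\<xi> (W v)) else 1)"

lemma continuous_map_param_point:
  assumes L: "simplicial_complex_on m L" and F: "F \<subseteq> L"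
  shows "continuous_map (top_of_set (params V F)) (moment_angle_complex m L) (param_point m V)"
  unfolding continuous_map_into_moment_angle_complex[OF L]
proof (intro conjI ballI image_subsetI)
  fix \<xi> assume "\<xi> \<in> topspace (top_of_set (params V F))"
  then obtain S where S: "S \<in> F" "\<And>v. v \<in> V \<Longrightarrow> \<bar>\<xi> (U v)\<bar> \<le> 1 \<and> \<bar>\<xi> (W v)\<bar> \<le> 1 \<and> (v \<notin> S \<longrightarrow> \<bar>\<xi> (U v)\<bar> = 1 \<or> \<bar>\<xi> (W v)\<bar> = 1)"
    by (auto simp: params_def)
  have *: "cmod (param_point m V \<xi> v) \<le> 1 \<and> (v \<notin> S \<longrightarrow> cmod (param_point m V \<xi> v) = 1)" if "v \<in> {1..m}" for v
    using that S(2)[of v] square_to_disc_in_disc[of "\<xi> (U v)" "\<xi> (W v)"] by (auto simp: param_point_def)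
  then have "{v \<in> {1..m}. cmod (param_point m V \<xi> v) < 1} \<subseteq> S" by force
  then have "{v \<in> {1..m}. cmod (param_point m V \<xi> v) < 1} \<in> L"
    using simplicial_complex_onD(3)[OF L] S(1) F by blast
  then show "param_point m V \<xi> \<in> topspace (moment_angle_complex m L)"
    using * by (simp add: topspace_moment_angle_complex[OF L]) (simp add: param_point_def)
next
  fix v assume v: "v \<in> {1..m}"
  have "continuous_on (params V F) (\<lambda>\<xi>. square_to_disc (\<xi> (U v)) (\<xi> (W v)))"
    unfolding square_to_disc_def complex_eq by (intro continuous_intros) auto
  then show "continuous_map (top_of_set (params V F)) euclidean (\<lambda>\<xi>. param_point m V \<xi> v)"
    using v by (cases "v \<in> V") (auto simp: param_point_def)
qed

text \<open>The homotopies contracting the sets \<open>Op a\<close> are cut off by functions that equal \<open>1\<close> on closed sets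
  which still cover; no partition of unity is needed because only the maximal distance matters.\<close>

lemma deformations_from_cover:
  fixes P :: "(coord \<Rightarrow> real) set"
  assumes P: "closed P" and \<sigma>: "finite \<sigma>" "\<sigma> \<noteq> {}"
    and e: "continuous_map (top_of_set P) Z e"
    and t: "continuous_on P t" "\<And>\<xi>. \<xi> \<in> P \<Longrightarrow> 0 \<le> t \<xi> \<and> t \<xi> \<le> (1::real)"
    and Op: "\<And>a. a \<in> \<sigma> \<Longrightarrow> openin Z (Op a)" and cover: "topspace Z \<subseteq> (\<Union>a\<in>\<sigma>. Op a)"
    and contr: "\<And>a. a \<in> \<sigma> \<Longrightarrow> homotopic_with (\<lambda>h. True) (subtopology Z (Op a)) Z (\<lambda>x. x) (\<lambda>x. b)"
  shows "\<exists>\<Phi>. (\<forall>a\<in>\<sigma>. continuous_map (top_of_set P) Z (\<Phi> a)) \<and>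
    (\<forall>a\<in>\<sigma>. \<forall>\<xi>\<in>P. t \<xi> = 0 \<longrightarrow> \<Phi> a \<xi> = e \<xi>) \<and> (\<forall>\<xi>\<in>P. t \<xi> = 1 \<longrightarrow> (\<exists>a\<in>\<sigma>. \<Phi> a \<xi> = b))"
proof -
  have "\<exists>H. continuous_map (prod_topology (top_of_set {0..1::real}) (subtopology Z (Op a))) Z H \<and>
      (\<forall>x. H (0, x) = x) \<and> (\<forall>x. H (1, x) = b)" if "a \<in> \<sigma>" for a
    using contr[OF that] unfolding homotopic_with_def by blast
  then obtain H where H: "\<And>a. a \<in> \<sigma> \<Longrightarrow> continuous_map (prod_topology (top_of_set {0..1::real}) (subtopology Z (Op a))) Z (H a)"
    "\<And>a x. a \<in> \<sigma> \<Longrightarrow> H a (0, x) = x" "\<And>a x. a \<in> \<sigma> \<Longrightarrow> H a (1, x) = b"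
    by metis
  define A where "A a = {\<xi> \<in> P. e \<xi> \<notin> Op a}" for a
  \<comment> \<open>The distance to the empty set is 0 by convention, which would wrongly say that
    no point lies in \<open>Op a\<close>; hence the value 1.\<close>
  define D where "D a \<xi> = (if A a = {} then 1 else infdist \<xi> (A a))" for a \<xi>
  define \<mu> where "\<mu> \<xi> = (\<Sum>a\<in>\<sigma>. D a \<xi>) / card \<sigma>" for \<xi>
  have cA: "closed (A a)" if "a \<in> \<sigma>" for a
  proof -
    have "openin (top_of_set P) {\<xi> \<in> P. e \<xi> \<in> Op a}"
      using openin_continuous_map_preimage[OF e Op[OF that]] by simp
    then have "closedin (top_of_set P) (P - {\<xi> \<in> P. e \<xi> \<in> Op a})"
      by (metis closedin_diff closedin_topspace topspace_euclidean_subtopology)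
    moreover have "P - {\<xi> \<in> P. e \<xi> \<in> Op a} = A a" by (auto simp: A_def)
    ultimately show ?thesis using P closedin_closed_trans by metis
  qed
  have D0: "D a \<xi> \<ge> 0" for a \<xi> by (simp add: D_def infdist_nonneg)
  have Dpos: "D a \<xi> > 0 \<longleftrightarrow> e \<xi> \<in> Op a" if "a \<in> \<sigma>" "\<xi> \<in> P" for a \<xi>
  proof (cases "A a = {}")
    case True
    then show ?thesis using that by (auto simp: D_def A_def)
  next
    case False
    then have "\<xi> \<in> A a \<longleftrightarrow> infdist \<xi> (A a) = 0" using in_closed_iff_infdist_zero[OF cA[OF that(1)]] by blast
    then show ?thesis using False that infdist_nonneg[of \<xi> "A a"] by (auto simp: D_def A_def)
  qed
  have cD: "continuous_on P (D a)" for a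
    unfolding D_def by (cases "A a = {}") (auto intro!: continuous_intros)
  have c\<mu>: "continuous_on P \<mu>"
    unfolding \<mu>_def by (intro continuous_intros cD) (use \<sigma> in auto)
  have emem: "e \<xi> \<in> topspace Z" if "\<xi> \<in> P" for \<xi>
    using continuous_map_image_subset_topspace[OF e] that by auto
  have \<mu>pos: "\<mu> \<xi> > 0" if \<xi>: "\<xi> \<in> P" for \<xi>
  proof -
    obtain a where "a \<in> \<sigma>" "e \<xi> \<in> Op a" using cover emem[OF \<xi>] by auto
    then have "D a \<xi> > 0" using Dpos[OF _ \<xi>, of a] by simp
    then have "(\<Sum>a\<in>\<sigma>. D a \<xi>) > 0"
      by (rule sum_pos2[OF \<sigma>(1) \<open>a \<in> \<sigma>\<close>]) (rule D0)
    then show ?thesis using \<sigma> by (simp add: \<mu>_def card_gt_0_iff)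
  qed
  have max: "\<exists>a\<in>\<sigma>. \<mu> \<xi> \<le> D a \<xi>" for \<xi>
  proof (rule ccontr)
    assume "\<not> ?thesis"
    then have "D a \<xi> < \<mu> \<xi>" if "a \<in> \<sigma>" for a using that by (meson not_le)
    then have "(\<Sum>a\<in>\<sigma>. D a \<xi>) < (\<Sum>a\<in>\<sigma>. \<mu> \<xi>)" by (rule sum_strict_mono[OF \<sigma>])
    then show False using \<sigma> by (simp add: \<mu>_def)
  qed
  define \<tau> where "\<tau> a \<xi> = t \<xi> * min 1 (2 * D a \<xi> / \<mu> \<xi> - 1)" for a \<xi>
  define \<Phi> where "\<Phi> a \<xi> = (if \<mu> \<xi> \<le> 2 * D a \<xi> then H a (\<tau> a \<xi>, e \<xi>) else e \<xi>)" for a \<xi>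
  have c\<tau>: "continuous_on P (\<tau> a)" for a
    unfolding \<tau>_def by (intro continuous_intros cD c\<mu> t(1)) (use \<mu>pos in force)
  have "continuous_map (top_of_set P) Z (\<Phi> a)" if a: "a \<in> \<sigma>" for a
    unfolding \<Phi>_def
  proof (rule continuous_map_cases_le)
    show "continuous_map (top_of_set P) euclideanreal \<mu>" using c\<mu> by simp
    show "continuous_map (top_of_set P) euclideanreal (\<lambda>\<xi>. 2 * D a \<xi>)"
      using cD by (auto intro!: continuous_intros)
    let ?X = "subtopology (top_of_set P) {\<xi> \<in> topspace (top_of_set P). \<mu> \<xi> \<le> 2 * D a \<xi>}"
    have "0 \<le> \<tau> a \<xi> \<and> \<tau> a \<xi> \<le> 1" if "\<xi> \<in> P" "\<mu> \<xi> \<le> 2 * D a \<xi>" for \<xi>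
    proof -
      have "0 \<le> min 1 (2 * D a \<xi> / \<mu> \<xi> - 1)" "min 1 (2 * D a \<xi> / \<mu> \<xi> - 1) \<le> 1"
        using that \<mu>pos[OF that(1)] by (auto simp: field_simps)
      then show ?thesis using t(2)[OF that(1)] by (auto simp: \<tau>_def intro: mult_le_one)
    qed
    then have "continuous_map ?X (top_of_set {0..1}) (\<tau> a)"
      using c\<tau> by (auto simp: continuous_map_in_subtopology intro: continuous_map_from_subtopology)
    moreover have "e \<xi> \<in> Op a" if "\<xi> \<in> P" "\<mu> \<xi> \<le> 2 * D a \<xi>" for \<xi>
      using Dpos[OF a that(1)] \<mu>pos[OF that(1)] that(2) by linarith
    then have "continuous_map ?X (subtopology Z (Op a)) e"
      using e by (auto simp: continuous_map_in_subtopology intro: continuous_map_from_subtopology)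
    ultimately have "continuous_map ?X (prod_topology (top_of_set {0..1}) (subtopology Z (Op a))) (\<lambda>\<xi>. (\<tau> a \<xi>, e \<xi>))"
      by (rule continuous_map_pairedI)
    from continuous_map_compose[OF this H(1)[OF a]]
    show "continuous_map ?X Z (\<lambda>\<xi>. H a (\<tau> a \<xi>, e \<xi>))" by (simp add: o_def)
    show "continuous_map (subtopology (top_of_set P) {\<xi> \<in> topspace (top_of_set P). 2 * D a \<xi> \<le> \<mu> \<xi>}) Z e"
      by (rule continuous_map_from_subtopology[OF e])
    show "H a (\<tau> a \<xi>, e \<xi>) = e \<xi>" if "\<xi> \<in> topspace (top_of_set P)" "\<mu> \<xi> = 2 * D a \<xi>" for \<xi>
    proof -
      have "\<tau> a \<xi> = 0" using that \<mu>pos[of \<xi>] by (auto simp: \<tau>_def)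
      then show ?thesis using H(2)[OF a] by simp
    qed
  qed
  moreover have "\<Phi> a \<xi> = e \<xi>" if "a \<in> \<sigma>" "\<xi> \<in> P" "t \<xi> = 0" for a \<xi>
    using that H(2) by (simp add: \<Phi>_def \<tau>_def)
  moreover have "\<exists>a\<in>\<sigma>. \<Phi> a \<xi> = b" if "\<xi> \<in> P" "t \<xi> = 1" for \<xi>
  proof -
    obtain a where a: "a \<in> \<sigma>" "\<mu> \<xi> \<le> D a \<xi>" using max by blast
    have "1 \<le> 2 * D a \<xi> / \<mu> \<xi> - 1" using a \<mu>pos[OF that(1)] by (simp add: field_simps)
    then have "\<tau> a \<xi> = 1" using that by (simp add: \<tau>_def)
    then show ?thesis using a H(3) D0[of a \<xi>] by (intro bexI[of _ a]) (auto simp: \<Phi>_def)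
  qed
  ultimately show ?thesis by (intro exI[of _ \<Phi>]) blast
qed

text \<open>The coordinates deformed along the cover, sampled on a sufficiently fine grid, would be
  an instance of \<open>grid_map\<close>.\<close>

theorem no_small_categorical_cover:
  assumes L: "simplicial_complex_on m L" and V: "V \<subseteq> {1..m}" and F: "F \<subseteq> Pow V" "F \<subseteq> L"
    and card: "\<And>S. S \<in> F \<Longrightarrow> card S = card \<sigma>" and \<sigma>: "\<sigma> \<in> F" "\<sigma> \<noteq> {}"
    and ridge: "\<And>R. R \<subseteq> V \<Longrightarrow> even (card {S \<in> F. \<exists>v\<in>S. S - {v} = R})"
    and \<kappa>: "\<And>v. v \<in> V - \<sigma> \<Longrightarrow> \<kappa> v \<in> \<sigma> \<and> {v, \<kappa> v} \<notin> L"
    and Op: "\<And>a. a \<in> \<sigma> \<Longrightarrow> openin (moment_angle_complex m L) (Op a)"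
    and cover: "topspace (moment_angle_complex m L) \<subseteq> (\<Union>a\<in>\<sigma>. Op a)"
    and null: "\<And>a. a \<in> \<sigma> \<Longrightarrow>
      null_homotopic (subtopology (moment_angle_complex m L) (Op a)) (moment_angle_complex m L) (\<lambda>x. x)"
  shows False
proof -
  let ?Z = "moment_angle_complex m L"
  let ?P = "params V F"
  note top = topspace_moment_angle_complex[OF L]
  have finV: "finite V" using V finite_subset by blast
  have finF: "finite F" using F(1) finV by (meson finite_Pow_iff finite_subset)
  have \<sigma>V: "\<sigma> \<subseteq> V" using F(1) \<sigma>(1) by auto
  then have fin\<sigma>: "finite \<sigma>" using finV finite_subset by blast
  note cP = compact_params[OF finF, of V]
  have ct: "continuous_on ?P (\<lambda>\<xi>. \<xi> T)" by (rule continuous_on_coordinate)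
  have t01: "0 \<le> \<xi> T \<and> \<xi> T \<le> 1" if "\<xi> \<in> ?P" for \<xi> using that by (auto simp: params_def)
  have ce: "continuous_map (top_of_set ?P) ?Z (param_point m V)"
    by (rule continuous_map_param_point[OF L F(2)])
  have null': "homotopic_with (\<lambda>h. True) (subtopology ?Z (Op a)) ?Z (\<lambda>x. x) (\<lambda>x. basepoint m)" if "a \<in> \<sigma>" for a
    by (rule null_homotopic_to_basepoint[OF L null[OF that]])
  obtain \<Phi> where \<Phi>: "\<And>a. a \<in> \<sigma> \<Longrightarrow> continuous_map (top_of_set ?P) ?Z (\<Phi> a)"
    "\<And>a \<xi>. a \<in> \<sigma> \<Longrightarrow> \<xi> \<in> ?P \<Longrightarrow> \<xi> T = 0 \<Longrightarrow> \<Phi> a \<xi> = param_point m V \<xi>"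
    "\<And>\<xi>. \<xi> \<in> ?P \<Longrightarrow> \<xi> T = 1 \<Longrightarrow> \<exists>a\<in>\<sigma>. \<Phi> a \<xi> = basepoint m"
    using deformations_from_cover[where P = ?P and Z = ?Z and \<sigma> = \<sigma> and e = "param_point m V"
        and t = "\<lambda>\<xi>. \<xi> T" and Op = Op and b = "basepoint m"]
      compact_imp_closed[OF cP] fin\<sigma> \<sigma>(2) ce ct t01 Op cover null' by blast
  define \<kappa>' where "\<kappa>' v = (if v \<in> \<sigma> then v else \<kappa> v)" for v
  have \<kappa>': "\<kappa>' v \<in> \<sigma>" if "v \<in> V" for v using that \<kappa> by (auto simp: \<kappa>'_def)
  have cont: "continuous_on ?P (\<lambda>\<xi>. \<Phi> (\<kappa>' v) \<xi> v)" if "v \<in> V" for v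
    using continuous_map_compose[OF \<Phi>(1)[OF \<kappa>'[OF that]] continuous_map_moment_angle_coordinate[OF L, of v]] that V
    by (auto simp: o_def)
  have "\<exists>\<delta>>0. \<forall>\<xi>\<in>?P. \<forall>\<xi>'\<in>?P. dist \<xi> \<xi>' < \<delta> \<longrightarrow> cmod (\<Phi> (\<kappa>' v) \<xi> v - \<Phi> (\<kappa>' v) \<xi>' v) < 1 / 4" if v: "v \<in> V" for v
  proof -
    have "uniformly_continuous_on ?P (\<lambda>\<xi>. \<Phi> (\<kappa>' v) \<xi> v)"
      by (rule compact_uniformly_continuous[OF cont[OF v] cP])
    then obtain \<delta> where "\<delta> > 0" "\<forall>\<xi>\<in>?P. \<forall>\<xi>'\<in>?P. dist \<xi>' \<xi> < \<delta> \<longrightarrow> dist (\<Phi> (\<kappa>' v) \<xi>' v) (\<Phi> (\<kappa>' v) \<xi> v) < 1 / 4"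
      unfolding uniformly_continuous_on_def by (meson zero_less_divide_1_iff zero_less_numeral)
    then show ?thesis by (auto simp: dist_norm)
  qed
  then obtain \<delta> where \<delta>: "\<And>v. v \<in> V \<Longrightarrow> \<delta> v > 0"
    "\<And>v \<xi> \<xi>'. v \<in> V \<Longrightarrow> \<xi> \<in> ?P \<Longrightarrow> \<xi>' \<in> ?P \<Longrightarrow> dist \<xi> \<xi>' < \<delta> v \<Longrightarrow> cmod (\<Phi> (\<kappa>' v) \<xi> v - \<Phi> (\<kappa>' v) \<xi>' v) < 1 / 4"
    by metis
  define \<delta>0 where "\<delta>0 = Min (insert 1 (\<delta> ` V))"
  have \<delta>0: "\<delta>0 > 0" "\<And>v. v \<in> V \<Longrightarrow> \<delta>0 \<le> \<delta> v" using finV \<delta>(1) by (auto simp: \<delta>0_def)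
  obtain \<eta> where \<eta>: "\<eta> > 0" "\<And>x y :: coord \<Rightarrow> real. (\<And>c. \<bar>x c - y c\<bar> \<le> \<eta>) \<Longrightarrow> dist x y < \<delta>0"
    using dist_fun_small[OF \<delta>0(1)] by blast
  obtain n :: nat where n: "1 / \<eta> < n" using reals_Archimedean2 by blast
  \<comment> \<open>The summand 2 secures \<open>q \<ge> 2\<close> for every \<open>n\<close>; the
    mesh \<open>1 / p\<close> is then below \<open>\<eta>\<close>.\<close>
  define q where "q = int n + 2"
  define p where "p = 2 * q"
  have p0: "p > 0" by (simp add: p_def q_def)
  have "1 / \<eta> \<le> p" using n by (simp add: p_def q_def)
  then have p\<eta>: "1 / p \<le> \<eta>" using \<eta>(1) p0 by (simp add: field_simps)
  define \<phi> where "\<phi> y v = \<Phi> (\<kappa>' v) (\<lambda>c. real_of_int (y c) / p) v" for y v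
  have reg: "(\<lambda>c. real_of_int (y c) / p) \<in> ?P" if "S \<in> F" "in_region p V S y" for S y
    by (rule in_region_imp_params[OF that p0])
  interpret grid_map q p V \<sigma> F \<kappa> \<phi>
  proof
    show "q \<ge> 2" "p = 2 * q" by (auto simp: q_def p_def)
    show "\<phi> y v = square_to_disc (y (U v) / p) (y (W v) / p)"
      if "S \<in> F" "in_region p V S y" "y T = 0" "v \<in> V" for y S v
      using \<Phi>(2)[OF \<kappa>'[OF that(4)] reg[OF that(1,2)]] that V by (auto simp: \<phi>_def param_point_def)
    show "\<exists>v\<in>V. Re (\<phi> y v) \<ge> 0" if h: "S \<in> F" "in_region p V S y" "y T = p" for y S
    proof -
      obtain a where "a \<in> \<sigma>" "\<Phi> a (\<lambda>c. real_of_int (y c) / p) = basepoint m"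
        using \<Phi>(3)[OF reg[OF h(1,2)]] h(3) p0 by auto
      \<comment> \<open>The coordinate \<open>a\<close> follows the homotopy of \<open>a\<close>
        itself, since \<open>\<kappa>' a = a\<close>, and ends at 1.\<close>
      then show ?thesis using \<sigma>V V by (intro bexI[of _ a]) (auto simp: \<phi>_def \<kappa>'_def basepoint_def)
    qed
    show "cmod (\<phi> y v - \<phi> z v) < 1 / 4"
      if "S \<in> F" "in_region p V S y" "in_region p V S z" "\<And>c. \<bar>y c - z c\<bar> \<le> 1" "v \<in> V" for y z S v
      unfolding \<phi>_def
    proof (rule \<delta>(2)[OF that(5) reg[OF that(1,2)] reg[OF that(1,3)]])
      have "\<bar>real_of_int (y c) / p - real_of_int (z c) / p\<bar> \<le> \<eta>" for c
      proof -
        have "\<bar>real_of_int (y c) / p - real_of_int (z c) / p\<bar> = \<bar>real_of_int (y c - z c)\<bar> / p"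
          using p0 by (simp add: diff_divide_distrib[symmetric])
        also have "\<dots> \<le> 1 / p"
          using that(4)[of c] p0 by (intro divide_right_mono) linarith+
        finally show ?thesis using p\<eta> by linarith
      qed
      then show "dist (\<lambda>c. real_of_int (y c) / p) (\<lambda>c. real_of_int (z c) / p) < \<delta> v"
        by (intro order.strict_trans2[OF \<eta>(2) \<delta>0(2)[OF that(5)]])
    qed
    show "\<kappa> v \<in> \<sigma>" if "v \<in> V - \<sigma>" for v using \<kappa>[OF that] by simp
    show "cmod (\<phi> y (\<kappa> v)) = 1"
      if h: "S \<in> F" "in_region p V S y" "v \<in> V - \<sigma>" "cmod (\<phi> y v) < 1" for y S v
    proof -
      have a: "\<kappa> v \<in> \<sigma>" "{v, \<kappa> v} \<notin> L" using \<kappa>[OF h(3)] by auto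
      \<comment> \<open>The coordinates \<open>v\<close> and \<open>\<kappa> v\<close> are read off
        the same point \<open>z\<close> of the complex, where the vertices inside the open disc form
        a face of \<open>L\<close>.\<close>
      define z where "z = \<Phi> (\<kappa> v) (\<lambda>c. real_of_int (y c) / p)"
      have "z \<in> topspace ?Z"
        using continuous_map_image_subset_topspace[OF \<Phi>(1)[OF a(1)]] reg[OF h(1,2)] by (auto simp: z_def)
      then have z: "\<forall>v\<in>{1..m}. cmod (z v) \<le> 1" "{v \<in> {1..m}. cmod (z v) < 1} \<in> L" by (auto simp: top)
      have zv: "cmod (z v) < 1" "\<phi> y (\<kappa> v) = z (\<kappa> v)"
        using h(3,4) a by (auto simp: \<phi>_def z_def \<kappa>'_def)
      have mem: "v \<in> {1..m}" "\<kappa> v \<in> {1..m}" using h(3) a \<sigma>V V by auto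
      show ?thesis
      proof (rule ccontr)
        assume "\<not> ?thesis"
        then have "cmod (z (\<kappa> v)) < 1" using zv(2) bspec[OF z(1) mem(2)] by simp
        then have "{v, \<kappa> v} \<subseteq> {v \<in> {1..m}. cmod (z v) < 1}" using zv(1) mem by auto
        then show False using simplicial_complex_onD(3)[OF L z(2)] a(2) by blast
      qed
    qed
  qed (fact finV F(1) card \<sigma> ridge)+
  show False by (rule no_grid_map)
qed

section \<open>The upper bound\<close>

text \<open>Coordinates in the face move freely within the convex disc; all others stay fixed on the
  circle.\<close>

lemma linear_homotopy_moment_angle_complex:
  assumes L: "simplicial_complex_on m L"
    and f: "continuous_map X (moment_angle_complex m L) f" and g: "continuous_map X (moment_angle_complex m L) g"
    and face: "\<And>x. x \<in> topspace X \<Longrightarrow> \<exists>I\<in>L. \<forall>v\<in>{1..m} - I. f x v = g x v \<and> cmod (f x v) = 1"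
  shows "homotopic_with (\<lambda>h. True) X (moment_angle_complex m L) f g"
proof -
  note top = topspace_moment_angle_complex[OF L]
  define h where "h p = (\<lambda>v\<in>{1..m}. (1 - fst p) *\<^sub>R f (snd p) v + fst p *\<^sub>R g (snd p) v)" for p
  let ?P = "prod_topology (top_of_set {0..1::real}) X"
  have fm: "f x \<in> topspace (moment_angle_complex m L)" "g x \<in> topspace (moment_angle_complex m L)"
    if "x \<in> topspace X" for x
    using continuous_map_image_subset_topspace[OF f] continuous_map_image_subset_topspace[OF g] that by auto
  have "continuous_map ?P (moment_angle_complex m L) h"
    unfolding continuous_map_into_moment_angle_complex[OF L]
  proof (intro conjI ballI image_subsetI)
    fix p assume "p \<in> topspace ?P"
    then obtain t x where p: "p = (t, x)" "0 \<le> t" "t \<le> 1" "x \<in> topspace X" by auto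
    obtain I where I: "I \<in> L" "\<And>v. v \<in> {1..m} - I \<Longrightarrow> f x v = g x v \<and> cmod (f x v) = 1"
      using face[OF p(4)] by blast
    have "cmod (h p v) = 1" if "v \<in> {1..m} - I" for v
    proof -
      have "f x v = g x v" "cmod (g x v) = 1" using I(2)[OF that] by auto
      then show ?thesis using that by (simp add: h_def p scaleR_add_left[symmetric])
    qed
    then have "{v \<in> {1..m}. cmod (h p v) < 1} \<subseteq> I" by force
    then have "{v \<in> {1..m}. cmod (h p v) < 1} \<in> L" using simplicial_complex_onD(3)[OF L I(1)] by blast
    moreover have "cmod (h p v) \<le> 1" if "v \<in> {1..m}" for v
      using that fm[OF p(4)] norm_convex_le_1[of "f x v" "g x v" t] p by (auto simp: h_def top)
    ultimately show "h p \<in> topspace (moment_angle_complex m L)"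
      by (simp add: top) (simp add: h_def)
  next
    fix v assume v: "v \<in> {1..m}"
    have fv: "continuous_map X euclidean (\<lambda>x. f x v)" "continuous_map X euclidean (\<lambda>x. g x v)"
      using f g v unfolding continuous_map_into_moment_angle_complex[OF L] by auto
    have "continuous_map ?P (prod_topology euclideanreal (prod_topology euclidean euclidean)) (\<lambda>p. (fst p, f (snd p) v, g (snd p) v))"
    proof (intro continuous_map_pairedI)
      show "continuous_map ?P euclideanreal fst"
        by (rule continuous_map_into_fulltopology[OF continuous_map_fst])
      show "continuous_map ?P euclidean (\<lambda>p. f (snd p) v)" "continuous_map ?P euclidean (\<lambda>p. g (snd p) v)"
        using continuous_map_compose[OF continuous_map_snd fv(1)] continuous_map_compose[OF continuous_map_snd fv(2)]
        by (auto simp: o_def)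
    qed
    then have c: "continuous_map ?P (euclidean :: (real \<times> complex \<times> complex) topology) (\<lambda>p. (fst p, f (snd p) v, g (snd p) v))"
      by simp
    have "continuous_map euclidean euclidean (\<lambda>(t, a, b). (1 - t) *\<^sub>R a + t *\<^sub>R b :: complex)"
      by (simp add: case_prod_unfold) (intro continuous_intros)
    from continuous_map_compose[OF c this]
    show "continuous_map ?P euclidean (\<lambda>p. h p v)"
      using v by (simp add: o_def h_def)
  qed
  moreover have "h (0, x) = f x" "h (1, x) = g x" if "x \<in> topspace X" for x
    using fm[OF that] by (auto simp: h_def top extensional_def fun_eq_iff)
  ultimately show ?thesis
    by (subst homotopic_with) auto
qed

text \<open>Coordinates near the circle are pushed onto it and the others are moved to \<open>1\<close>; this lands in the
  torus, whose coordinates can then be contracted through the disc one after the other.\<close>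

lemma contract_avoiding_radius:
  assumes L: "simplicial_complex_on m L" and \<delta>: "0 < \<delta>" "\<delta> < 1"
  defines "N \<equiv> {z \<in> topspace (moment_angle_complex m L). \<forall>v\<in>{1..m}. 1 - cmod (z v) \<noteq> \<delta>}"
  shows "homotopic_with (\<lambda>h. True) (subtopology (moment_angle_complex m L) N) (moment_angle_complex m L)
    (\<lambda>z. z) (\<lambda>z. basepoint m)"
proof -
  let ?Z = "moment_angle_complex m L" and ?X = "subtopology (moment_angle_complex m L) N"
  note top = topspace_moment_angle_complex[OF L]
  define push where "push v z = (if \<delta> \<le> 1 - cmod (z v) then 1 else sgn (z v))" for v and z :: "nat \<Rightarrow> complex"
  define keep where "keep v z = (if \<delta> \<le> 1 - cmod (z v) then z v else sgn (z v))" for v and z :: "nat \<Rightarrow> complex"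
  define f where "f z = (\<lambda>v\<in>{1..m}. keep v z)" for z
  \<comment> \<open>From \<open>g 0\<close> to \<open>g m\<close> the torus coordinates are replaced
    by 1 one at a time.\<close>
  define g where "g k z = (\<lambda>v\<in>{1..m}. if v \<le> k then 1 else push v z)" for k z
  have X: "z \<in> topspace ?Z" "\<forall>v\<in>{1..m}. 1 - cmod (z v) \<noteq> \<delta>" if "z \<in> topspace ?X" for z
    using that by (auto simp: N_def)
  have coord: "continuous_map ?X euclidean (\<lambda>z. z v)" if "v \<in> {1..m}" for v
    by (rule continuous_map_from_subtopology[OF continuous_map_moment_angle_coordinate[OF L that]])
  have glue: "continuous_map ?X euclidean (\<lambda>z. if \<delta> \<le> 1 - cmod (z v) then F z else sgn (z v))"
    if v: "v \<in> {1..m}" and F: "continuous_map ?X euclidean F" for v F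
  proof (rule continuous_map_cases_le)
    show "continuous_map ?X euclideanreal (\<lambda>z. \<delta>)" by simp
    show "continuous_map ?X euclideanreal (\<lambda>z. 1 - cmod (z v))"
      using coord[OF v] by (intro continuous_intros)
    show "continuous_map (subtopology ?X {z \<in> topspace ?X. \<delta> \<le> 1 - cmod (z v)}) euclidean F"
      by (rule continuous_map_from_subtopology[OF F])
    let ?X' = "subtopology ?X {z \<in> topspace ?X. 1 - cmod (z v) \<le> \<delta>}"
    have away: "continuous_map ?X' (top_of_set (- {0})) (\<lambda>z. z v)"
      using coord[OF v] \<delta> by (auto simp: continuous_map_in_subtopology intro: continuous_map_from_subtopology)
    have "continuous_map (top_of_set (- {0::complex})) euclidean sgn"
      by (auto intro!: continuous_intros)
    from continuous_map_compose[OF away this]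
    show "continuous_map ?X' euclidean (\<lambda>z. sgn (z v))" by (simp add: o_def)
    \<comment> \<open>The two branches meet only at the radius that \<open>N\<close> excludes, so
      there is nothing to match.\<close>
    show "F z = sgn (z v)" if "z \<in> topspace ?X" "\<delta> = 1 - cmod (z v)" for z
      using X(2)[OF that(1)] that(2) v by auto
  qed
  have norm_push: "cmod (push v z) = 1" for v z
    using \<delta> by (auto simp: push_def norm_sgn)
  have cf: "continuous_map ?X ?Z f"
    unfolding continuous_map_into_moment_angle_complex[OF L]
  proof (intro conjI ballI image_subsetI)
    fix z assume z: "z \<in> topspace ?X"
    have "{v \<in> {1..m}. cmod (f z v) < 1} \<subseteq> {v \<in> {1..m}. cmod (z v) < 1}"
      using \<delta> by (auto simp: f_def keep_def norm_sgn split: if_splits)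
    then have "{v \<in> {1..m}. cmod (f z v) < 1} \<in> L"
      using simplicial_complex_onD(3)[OF L] X(1)[OF z] unfolding top by blast
    moreover have "cmod (f z v) \<le> 1" if "v \<in> {1..m}" for v
      using that X(1)[OF z] by (auto simp: f_def keep_def norm_sgn top)
    ultimately show "f z \<in> topspace ?Z" by (simp add: top) (simp add: f_def)
  next
    show "continuous_map ?X euclidean (\<lambda>z. f z v)" if "v \<in> {1..m}" for v
      using glue[OF that coord[OF that]] that by (simp add: f_def keep_def)
  qed
  have cg: "continuous_map ?X ?Z (g k)" for k
    unfolding continuous_map_into_moment_angle_complex[OF L]
  proof (intro conjI ballI image_subsetI)
    fix z assume z: "z \<in> topspace ?X"
    have 1: "cmod (g k z v) = 1" if "v \<in> {1..m}" for v
      using that norm_push by (simp add: g_def)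
    then have "{v \<in> {1..m}. cmod (g k z v) < 1} = {}" by auto
    then have "{v \<in> {1..m}. cmod (g k z v) < 1} \<in> L"
      using simplicial_complex_onD(1)[OF L] by (simp only:)
    then show "g k z \<in> topspace ?Z" using 1 by (simp add: top) (simp add: g_def)
  next
    show "continuous_map ?X euclidean (\<lambda>z. g k z v)" if "v \<in> {1..m}" for v
    proof (cases "v \<le> k")
      case False
      then show ?thesis
        using glue[OF that, of "\<lambda>z. 1"] that by (simp add: g_def push_def)
    qed (use that in \<open>simp add: g_def\<close>)
  qed
  have "homotopic_with (\<lambda>h. True) ?X ?Z (\<lambda>z. z) f"
  proof (rule linear_homotopy_moment_angle_complex[OF L _ cf])
    show "continuous_map ?X ?Z (\<lambda>z. z)" by (simp add: continuous_map_from_subtopology)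
    fix z assume z: "z \<in> topspace ?X"
    have "z v = f z v \<and> cmod (z v) = 1" if "v \<in> {1..m} - {v \<in> {1..m}. cmod (z v) < 1}" for v
    proof -
      have "cmod (z v) = 1" using that X(1)[OF z] by (auto simp: top not_less intro: antisym)
      then show ?thesis using that \<delta> by (auto simp: f_def keep_def sgn_eq)
    qed
    then show "\<exists>I\<in>L. \<forall>v\<in>{1..m} - I. z v = f z v \<and> cmod (z v) = 1"
      using X(1)[OF z] unfolding top by blast
  qed
  also have "homotopic_with (\<lambda>h. True) ?X ?Z f (g 0)"
  proof (rule linear_homotopy_moment_angle_complex[OF L cf cg])
    fix z assume z: "z \<in> topspace ?X"
    let ?I = "{v \<in> {1..m}. \<delta> \<le> 1 - cmod (z v)}"
    have "?I \<subseteq> {v \<in> {1..m}. cmod (z v) < 1}" using \<delta> by auto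
    then have "?I \<in> L" using simplicial_complex_onD(3)[OF L] X(1)[OF z] unfolding top by blast
    moreover have "f z v = g 0 z v \<and> cmod (f z v) = 1" if "v \<in> {1..m} - ?I" for v
      using that \<delta> by (auto simp: f_def g_def keep_def push_def norm_sgn)
    ultimately show "\<exists>I\<in>L. \<forall>v\<in>{1..m} - I. f z v = g 0 z v \<and> cmod (f z v) = 1" by blast
  qed
  also (homotopic_with_trans) have "homotopic_with (\<lambda>h. True) ?X ?Z (g 0) (g m)"
  proof -
    have "homotopic_with (\<lambda>h. True) ?X ?Z (g 0) (g k)" if "k \<le> m" for k
      using that
    proof (induction k)
      case 0
      then show ?case using cg by simp
    next
      case (Suc k)
      have "homotopic_with (\<lambda>h. True) ?X ?Z (g k) (g (Suc k))"
      proof (rule linear_homotopy_moment_angle_complex[OF L cg cg])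
        fix z
        \<comment> \<open>Since every vertex is a face, a single coordinate may cross its disc while
          all others stay on the circle.\<close>
        have "{Suc k} \<in> L" using simplicial_complex_onD(4)[OF L, of "Suc k"] Suc.prems by simp
        moreover have "g k z v = g (Suc k) z v \<and> cmod (g k z v) = 1" if "v \<in> {1..m} - {Suc k}" for v
          using that norm_push by (auto simp: g_def)
        ultimately show "\<exists>I\<in>L. \<forall>v\<in>{1..m} - I. g k z v = g (Suc k) z v \<and> cmod (g k z v) = 1" by blast
      qed
      then show ?case using Suc homotopic_with_trans by fastforce
    qed
    then show ?thesis by simp
  qed
  also (homotopic_with_trans) have "g m = (\<lambda>z. basepoint m)" by (auto simp: g_def basepoint_def fun_eq_iff)
  finally show ?thesis .
qed

theorem ls_cat_moment_angle_complex_le: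
  assumes L: "simplicial_complex_on m L" and dim: "\<And>I. I \<in> L \<Longrightarrow> card I \<le> n"
  shows "ls_cat (moment_angle_complex m L) \<le> enat n"
proof -
  let ?Z = "moment_angle_complex m L"
  note top = topspace_moment_angle_complex[OF L]
  define \<delta> where "\<delta> k = 1 / (real k + 2)" for k
  have \<delta>: "0 < \<delta> k" "\<delta> k < 1" for k by (simp_all add: \<delta>_def)
  define N where "N k = {z \<in> topspace ?Z. \<forall>v\<in>{1..m}. 1 - cmod (z v) \<noteq> \<delta> k}" for k
  have "categorical_cover ?Z n N"
    unfolding categorical_cover_def
  proof (intro conjI allI impI)
    fix k
    have "openin ?Z {z \<in> topspace ?Z. 1 - cmod (z v) \<in> - {\<delta> k}}" if "v \<in> {1..m}" for v
      using continuous_map_moment_angle_coordinate[OF L that]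
      by (intro openin_continuous_map_preimage[of _ euclideanreal] continuous_intros) auto
    then have "openin ?Z (topspace ?Z \<inter> (\<Inter>v\<in>{1..m}. {z \<in> topspace ?Z. 1 - cmod (z v) \<in> - {\<delta> k}}))"
      by (intro openin_Int_Inter) auto
    also have "topspace ?Z \<inter> (\<Inter>v\<in>{1..m}. {z \<in> topspace ?Z. 1 - cmod (z v) \<in> - {\<delta> k}}) = N k"
      by (auto simp: N_def)
    finally show "openin ?Z (N k)" .
    show "null_homotopic (subtopology ?Z (N k)) ?Z (\<lambda>x. x)"
      unfolding null_homotopic_def N_def
      using contract_avoiding_radius[OF L \<delta>] basepoint_in_moment_angle_complex[OF L] by blast
  next
    show "topspace ?Z = (\<Union>k\<le>n. N k)"
    proof (intro equalityI subsetI)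
      fix z assume z: "z \<in> topspace ?Z"
      show "z \<in> (\<Union>k\<le>n. N k)"
      proof (rule ccontr)
        assume "z \<notin> (\<Union>k\<le>n. N k)"
        then have all: "\<forall>k\<le>n. \<exists>v\<in>{1..m}. 1 - cmod (z v) = \<delta> k" using z by (auto simp: N_def)
        \<comment> \<open>At most \<open>n\<close> coordinates lie off the circle, too few to hit all \<open>n + 1\<close> radii.\<close>
        have "\<delta> ` {..n} \<subseteq> (\<lambda>v. 1 - cmod (z v)) ` {v \<in> {1..m}. cmod (z v) < 1}"
        proof (intro image_subsetI)
          fix k assume "k \<in> {..n}"
          then obtain v where v: "v \<in> {1..m}" "1 - cmod (z v) = \<delta> k"
            using all by (meson atMost_iff)
          then show "\<delta> k \<in> (\<lambda>v. 1 - cmod (z v)) ` {v \<in> {1..m}. cmod (z v) < 1}"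
            using \<delta>(1)[of k] by (intro image_eqI[of _ _ v]) auto
        qed
        then have "card (\<delta> ` {..n}) \<le> card {v \<in> {1..m}. cmod (z v) < 1}"
          by (rule surj_card_le[rotated]) simp
        also have "\<dots> \<le> n" using dim z by (simp add: top)
        finally have "card (\<delta> ` {..n}) \<le> n" .
        moreover have "inj_on \<delta> {..n}" by (auto simp: inj_on_def \<delta>_def)
        ultimately show False by (simp add: card_image)
      qed
    qed (auto simp: N_def)
  qed
  then show ?thesis unfolding ls_cat_def by (intro Inf_lower) blast
qed

section \<open>Flag triangulations\<close>

text \<open>A non-face contains a minimal one, which by flagness is a pair.\<close>

lemma flag_complex_clique:
  assumes K: "simplicial_complex_on m K" and flag: "flag_complex m K"
    and I: "I \<subseteq> {1..m}" and pairs: "\<And>x y. x \<in> I \<Longrightarrow> y \<in> I \<Longrightarrow> {x, y} \<in> K"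
  shows "I \<in> K"
proof (rule ccontr)
  assume "I \<notin> K"
  define \<N> where "\<N> = {J. J \<subseteq> I \<and> J \<notin> K}"
  have "finite I" using I finite_subset by blast
  then have "finite \<N>" by (simp add: \<N>_def)
  moreover have "I \<in> \<N>" using \<open>I \<notin> K\<close> by (simp add: \<N>_def)
  ultimately obtain J where J: "J \<in> \<N>" "\<And>J'. J' \<in> \<N> \<Longrightarrow> J' \<subseteq> J \<Longrightarrow> J = J'"
    using finite_has_minimal[of \<N>] by blast
  have "minimal_nonface m K J"
    unfolding minimal_nonface_def
  proof (intro conjI allI impI)
    show "J \<subseteq> {1..m}" "J \<notin> K" using J(1) I by (auto simp: \<N>_def)
    fix J' assume "J' \<subset> J"
    then show "J' \<in> K" using J by (auto simp: \<N>_def)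
  qed
  then have "card J = 2" using flag by (simp add: flag_complex_def)
  then obtain x y where "J = {x, y}" by (auto simp: card_2_iff)
  then show False using J(1) pairs[of x y] by (auto simp: \<N>_def)
qed

text \<open>If a maximal face had fewer than \<open>d + 1\<close> vertices, its open star would sit
  in a hyperplane of the local model.\<close>

lemma face_in_facet:
  assumes K: "simplicial_complex_on m K" and X: "locally_Euclidean d (geometric_realization m K)"
    and m: "m \<ge> 1" and I: "I \<in> K"
  shows "\<exists>S\<in>K. I \<subseteq> S \<and> card S = Suc d"
proof -
  have "\<exists>S. (S \<in> K \<and> I \<subseteq> S) \<and> (\<forall>S'. S' \<in> K \<and> I \<subseteq> S' \<longrightarrow> card S' \<le> card S)"
    by (rule ex_has_greatest_nat[of _ I _ "Suc (Suc d)"]) (use I card_face_le[OF K X] in \<open>auto simp: less_Suc_eq_le\<close>)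
  then obtain S where S: "S \<in> K" "I \<subseteq> S" and max: "\<And>S'. S' \<in> K \<Longrightarrow> I \<subseteq> S' \<Longrightarrow> card S' \<le> card S" by blast
  have fin: "finite S" using simplicial_complex_onD(2)[OF K S(1)] finite_subset by blast
  have "S \<noteq> {}"
  proof
    assume "S = {}"
    then have "card {1::nat} \<le> card S" using S(2) m simplicial_complex_onD(4)[OF K, of 1] by (intro max) auto
    then show False using \<open>S = {}\<close> by simp
  qed
  then obtain n where n: "card S = Suc n" using fin by (metis card_gt_0_iff gr0_implies_Suc)
  have "\<not> n < d"
  proof
    assume "n < d"
    show False
    \<comment> \<open>Since 0 is not a vertex, its weight vanishes on the whole star: a degenerate
      page.\<close>
    proof (rule page_not_locally_Euclidean[OF K X S(1) n \<open>n < d\<close>, of 0])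
      show "0 \<notin> S" using simplicial_complex_onD(2)[OF K S(1)] by auto
      fix I' assume I': "I' \<in> K" "S \<subseteq> I'"
      have "finite I'" using simplicial_complex_onD(2)[OF K I'(1)] finite_subset by blast
      then have "S = I'" using I' max[OF I'(1)] S(2) by (intro card_seteq) auto
      then show "I' \<subseteq> insert 0 S" by auto
    qed
  qed
  then have "card S = Suc d" using card_face_le[OF K X S(1)] n by simp
  then show ?thesis using S by blast
qed

text \<open>With one further vertex the star would be a half-space, with three or more it would
  branch.\<close>

lemma ridge_in_two_facets:
  assumes K: "simplicial_complex_on m K" and X: "locally_Euclidean d (geometric_realization m K)"
    and m: "m \<ge> 1" and \<tau>: "\<tau> \<in> K" "card \<tau> = d" and d: "d > 0"
  shows "card {w. w \<notin> \<tau> \<and> insert w \<tau> \<in> K} = 2" (is "card ?N = 2")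
proof -
  obtain n where n: "d = Suc n" using d gr0_implies_Suc by blast
  have "?N \<subseteq> {1..m}" using simplicial_complex_onD(2)[OF K] by blast
  then have fin: "finite ?N" using finite_subset by blast
  obtain S where S: "S \<in> K" "\<tau> \<subseteq> S" "card S = Suc d" using face_in_facet[OF K X m \<tau>(1)] by blast
  then obtain w where w: "w \<in> S" "w \<notin> \<tau>" using \<tau>(2) by (metis n_not_Suc_n subsetI subset_antisym)
  then have "insert w \<tau> \<in> K" using simplicial_complex_onD(3)[OF K S(1)] S(2) by blast
  then have wN: "w \<in> ?N" using w by simp
  have "card ?N \<noteq> 1"
  proof
    assume "card ?N = 1"
    then have N: "?N = {w}" using wN by (metis card_1_singletonE singletonD)
    show False
    proof (rule page_not_locally_Euclidean[OF K X \<tau>(1) _ _ w(2)])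
      show "card \<tau> = Suc n" "n < d" using \<tau> n by auto
      fix I assume I: "I \<in> K" "\<tau> \<subseteq> I"
      show "I \<subseteq> insert w \<tau>"
      proof
        fix u assume u: "u \<in> I"
        then have "insert u \<tau> \<in> K" using simplicial_complex_onD(3)[OF K I(1)] I(2) by blast
        then show "u \<in> insert w \<tau>" using N by blast
      qed
    qed
  qed
  moreover have "\<not> 3 \<le> card ?N"
  proof
    assume "3 \<le> card ?N"
    then obtain A where "A \<subseteq> ?N" "card A = 3" by (meson obtain_subset_with_card_n)
    then obtain a b c where "a \<in> ?N" "b \<in> ?N" "c \<in> ?N" "a \<noteq> b" "a \<noteq> c" "b \<noteq> c"
      by (auto simp: card_3_iff)
    then show False
      using three_pages_not_locally_Euclidean[OF K X[unfolded n] \<tau>(1) \<tau>(2)[unfolded n], of a b c] by blast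
  qed
  moreover have "card ?N > 0" using fin wN by (metis card_gt_0_iff empty_iff)
  ultimately show ?thesis by linarith
qed

text \<open>The link of a face with \<open>d - i\<close> vertices is a full subcomplex by flagness, and it is a cycle modulo 2
  of dimension \<open>i\<close>; this reduces the bound to the case where the complex is such a cycle.\<close>

theorem ls_cat_moment_angle_complex_ge:
  assumes K: "simplicial_complex_on m K" and X: "locally_Euclidean d (geometric_realization m K)"
    and m: "m \<ge> 1" and flag: "flag_complex m K" and L: "simplicial_complex_on m L"
    and i: "1 \<le> i" "i \<le> d" and sk: "skeleton i K \<subseteq> L" and LK: "L \<subseteq> K"
  shows "enat (i + 1) \<le> ls_cat (moment_angle_complex m L)"
proof -
  obtain \<sigma>0 where \<sigma>0: "\<sigma>0 \<in> K" "card \<sigma>0 = Suc d"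
    using face_in_facet[OF K X m simplicial_complex_onD(1)[OF K]] by blast
  have \<sigma>0m: "\<sigma>0 \<subseteq> {1..m}" using simplicial_complex_onD(2)[OF K \<sigma>0(1)] .
  then have fin\<sigma>0: "finite \<sigma>0" using finite_subset by blast
  have "d - i \<le> card \<sigma>0" using \<sigma>0(2) by simp
  then obtain \<rho> where \<rho>: "\<rho> \<subseteq> \<sigma>0" "card \<rho> = d - i"
    by (meson obtain_subset_with_card_n)
  have fin\<rho>: "finite \<rho>" using \<rho>(1) fin\<sigma>0 finite_subset by blast
  define \<sigma> where "\<sigma> = \<sigma>0 - \<rho>"
  have c\<sigma>: "card \<sigma> = i + 1" using \<rho> \<sigma>0(2) fin\<rho> i by (simp add: \<sigma>_def card_Diff_subset)
  \<comment> \<open>Vertices and facets of the link of \<open>\<rho>\<close>: for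
    \<open>S \<in> F\<close> the face \<open>S \<union> \<rho>\<close> has \<open>d + 1\<close>
    vertices. Having only \<open>i + 1\<close> vertices itself, \<open>S\<close> lies in the
    \<open>i\<close>-skeleton and hence in \<open>L\<close>.\<close>
  define V where "V = {v \<in> {1..m} - \<rho>. insert v \<rho> \<in> K}"
  define F where "F = {S. S \<subseteq> V \<and> card S = i + 1 \<and> S \<union> \<rho> \<in> K}"
  have \<sigma>V: "\<sigma> \<subseteq> V"
  proof
    fix v assume v: "v \<in> \<sigma>"
    then have "insert v \<rho> \<subseteq> \<sigma>0" using \<rho> by (auto simp: \<sigma>_def)
    then show "v \<in> V" using v \<sigma>0m simplicial_complex_onD(3)[OF K \<sigma>0(1)] by (auto simp: V_def \<sigma>_def)
  qed
  have "\<sigma> \<union> \<rho> = \<sigma>0" using \<rho> by (auto simp: \<sigma>_def)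
  then have \<sigma>F: "\<sigma> \<in> F" using \<sigma>V c\<sigma> \<sigma>0 by (simp add: F_def)
  have FL: "F \<subseteq> L"
  proof
    fix S assume "S \<in> F"
    then have "S \<in> K" "card S \<le> i + 1" using simplicial_complex_onD(3)[OF K, of "S \<union> \<rho>" S] by (auto simp: F_def)
    then show "S \<in> L" using sk by (auto simp: skeleton_def)
  qed
  have ridge: "even (card {S \<in> F. \<exists>v\<in>S. S - {v} = R})" if R: "R \<subseteq> V" for R
  proof (cases "{S \<in> F. \<exists>v\<in>S. S - {v} = R} = {}")
    case True
    then show ?thesis by (simp only: card.empty) simp
  next
    case False
    then obtain S v where S: "S \<in> F" "v \<in> S" "S - {v} = R" by blast
    have finS: "finite S" using S(1) c\<sigma> by (auto simp: F_def intro: card_ge_0_finite)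
    have "R \<union> \<rho> \<in> K" using S simplicial_complex_onD(3)[OF K, of "S \<union> \<rho>" "R \<union> \<rho>"] by (auto simp: F_def)
    have cR: "card R = i" using S finS by (auto simp: F_def)
    have finR: "finite R" using S(3) finS by auto
    have "card (R \<union> \<rho>) = d"
      using R cR \<rho>(2) i finR fin\<rho> by (subst card_Un_disjoint) (auto simp: V_def)
    then have two: "card {w. w \<notin> R \<union> \<rho> \<and> insert w (R \<union> \<rho>) \<in> K} = 2"
      using ridge_in_two_facets[OF K X m \<open>R \<union> \<rho> \<in> K\<close>] i by simp
    \<comment> \<open>Facets of the link through \<open>R\<close> correspond to facets of
      \<open>K\<close> through the ridge \<open>R \<union> \<rho>\<close>.\<close>
    have "{S \<in> F. \<exists>v\<in>S. S - {v} = R} = (\<lambda>w. insert w R) ` {w. w \<notin> R \<union> \<rho> \<and> insert w (R \<union> \<rho>) \<in> K}"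
    proof (intro equalityI subsetI)
      fix S assume "S \<in> {S \<in> F. \<exists>v\<in>S. S - {v} = R}"
      then obtain v where v: "S \<in> F" "v \<in> S" "S - {v} = R" by blast
      then have Sv: "S = insert v R" "v \<notin> R" by auto
      have "v \<notin> \<rho>" using v by (auto simp: F_def V_def)
      moreover have "insert v (R \<union> \<rho>) \<in> K" using v(1) Sv(1) by (simp add: F_def)
      ultimately show "S \<in> (\<lambda>w. insert w R) ` {w. w \<notin> R \<union> \<rho> \<and> insert w (R \<union> \<rho>) \<in> K}"
        using Sv by blast
    next
      fix S assume "S \<in> (\<lambda>w. insert w R) ` {w. w \<notin> R \<union> \<rho> \<and> insert w (R \<union> \<rho>) \<in> K}"
      then obtain w where w: "S = insert w R" "w \<notin> R" "w \<notin> \<rho>" "insert w (R \<union> \<rho>) \<in> K" by blast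
      have "insert w \<rho> \<in> K" using simplicial_complex_onD(3)[OF K w(4)] by blast
      moreover have "w \<in> {1..m}" using simplicial_complex_onD(2)[OF K w(4)] by auto
      ultimately have "w \<in> V" using w(3) by (simp add: V_def)
      then have "S \<in> F" using w R cR finR by (simp add: F_def)
      moreover have "S - {w} = R" using w by auto
      ultimately show "S \<in> {S \<in> F. \<exists>v\<in>S. S - {v} = R}" using w(1) by blast
    qed
    moreover have "inj_on (\<lambda>w. insert w R) {w. w \<notin> R \<union> \<rho> \<and> insert w (R \<union> \<rho>) \<in> K}"
      by (auto simp: inj_on_def)
    ultimately show ?thesis using two by (simp add: card_image)
  qed
  \<comment> \<open>Otherwise \<open>v\<close> is adjacent to \<open>\<sigma>\<close>, and to
    \<open>\<rho>\<close> because it lies in the link. Flagness then makes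
    \<open>insert v \<sigma>0\<close> a face with \<open>d + 2\<close> vertices, one too
    many.\<close>
  have "\<exists>a. a \<in> \<sigma> \<and> {v, a} \<notin> L" if v: "v \<in> V - \<sigma>" for v
  proof (rule ccontr)
    assume "\<nexists>a. a \<in> \<sigma> \<and> {v, a} \<notin> L"
    then have adj\<sigma>: "{v, a} \<in> K" if "a \<in> \<sigma>" for a using that LK by blast
    have v\<rho>: "insert v \<rho> \<in> K" "v \<in> {1..m}" "v \<notin> \<rho>" using v by (auto simp: V_def)
    have adj: "{v, a} \<in> K" if "a \<in> insert v \<sigma>0" for a
    proof (cases "a \<in> \<sigma>")
      case False
      then have "{v, a} \<subseteq> insert v \<rho>" using that by (auto simp: \<sigma>_def)
      then show ?thesis using simplicial_complex_onD(3)[OF K v\<rho>(1)] by blast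
    qed (rule adj\<sigma>)
    have "insert v \<sigma>0 \<in> K"
    proof (rule flag_complex_clique[OF K flag])
      show "insert v \<sigma>0 \<subseteq> {1..m}" using v\<rho> \<sigma>0m by auto
      fix x y assume xy: "x \<in> insert v \<sigma>0" "y \<in> insert v \<sigma>0"
      show "{x, y} \<in> K"
      proof (cases "x = v \<or> y = v")
        case True
        then show ?thesis using adj[OF xy(1)] adj[OF xy(2)] by (auto simp: insert_commute)
      next
        case False
        then show ?thesis using xy simplicial_complex_onD(3)[OF K \<sigma>0(1), of "{x, y}"] by auto
      qed
    qed
    moreover have "v \<notin> \<sigma>0" using v v\<rho> by (auto simp: \<sigma>_def)
    ultimately show False using card_face_le[OF K X, of "insert v \<sigma>0"] \<sigma>0(2) fin\<sigma>0 by simp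
  qed
  then obtain \<kappa> where \<kappa>: "\<And>v. v \<in> V - \<sigma> \<Longrightarrow> \<kappa> v \<in> \<sigma> \<and> {v, \<kappa> v} \<notin> L" by metis
  have "i + 1 \<le> n" if cov: "categorical_cover (moment_angle_complex m L) n Op" for n Op
  proof (rule ccontr)
    assume "\<not> i + 1 \<le> n"
    then have ni: "n \<le> i" by simp
    have "finite \<sigma>" using fin\<sigma>0 by (simp add: \<sigma>_def)
    then obtain e where e: "bij_betw e \<sigma> {..i}"
      using ex_bij_betw_finite_nat[of \<sigma>] c\<sigma> by (auto simp: atLeast0LessThan lessThan_Suc_atMost)
    show False
    \<comment> \<open>A cover with \<open>n + 1 \<le> i + 1\<close> sets is indexed by the
      \<open>i + 1\<close> elements of \<open>\<sigma>\<close>; \<open>min\<close> repeats its last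
      set for the surplus indices.\<close>
    proof (rule no_small_categorical_cover[OF L, of V F \<sigma> \<kappa> "\<lambda>a. Op (min (e a) n)"])
      show "V \<subseteq> {1..m}" by (auto simp: V_def)
      show "F \<subseteq> Pow V" by (auto simp: F_def)
      show "F \<subseteq> L" "\<sigma> \<in> F" by (fact FL \<sigma>F)+
      show "\<sigma> \<noteq> {}" using c\<sigma> by auto
      show "card S = card \<sigma>" if "S \<in> F" for S using that c\<sigma> by (simp add: F_def)
      show "topspace (moment_angle_complex m L) \<subseteq> (\<Union>a\<in>\<sigma>. Op (min (e a) n))"
      proof
        fix z assume "z \<in> topspace (moment_angle_complex m L)"
        then obtain k where k: "k \<le> n" "z \<in> Op k" using cov by (auto simp: categorical_cover_def)
        then have "k \<in> e ` \<sigma>" using ni bij_betw_imp_surj_on[OF e] by simp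
        then obtain a where "a \<in> \<sigma>" "e a = k" by blast
        then show "z \<in> (\<Union>a\<in>\<sigma>. Op (min (e a) n))" using k by (intro UN_I[of a]) (auto simp: min_def)
      qed
    qed (use ridge \<kappa> cov in \<open>auto simp: categorical_cover_def\<close>)
  qed
  then show ?thesis
    unfolding ls_cat_def by (intro Inf_greatest) auto
qed

theorem corollary5p25:
  fixes m d :: nat
    and K :: "nat set set"
    and M :: "'a topology"
  assumes "m \<ge> 1"
    and "closed_manifold d M"
    and "triangulation_of m K M"
    and "flag_complex m K"
  shows "(\<forall>L i j. simplicial_complex_on m L \<and> 1 \<le> i \<and> i \<le> j \<and> j \<le> d \<and>
              skeleton i K \<subseteq> L \<and> L \<subseteq> skeleton j K \<longrightarrow>
            enat (i + 1) \<le> ls_cat (moment_angle_complex m L) \<and>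
            ls_cat (moment_angle_complex m L) \<le> enat (j + 1)) \<and>
         (\<forall>i. 1 \<le> i \<and> i \<le> d \<longrightarrow>
            ls_cat (moment_angle_complex m (skeleton i K)) = enat (i + 1))"
proof -
  have K: "simplicial_complex_on m K" and hom: "geometric_realization m K homeomorphic_space M"
    using assms(3) by (auto simp: triangulation_of_def)
  have "locally_Euclidean d M"
    using assms(2) by (simp add: closed_manifold_def locally_Euclidean_def)
  then have X: "locally_Euclidean d (geometric_realization m K)"
    by (rule locally_Euclidean_homeomorphic[OF hom])
  have bounds: "enat (i + 1) \<le> ls_cat (moment_angle_complex m L) \<and> ls_cat (moment_angle_complex m L) \<le> enat (j + 1)"
    if "simplicial_complex_on m L" "1 \<le> i" "i \<le> j" "j \<le> d" "skeleton i K \<subseteq> L" "L \<subseteq> skeleton j K" for L i j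
  proof
    have "L \<subseteq> K" using that(6) by (auto simp: skeleton_def)
    then show "enat (i + 1) \<le> ls_cat (moment_angle_complex m L)"
      using that by (intro ls_cat_moment_angle_complex_ge[OF K X assms(1,4)]) auto
    show "ls_cat (moment_angle_complex m L) \<le> enat (j + 1)"
      using that(6) by (intro ls_cat_moment_angle_complex_le[OF that(1)]) (auto simp: skeleton_def)
  qed
  moreover have "simplicial_complex_on m (skeleton i K)" for i
  proof -
    have "card J \<le> i + 1" if "I \<in> K" "card I \<le> i + 1" "J \<subseteq> I" for I J
    proof -
      have "finite I" using simplicial_complex_onD(2)[OF K that(1)] finite_subset by blast
      then show ?thesis using card_mono[OF _ that(3)] that(2) by simp
    qed
    moreover have "{} \<in> skeleton i K" using simplicial_complex_onD(1)[OF K] by (simp add: skeleton_def)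
    ultimately show ?thesis
      using simplicial_complex_onD(2-4)[OF K] unfolding simplicial_complex_on_def skeleton_def by fastforce
  qed
  ultimately show ?thesis by (auto intro!: antisym)
qed

end
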